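(* Let $\hat{\mathbf M}=\mathbf M+\mathbf E$ be a symmetric $n\times n$ matrix with $\mathrm{rk}(\mathbf M)=k_0$, let $E_n=\|\mathbf E\|>0$, and let $\sigma_1\ge\dots\ge\sigma_{k_0}>0$ be the nonzero singular values of $\mathbf M$, with $\sigma_{k_0}>2E_n$. Let $\hat{\mathbf U}_g^{(k_0)}$ be the output of RSVD applied to $\hat{\mathbf M}$ with rank parameter $k_0$, power $g$, and sketching dimension $\tilde k$ with $n\ge\tilde k\ge(1-c_{\mathrm{gap}})^{-2}(k_0+\sqrt{24k_0\log n}+6\log n)$, where $c_{\mathrm{gap}}\in(0,1)$ is a fixed but arbitrary constant. Define $$g_*=\max\Bigl\{1+\frac{\log(nk_0/\tilde k)+\log\log n}{2\log(\frac12\sigma_{k_0}/E_n)},\ \frac13+\frac{\log(n^{3/2}/\tilde k)+\frac12\log\log n}{3\log(\frac12\sigma_{k_0}/E_n)},\ \frac12+\frac{\log(n^{3/2}\|\mathbf U^{(k_0)}\|_{2,\infty}/\tilde k)}{2\log(\frac12\sigma_{k_0}/E_n)}\Bigr\}.$$ Suppose also that $d_{2,\infty}(\hat{\mathbf U}^{(k_0)},\mathbf U^{(k_0)})\le\|\mathbf U^{(k_0)}\|_{2,\infty}$. Then: (i) for all $g\ge g_*$, with probability at least $1-5n^{-3}-2e^{-n/2}$, $$d_{2,\infty}(\hat{\mathbf U}_g^{(k_0)},\mathbf U^{(k_0)})\le d_{2,\infty}(\hat{\mathbf U}^{(k_0)},\mathbf U^{(k_0)})+O\bigl(n^{-1/2}E_n/\sigma_{k_0}\bigr),$$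 where the hidden factor depends only on $c_{\mathrm{gap}}$; (ii) for all $g\ge g_*$, with probability at least $1-9n^{-3}-2e^{-n/2}$, $$\|\hat{\mathbf U}_g^{(k_0)}\hat{\mathbf U}_g^{(k_0)\top}\hat{\mathbf M}-\mathbf M\|_{\max}\le\|\hat{\mathbf U}^{(k_0)}\hat{\mathbf U}^{(k_0)\top}\hat{\mathbf M}-\mathbf M\|_{\max}+O\bigl(\kappa n^{-1/2}E_n\|\mathbf U^{(k_0)}\|_{2,\infty}\bigr),$$ where $\kappa=\sigma_1/\sigma_{k_0}$ and the hidden factor depends only on $c_{\mathrm{gap}}$; (iii) if $\sigma_{k_0}=\omega(E_n)$, then the terms $O(n^{-1/2}E_n/\sigma_{k_0})$ and $O(\kappa n^{-1/2}E_n\|\mathbf U^{(k_0)}\|_{2,\infty})$ in (i) and (ii) can be replaced by $o(n^{-1/2}E_n/\sigma_{k_0})$ and $o(\kappa n^{-1/2}E_n\|\mathbf U^{(k_0)}\|_{2,\infty})$, respectively, provided $g\ge g_*+\Delta$, where $\Delta>0$ is any arbitrary constant; (iv) if $\sigma_{k_0}/E_n\succsim n^\epsilon$ for a fixed but arbitrary $\epsilon>0$, then the expression for $g_*$ above can be simplified to $$g_*=\max\Bigl\{1+\frac{\log(nk_0/\tilde k)}{2\log(\sigma_{k_0}/E_n)},\ \frac13+\frac{\log(n^{3/2}/\tilde k)}{3\log(\sigma_{k_0}/E_n)},\ \frac12+\frac{\log(n^{3/2}\|\mathbf U^{(k_0)}\|_{2,\infty}/\tilde k)}{2\log(\sigm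a_{k_0}/E_n)}\Bigr\}.$$
   Context: Notation: $\|\cdot\|$ is the spectral norm, $\|\mathbf N\|_{2,\infty}$ the maximum Euclidean norm of the rows of $\mathbf N$, $\|\mathbf N\|_{\max}$ the maximum absolute entry. For $\mathbf U_1,\mathbf U_2$ with $d$ orthonormal columns, $d_{2,\infty}(\mathbf U_1,\mathbf U_2)=\inf_{\mathbf W}\|\mathbf U_1-\mathbf U_2\mathbf W\|_{2,\infty}$, infimum over $d\times d$ orthogonal matrices. $\mathbf U^{(k_0)}$ and $\hat{\mathbf U}^{(k_0)}$ are the $n\times k_0$ matrices of left singular vectors for the $k_0$ largest singular values of $\mathbf M$ and $\hat{\mathbf M}$. Asymptotic notation is for $n\to\infty$ along a sequence of such problems: $a_n\succsim b_n$ means $a_n\ge cb_n$ for some constant $c>0$ and all large $n$; $a_n=\omega(b_n)$ means $b_n/a_n\to0$. RSVD of the symmetric matrix $\hat{\mathbf M}$ with rank $k_0$, sketching dimension $\tilde k\ge k_0$, power $g\ge1$ (an integer): draw $\mathbf G\in\mathbb R^{n\times\tilde k}$ with i.i.d. standard normal entries, form $\mathbf Y_g=\hat{\mathbf M}^g\mathbf G$, and let $\hat{\mathbf U}_g^{(k_0)}$ be the $n\times k_0$ matrix whose orthonormal columns are the $k_0$ leading left singular vectors of $\mathbf Y_g$. Probability is with respect to $\mathbf G$, with $\hat{\mathbf M}$ and $\mathbf M$ regarded as fixed.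
   Formalization: In (iv), the simplified expression is shown to equal g_* up to o(1); (i) and (ii) hold for g at least the simplified expression plus that o(1), and (iii) with it plus Δ. Exactly at the simplified value the O-bound in (i) can fail by a factor √(log n). *)

theory Defs
  imports
    "HOL-Probability.Probability"
    "HOL-Library.Landau_Symbols"
    "Jordan_Normal_Form.DL_Rank"
begin

section \<open>Matrix norms\<close>

definition l2_norm :: "real vec \<Rightarrow> real" where
  "l2_norm v = sqrt (scalar_prod v v)"

definition spectral_norm :: "real mat \<Rightarrow> real" where
  "spectral_norm A = (SUP v \<in> {v \<in> carrier_vec (dim_col A). l2_norm v \<le> 1}. l2_norm (A *\<^sub>v v))"

definition norm_2inf :: "real mat \<Rightarrow> real" where
  "norm_2inf A = Max ((\<lambda>i. l2_norm (Matrix.row A i)) ` {..<dim_row A})"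

definition norm_max :: "real mat \<Rightarrow> real" where
  "norm_max A = Max ((\<lambda>(i, j). \<bar>A $$ (i, j)\<bar>) ` ({..<dim_row A} \<times> {..<dim_col A}))"

text \<open>For a square matrix this says that the matrix is orthogonal in the usual sense
  (the library's \<^const>\<open>orthogonal_mat\<close> does not normalise the columns).\<close>

definition orthonormal_cols :: "real mat \<Rightarrow> bool" where
  "orthonormal_cols A \<longleftrightarrow> transpose_mat A * A = 1\<^sub>m (dim_col A)"

definition d_2inf :: "real mat \<Rightarrow> real mat \<Rightarrow> real" where
  "d_2inf U1 U2 =
     (INF W \<in> {W \<in> carrier_mat (dim_col U2) (dim_col U2). orthonormal_cols W}.
        norm_2inf (U1 - U2 * W))"

section \<open>Singular value decomposition\<close>

text \<open>A full decomposition \<open>A = U \<Sigma> V\<^sup>T\<close>. Singular values are numbered from 1, as usual in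
  the mathematical literature, so the \<open>i\<close>-th one stands at the matrix position \<open>(i-1, i-1)\<close>; the
  values of \<open>s\<close> outside \<open>{1..min (dim_row A) (dim_col A)}\<close> are irrelevant.\<close>

definition is_svd :: "real mat \<Rightarrow> real mat \<Rightarrow> (nat \<Rightarrow> real) \<Rightarrow> real mat \<Rightarrow> bool" where
  "is_svd A U s V \<longleftrightarrow>
     U \<in> carrier_mat (dim_row A) (dim_row A) \<and> orthonormal_cols U \<and>
     V \<in> carrier_mat (dim_col A) (dim_col A) \<and> orthonormal_cols V \<and>
     (\<forall>i \<in> {1..min (dim_row A) (dim_col A)}. 0 \<le> s i) \<and>
     antimono_on {1..min (dim_row A) (dim_col A)} s \<and>
     A = U * Matrix.mat (dim_row A) (dim_col A) (\<lambda>(i, j). if i = j then s (i + 1) else 0)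
           * transpose_mat V"

definition singular_values :: "real mat \<Rightarrow> (nat \<Rightarrow> real) \<Rightarrow> bool" where
  "singular_values A s \<longleftrightarrow> (\<exists>U V. is_svd A U s V)"

text \<open>Leading singular vectors are determined only up to the choice of a decomposition (signs,
  rotations within a singular space), hence a relation rather than a function.\<close>

definition leading_left_sv :: "nat \<Rightarrow> real mat \<Rightarrow> real mat \<Rightarrow> bool" where
  "leading_left_sv k A U \<longleftrightarrow>
     k \<le> min (dim_row A) (dim_col A) \<and>
     (\<exists>P s V. is_svd A P s V \<and> U = Matrix.mat (dim_row A) k (\<lambda>(i, j). P $$ (i, j)))"

section \<open>Randomized SVD\<close>

text \<open>Independent standard normal entries, indexed by the matrix positions; a sample point \<open>\<omega>\<close>
  stands for the \<open>n \<times> k\<close> matrix \<open>mat n k \<omega>\<close>.\<close>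

definition gaussian_entries :: "nat \<Rightarrow> nat \<Rightarrow> (nat \<times> nat \<Rightarrow> real) measure" where
  "gaussian_entries n k = PiM ({..<n} \<times> {..<k}) (\<lambda>_. std_normal_distribution)"

text \<open>The Gaussian \<open>n \<times> k\<close> matrix satisfies \<open>Q\<close> with probability at least \<open>p\<close>. For measurable
  \<open>Q\<close> this is \<open>p \<le> \<P>(Q)\<close>; the formulation through a measurable subset avoids making the
  measurability of \<open>Q\<close> a separate issue.\<close>

definition gaussian_prob_ge :: "nat \<Rightarrow> nat \<Rightarrow> real \<Rightarrow> (real mat \<Rightarrow> bool) \<Rightarrow> bool" where
  "gaussian_prob_ge n k p Q \<longleftrightarrow>
     (\<exists>A \<in> sets (gaussian_entries n k).
        p \<le> measure (gaussian_entries n k) A \<and> (\<forall>\<omega> \<in> A. Q (Matrix.mat n k \<omega>)))"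

definition rsvd_output :: "real mat \<Rightarrow> nat \<Rightarrow> nat \<Rightarrow> real mat \<Rightarrow> real mat \<Rightarrow> bool" where
  "rsvd_output Mhat k g G Ug \<longleftrightarrow> leading_left_sv k (Mhat ^\<^sub>m g * G) Ug"

record rsvd_problem =
  dim_n :: nat
  rank_k :: nat
  sketch_k :: nat
  signal :: "real mat"
  noise :: "real mat"
  sigma :: "nat \<Rightarrow> real"
  U_signal :: "real mat"
  U_hat :: "real mat"

definition observed :: "rsvd_problem \<Rightarrow> real mat" where
  "observed p = signal p + noise p"

definition noise_level :: "rsvd_problem \<Rightarrow> real" where
  "noise_level p = spectral_norm (noise p)"

definition sigma_min :: "rsvd_problem \<Rightarrow> real" where
  "sigma_min p = sigma p (rank_k p)"

definition cond_number :: "rsvd_problem \<Rightarrow> real" where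
  "cond_number p = sigma p 1 / sigma_min p"

text \<open>Only \<open>observed p\<close> is required to be symmetric, not its two summands.\<close>

definition valid_problem :: "real \<Rightarrow> rsvd_problem \<Rightarrow> bool" where
  "valid_problem c p \<longleftrightarrow>
     signal p \<in> carrier_mat (dim_n p) (dim_n p) \<and>
     noise p \<in> carrier_mat (dim_n p) (dim_n p) \<and>
     transpose_mat (observed p) = observed p \<and>
     1 \<le> rank_k p \<and> vec_space.rank (dim_n p) (signal p) = rank_k p \<and>
     singular_values (signal p) (sigma p) \<and>
     leading_left_sv (rank_k p) (signal p) (U_signal p) \<and>
     leading_left_sv (rank_k p) (observed p) (U_hat p) \<and>
     0 < noise_level p \<and> 2 * noise_level p < sigma_min p \<and>
     sketch_k p \<le> dim_n p \<and>
     (real (rank_k p) + sqrt (24 * real (rank_k p) * ln (real (dim_n p))) + 6 * ln (real (dim_n p)))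
        / (1 - c)\<^sup>2 \<le> real (sketch_k p) \<and>
     d_2inf (U_hat p) (U_signal p) \<le> norm_2inf (U_signal p)"

definition g_star :: "rsvd_problem \<Rightarrow> real" where
  "g_star p =
     (let n = real (dim_n p); k = real (rank_k p); kt = real (sketch_k p);
          u = norm_2inf (U_signal p); L = ln (1 / 2 * sigma_min p / noise_level p)
      in max (1 + (ln (n * k / kt) + ln (ln n)) / (2 * L))
           (max (1 / 3 + (ln (n powr (3 / 2) / kt) + 1 / 2 * ln (ln n)) / (3 * L))
                (1 / 2 + ln (n powr (3 / 2) * u / kt) / (2 * L))))"

text \<open>When \<open>sigma_min p / noise_level p\<close> grows at least like a power of \<open>n\<close>, this agrees with
  \<^const>\<open>g_star\<close> up to \<open>o(1)\<close>, but not exactly: at an integer \<open>g\<close> between the two thresholds, the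
  factor \<open>sqrt (ln n)\<close> paid for by the dropped \<open>ln (ln n)\<close> can really be present in the error.\<close>

definition g_star_simple :: "rsvd_problem \<Rightarrow> real" where
  "g_star_simple p =
     (let n = real (dim_n p); k = real (rank_k p); kt = real (sketch_k p);
          u = norm_2inf (U_signal p); L = ln (sigma_min p / noise_level p)
      in max (1 + ln (n * k / kt) / (2 * L))
           (max (1 / 3 + ln (n powr (3 / 2) / kt) / (3 * L))
                (1 / 2 + ln (n powr (3 / 2) * u / kt) / (2 * L))))"

definition subspace_rate :: "rsvd_problem \<Rightarrow> real" where
  "subspace_rate p = real (dim_n p) powr (- 1 / 2) * noise_level p / sigma_min p"

definition lowrank_rate :: "rsvd_problem \<Rightarrow> real" where
  "lowrank_rate p =
     cond_number p * real (dim_n p) powr (- 1 / 2) * noise_level p * norm_2inf (U_signal p)"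

text \<open>In the two bounds \<open>e\<close> is the additional error caused by the randomization. They are required
  for every admissible choice of the leading singular vectors of the sketch.\<close>

definition subspace_bound :: "rsvd_problem \<Rightarrow> nat \<Rightarrow> real \<Rightarrow> bool" where
  "subspace_bound p g e \<longleftrightarrow>
     gaussian_prob_ge (dim_n p) (sketch_k p)
       (1 - 5 * real (dim_n p) powr (- 3) - 2 * exp (- real (dim_n p) / 2))
       (\<lambda>G. \<forall>Ug. rsvd_output (observed p) (rank_k p) g G Ug \<longrightarrow>
          d_2inf Ug (U_signal p) \<le> d_2inf (U_hat p) (U_signal p) + e)"

definition lowrank_bound :: "rsvd_problem \<Rightarrow> nat \<Rightarrow> real \<Rightarrow> bool" where
  "lowrank_bound p g e \<longleftrightarrow>
     gaussian_prob_ge (dim_n p) (sketch_k p)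
       (1 - 9 * real (dim_n p) powr (- 3) - 2 * exp (- real (dim_n p) / 2))
       (\<lambda>G. \<forall>Ug. rsvd_output (observed p) (rank_k p) g G Ug \<longrightarrow>
          norm_max (Ug * transpose_mat Ug * observed p - signal p)
            \<le> norm_max (U_hat p * transpose_mat (U_hat p) * observed p - signal p) + e)"

definition problem_sequence :: "real \<Rightarrow> (nat \<Rightarrow> rsvd_problem) \<Rightarrow> bool" where
  "problem_sequence c P \<longleftrightarrow>
     (\<forall>i. valid_problem c (P i)) \<and> filterlim (\<lambda>i. dim_n (P i)) at_top sequentially"

end

theory Submission
  imports Defs
begin

text \<open>Let \<open>\<Pi>\<close> be the orthogonal projection to the range of \<open>U_hat\<close>. It commutes with the symmetric
  observed matrix \<open>H\<close>, which expands the range of \<open>\<Pi>\<close> by at least \<open>\<sigma>/2\<close> and its complement by at most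
  \<open>E\<close>. Hence for the leading left singular vectors \<open>Q\<close> of the sketch \<open>Y = H\<^sup>g G\<close>, with right singular
  vectors \<open>W\<close> and singular values \<open>S\<close>, one has \<open>Q = U_hat (U_hat\<^sup>T Q) + (1 - \<Pi>) Y W S\<^sup>-\<^sup>1\<close>. The matrix
  \<open>U_hat\<^sup>T Q\<close> is orthogonal up to the square of the sine of the angle, which gives the third term of the
  threshold \<open>g_star\<close>. In the second summand \<open>W\<close> is split along the row space of \<open>U_hat\<^sup>T G\<close>: the part inside
  only involves inner products of the rows of \<open>U_hat\<^sup>T G\<close> with the independent Gaussian vectors
  \<open>G\<^sup>T H\<^sup>g (1 - \<Pi>) e\<^sub>i\<close> (first term of the threshold), the part outside is again quadratic in the angle (second term).

  The random matrix \<open>G\<close> enters only through norms \<open>\<parallel>G\<^sup>T z\<parallel>\<close> of fixed vectors \<open>z\<close>, whose squares are chi-square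
  distributed: operator norms and the smallest singular value are reduced to them by nets, inner products by
  polarization. Since the constant may depend on \<open>c_gap\<close>, the smallest singular value of \<open>U_hat\<^sup>T G\<close> can be
  bounded by the small ball probability of the chi-square distribution, without Gaussian comparison
  inequalities.\<close>

unbundle no inner_syntax and no vec_syntax

section \<open>Euclidean norms and norm bounds\<close>

lemma l2_norm_L2_set: "l2_norm v = L2_set (\<lambda>i. v $ i) {..<dim_vec v}"
  unfolding l2_norm_def scalar_prod_def L2_set_def
  by (simp add: atLeast0LessThan power2_eq_square)

lemma l2_norm_nonneg [simp]: "0 \<le> l2_norm v"
  by (simp add: l2_norm_L2_set L2_set_nonneg)

lemma scalar_prod_self_nonneg [simp]: "0 \<le> v \<bullet> (v :: real vec)"
  unfolding scalar_prod_def by (auto intro!: sum_nonneg)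

lemma l2_norm_square: "(l2_norm v)\<^sup>2 = v \<bullet> v"
  by (simp add: l2_norm_def)

lemma l2_norm_zero [simp]: "l2_norm (0\<^sub>v n) = 0"
  by (simp add: l2_norm_def)

lemma l2_norm_eq_0: "v \<in> carrier_vec n \<Longrightarrow> l2_norm v = 0 \<longleftrightarrow> v = 0\<^sub>v n"
  by (auto simp: l2_norm_L2_set L2_set_eq_0_iff)

lemma l2_norm_smult [simp]: "l2_norm (a \<cdot>\<^sub>v v) = \<bar>a\<bar> * l2_norm v"
proof -
  have "l2_norm (a \<cdot>\<^sub>v v) = L2_set (\<lambda>i. a * v $ i) {..<dim_vec v}"
    unfolding l2_norm_L2_set by (intro L2_set_cong) auto
  also have "\<dots> = \<bar>a\<bar> * l2_norm v"
    unfolding l2_norm_L2_set L2_set_def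
    by (simp add: power_mult_distrib sum_distrib_left[symmetric] real_sqrt_mult)
  finally show ?thesis .
qed

lemma l2_norm_uminus [simp]: "l2_norm (- v) = l2_norm v"
  unfolding l2_norm_L2_set by (simp add: L2_set_def)

lemma l2_norm_triangle:
  assumes "v \<in> carrier_vec n" "w \<in> carrier_vec n"
  shows "l2_norm (v + w) \<le> l2_norm v + l2_norm w"
proof -
  have "l2_norm (v + w) = L2_set (\<lambda>i. v $ i + w $ i) {..<n}"
    unfolding l2_norm_L2_set using assms by (intro L2_set_cong) auto
  also have "\<dots> \<le> l2_norm v + l2_norm w"
    unfolding l2_norm_L2_set using L2_set_triangle_ineq assms by auto
  finally show ?thesis .
qed

lemma l2_norm_triangle_diff:
  assumes "v \<in> carrier_vec n" "w \<in> carrier_vec n"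
  shows "l2_norm (v - w) \<le> l2_norm v + l2_norm w"
  using l2_norm_triangle[of v n "- w"] assms by (simp add: minus_add_uminus_vec)

lemma l2_norm_diff_ge:
  assumes "v \<in> carrier_vec n" "w \<in> carrier_vec n"
  shows "l2_norm v - l2_norm w \<le> l2_norm (v + w)"
proof -
  have "v = (v + w) - w" using assms by auto
  thus ?thesis using l2_norm_triangle_diff[of "v + w" n w] assms by auto
qed

lemma scalar_prod_le_l2_norm:
  assumes "v \<in> carrier_vec n" "w \<in> carrier_vec n"
  shows "\<bar>v \<bullet> w\<bar> \<le> l2_norm v * l2_norm w"
proof -
  have "\<bar>v \<bullet> w\<bar> \<le> (\<Sum>i<n. \<bar>v $ i\<bar> * \<bar>w $ i\<bar>)"
    unfolding scalar_prod_def using assms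
    by (auto simp: abs_mult atLeast0LessThan intro: order.trans[OF sum_abs])
  also have "\<dots> \<le> l2_norm v * l2_norm w"
    unfolding l2_norm_L2_set using L2_set_mult_ineq assms by auto
  finally show ?thesis .
qed

lemma l2_norm_add_square:
  assumes "v \<in> carrier_vec n" "w \<in> carrier_vec n"
  shows "(l2_norm (v + w))\<^sup>2 = (l2_norm v)\<^sup>2 + 2 * (v \<bullet> w) + (l2_norm w)\<^sup>2"
  unfolding l2_norm_square using assms
  by (simp add: add_scalar_prod_distrib[of _ n] scalar_prod_add_distrib[of _ n] comm_scalar_prod[of w n v])

lemma l2_norm_diff_square:
  assumes "v \<in> carrier_vec n" "w \<in> carrier_vec n"
  shows "(l2_norm (v - w))\<^sup>2 = (l2_norm v)\<^sup>2 - 2 * (v \<bullet> w) + (l2_norm w)\<^sup>2"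
  unfolding l2_norm_square using assms
  by (simp add: minus_scalar_prod_distrib[of _ n] scalar_prod_minus_distrib[of _ n] comm_scalar_prod[of w n v])

lemma abs_index_le_l2_norm: "i < dim_vec v \<Longrightarrow> \<bar>v $ i\<bar> \<le> l2_norm v"
  unfolding l2_norm_L2_set
  using member_le_L2_set[of "{..<dim_vec v}" i "\<lambda>i. \<bar>v $ i\<bar>"] by (simp add: L2_set_def)

lemma scalar_prod_mult_mat_vec:
  fixes A :: "real mat"
  assumes "A \<in> carrier_mat m n" "x \<in> carrier_vec m" "y \<in> carrier_vec n"
  shows "x \<bullet> (A *\<^sub>v y) = (A\<^sup>T *\<^sub>v x) \<bullet> y"
  using transpose_vec_mult_scalar[OF assms(1,3,2)] by simp

definition norm_bound :: "real mat \<Rightarrow> real \<Rightarrow> bool" where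
  "norm_bound A \<beta> \<longleftrightarrow> (\<forall>x \<in> carrier_vec (dim_col A). l2_norm (A *\<^sub>v x) \<le> \<beta> * l2_norm x)"

lemma norm_boundD: "norm_bound A \<beta> \<Longrightarrow> A \<in> carrier_mat m n \<Longrightarrow> x \<in> carrier_vec n \<Longrightarrow>
    l2_norm (A *\<^sub>v x) \<le> \<beta> * l2_norm x"
  unfolding norm_bound_def by auto

lemma norm_boundI: "A \<in> carrier_mat m n \<Longrightarrow>
    (\<And>x. x \<in> carrier_vec n \<Longrightarrow> l2_norm (A *\<^sub>v x) \<le> \<beta> * l2_norm x) \<Longrightarrow> norm_bound A \<beta>"
  unfolding norm_bound_def by auto

lemma norm_bound_mono: "norm_bound A \<beta> \<Longrightarrow> \<beta> \<le> \<gamma> \<Longrightarrow> norm_bound A \<gamma>"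
  unfolding norm_bound_def by (meson l2_norm_nonneg mult_right_mono order.trans)

lemma l2_norm_le_frobenius:
  assumes "A \<in> carrier_mat m n" "x \<in> carrier_vec n"
  shows "l2_norm (A *\<^sub>v x) \<le> L2_set (\<lambda>i. l2_norm (row A i)) {..<m} * l2_norm x"
proof -
  have "l2_norm (A *\<^sub>v x) = L2_set (\<lambda>i. row A i \<bullet> x) {..<m}"
    unfolding l2_norm_L2_set using assms by (intro L2_set_cong) auto
  also have "\<dots> = L2_set (\<lambda>i. \<bar>row A i \<bullet> x\<bar>) {..<m}" by (simp add: L2_set_def)
  also have "\<dots> \<le> L2_set (\<lambda>i. l2_norm (row A i) * l2_norm x) {..<m}"
    using assms by (intro L2_set_mono scalar_prod_le_l2_norm[of _ n]) auto
  also have "\<dots> = L2_set (\<lambda>i. l2_norm (row A i)) {..<m} * l2_norm x"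
    by (simp add: L2_set_left_distrib)
  finally show ?thesis .
qed

lemma norm_bound_exists: "\<exists>\<beta>\<ge>0. norm_bound A \<beta>"
  using l2_norm_le_frobenius[of A "dim_row A" "dim_col A"]
  by (intro exI[of _ "L2_set (\<lambda>i. l2_norm (row A i)) {..<dim_row A}"])
     (auto intro!: norm_boundI L2_set_nonneg)

lemma norm_bound_transpose:
  assumes "norm_bound A \<beta>" "0 \<le> \<beta>"
  shows "norm_bound (A\<^sup>T) \<beta>"
proof (rule norm_boundI)
  show A': "A\<^sup>T \<in> carrier_mat (dim_col A) (dim_row A)" by simp
  fix x :: "real vec" assume x: "x \<in> carrier_vec (dim_row A)"
  let ?y = "A\<^sup>T *\<^sub>v x"
  have A: "A \<in> carrier_mat (dim_row A) (dim_col A)" by simp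
  have y: "?y \<in> carrier_vec (dim_col A)" by (rule mult_mat_vec_carrier[OF A' x])
  have "(l2_norm ?y)\<^sup>2 = x \<bullet> (A *\<^sub>v ?y)"
    using scalar_prod_mult_mat_vec[OF A x y] by (simp add: l2_norm_square)
  also have "\<dots> \<le> l2_norm x * l2_norm (A *\<^sub>v ?y)"
    using scalar_prod_le_l2_norm[OF x, of "A *\<^sub>v ?y"] mult_mat_vec_carrier[OF A y] by auto
  also have "\<dots> \<le> l2_norm x * (\<beta> * l2_norm ?y)"
    by (intro mult_left_mono norm_boundD[OF assms(1) A y]) simp
  finally have *: "l2_norm ?y * l2_norm ?y \<le> (\<beta> * l2_norm x) * l2_norm ?y"
    by (simp add: power2_eq_square ac_simps)
  show "l2_norm ?y \<le> \<beta> * l2_norm x"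
  proof (cases "l2_norm ?y = 0")
    case False
    hence "0 < l2_norm ?y" using l2_norm_nonneg[of ?y] by linarith
    thus ?thesis using * by simp
  qed (simp add: assms(2))
qed

lemma mult_mat_vec_zero:
  assumes "(A :: real mat) \<in> carrier_mat m n"
  shows "A *\<^sub>v 0\<^sub>v n = 0\<^sub>v m"
  using assms by (intro eq_vecI) (auto intro!: scalar_prod_right_zero[of _ n])

lemma norm_bound_spectral_norm: "norm_bound A (spectral_norm A)"
proof (rule norm_boundI)
  show A: "A \<in> carrier_mat (dim_row A) (dim_col A)" by simp
  fix x :: "real vec" assume x: "x \<in> carrier_vec (dim_col A)"
  let ?S = "{v \<in> carrier_vec (dim_col A). l2_norm v \<le> 1}"
  obtain \<beta> where \<beta>: "0 \<le> \<beta>" "norm_bound A \<beta>" using norm_bound_exists by auto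
  have bdd: "bdd_above ((\<lambda>v. l2_norm (A *\<^sub>v v)) ` ?S)"
  proof (rule bdd_aboveI2)
    fix v assume "v \<in> ?S"
    thus "l2_norm (A *\<^sub>v v) \<le> \<beta>"
      using norm_boundD[OF \<beta>(2) A, of v] mult_left_mono[of "l2_norm v" 1 \<beta>] \<beta>(1) by auto
  qed
  show "l2_norm (A *\<^sub>v x) \<le> spectral_norm A * l2_norm x"
  proof (cases "l2_norm x = 0")
    case True
    hence "x = 0\<^sub>v (dim_col A)" using l2_norm_eq_0 x by auto
    hence "A *\<^sub>v x = 0\<^sub>v (dim_row A)" using mult_mat_vec_zero[OF A] by simp
    thus ?thesis using True by simp
  next
    case False
    hence pos: "0 < l2_norm x" using l2_norm_nonneg[of x] by linarith
    let ?v = "(1 / l2_norm x) \<cdot>\<^sub>v x"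
    have "l2_norm (A *\<^sub>v ?v) \<le> spectral_norm A"
      unfolding spectral_norm_def using x pos by (intro cSUP_upper bdd) auto
    moreover have "A *\<^sub>v ?v = (1 / l2_norm x) \<cdot>\<^sub>v (A *\<^sub>v x)"
      using mult_mat_vec[OF A x] by simp
    ultimately show ?thesis using pos by (simp add: field_simps)
  qed
qed

lemma norm_bound_mult:
  assumes "A \<in> carrier_mat m n" "B \<in> carrier_mat n l" "norm_bound A \<alpha>" "norm_bound B \<beta>" "0 \<le> \<alpha>"
  shows "norm_bound (A * B) (\<alpha> * \<beta>)"
proof (rule norm_boundI)
  show "A * B \<in> carrier_mat m l" using assms by auto
  fix x :: "real vec" assume x: "x \<in> carrier_vec l"
  have "l2_norm ((A * B) *\<^sub>v x) = l2_norm (A *\<^sub>v (B *\<^sub>v x))" using assms x by simp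
  also have "\<dots> \<le> \<alpha> * l2_norm (B *\<^sub>v x)"
    using assms x by (intro norm_boundD[OF assms(3,1)]) auto
  also have "\<dots> \<le> \<alpha> * (\<beta> * l2_norm x)"
    using assms x by (intro mult_left_mono norm_boundD[OF assms(4,2)]) auto
  finally show "l2_norm ((A * B) *\<^sub>v x) \<le> \<alpha> * \<beta> * l2_norm x" by simp
qed

lemma norm_bound_add:
  assumes "A \<in> carrier_mat m n" "B \<in> carrier_mat m n" "norm_bound A \<alpha>" "norm_bound B \<beta>"
  shows "norm_bound (A + B) (\<alpha> + \<beta>)"
proof (rule norm_boundI)
  show "A + B \<in> carrier_mat m n" using assms by auto
  fix x :: "real vec" assume x: "x \<in> carrier_vec n"
  have "l2_norm ((A + B) *\<^sub>v x) \<le> l2_norm (A *\<^sub>v x) + l2_norm (B *\<^sub>v x)"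
    using assms x l2_norm_triangle[of "A *\<^sub>v x" m "B *\<^sub>v x"]
    by (auto simp: add_mult_distrib_mat_vec[of _ m n])
  also have "\<dots> \<le> \<alpha> * l2_norm x + \<beta> * l2_norm x"
    using norm_boundD[OF assms(3,1) x] norm_boundD[OF assms(4,2) x] by simp
  finally show "l2_norm ((A + B) *\<^sub>v x) \<le> (\<alpha> + \<beta>) * l2_norm x" by (simp add: algebra_simps)
qed

lemma norm_bound_smult:
  assumes "norm_bound A \<alpha>"
  shows "norm_bound (c \<cdot>\<^sub>m A) (\<bar>c\<bar> * \<alpha>)"
proof (rule norm_boundI)
  show "c \<cdot>\<^sub>m A \<in> carrier_mat (dim_row A) (dim_col A)" by auto
  fix x :: "real vec" assume x: "x \<in> carrier_vec (dim_col A)"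
  have A: "A \<in> carrier_mat (dim_row A) (dim_col A)" by simp
  have "(c \<cdot>\<^sub>m A) *\<^sub>v x = c \<cdot>\<^sub>v (A *\<^sub>v x)" using x by (intro eq_vecI) auto
  thus "l2_norm ((c \<cdot>\<^sub>m A) *\<^sub>v x) \<le> \<bar>c\<bar> * \<alpha> * l2_norm x"
    using mult_left_mono[OF norm_boundD[OF assms A x], of "\<bar>c\<bar>"] by (simp add: mult.assoc)
qed

lemma norm_bound_one: "norm_bound (1\<^sub>m n) 1"
  by (rule norm_boundI[of _ n n]) auto

lemma abs_index_le_norm_bound:
  assumes "A \<in> carrier_mat m n" "norm_bound A \<beta>" "i < m" "j < n"
  shows "\<bar>A $$ (i, j)\<bar> \<le> \<beta>"
proof -
  have "A $$ (i, j) = (A *\<^sub>v unit_vec n j) $ i"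
    using assms(1,3,4) by (auto simp: scalar_prod_right_unit)
  moreover have "\<bar>(A *\<^sub>v unit_vec n j) $ i\<bar> \<le> l2_norm (A *\<^sub>v unit_vec n j)"
    using assms by (intro abs_index_le_l2_norm) auto
  moreover have "l2_norm (unit_vec n j) = 1"
    using assms(4) by (simp add: l2_norm_def)
  ultimately show ?thesis
    using norm_boundD[OF assms(2,1), of "unit_vec n j"] by auto
qed

section \<open>Singular values\<close>

lemma orthonormal_colsD:
  assumes "orthonormal_cols U" "U \<in> carrier_mat n k"
  shows "U\<^sup>T * U = 1\<^sub>m k"
  using assms unfolding orthonormal_cols_def by auto

lemma orthonormal_cols_transpose_mult_vec:
  assumes "orthonormal_cols U" "U \<in> carrier_mat n k" "x \<in> carrier_vec k"
  shows "U\<^sup>T *\<^sub>v (U *\<^sub>v x) = x"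
  using assoc_mult_mat_vec[of "U\<^sup>T" k n U k x] assms orthonormal_colsD[OF assms(1,2)]
  by auto

lemma orthonormal_cols_scalar_prod:
  assumes "orthonormal_cols U" "U \<in> carrier_mat n k" "x \<in> carrier_vec k" "y \<in> carrier_vec k"
  shows "(U *\<^sub>v x) \<bullet> (U *\<^sub>v y) = x \<bullet> y"
  using scalar_prod_mult_mat_vec[OF assms(2), of "U *\<^sub>v x" y] assms
    orthonormal_cols_transpose_mult_vec[OF assms(1,2,3)] by auto

lemma orthonormal_cols_l2_norm:
  assumes "orthonormal_cols U" "U \<in> carrier_mat n k" "x \<in> carrier_vec k"
  shows "l2_norm (U *\<^sub>v x) = l2_norm x"
  using orthonormal_cols_scalar_prod[OF assms(1,2,3,3)] by (simp add: l2_norm_def)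

lemma orthonormal_cols_norm_bound:
  assumes "orthonormal_cols U"
  shows "norm_bound U 1" "norm_bound (U\<^sup>T) 1"
proof -
  show "norm_bound U 1"
    by (rule norm_boundI[of U "dim_row U" "dim_col U"])
       (auto simp: orthonormal_cols_l2_norm[OF assms, of "dim_row U" "dim_col U"])
  thus "norm_bound (U\<^sup>T) 1" by (rule norm_bound_transpose) simp
qed

lemma orthonormal_cols_mult:
  assumes "orthonormal_cols U" "U \<in> carrier_mat n k" "orthonormal_cols W" "W \<in> carrier_mat k l"
  shows "orthonormal_cols (U * W)"
proof -
  have "transpose_mat (U * W) * (U * W) = W\<^sup>T * (U\<^sup>T * (U * W))"
    using assms by (simp add: transpose_mult[OF assms(2,4)] assoc_mult_mat[of _ l k _ n _ l])
  also have "U\<^sup>T * (U * W) = (U\<^sup>T * U) * W"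
    using assms by (simp add: assoc_mult_mat[of _ k n _ k _ l])
  also have "\<dots> = W" using assms by (simp add: orthonormal_colsD[OF assms(1,2)])
  finally show ?thesis using assms by (simp add: orthonormal_cols_def)
qed

lemma orthonormal_cols_one: "orthonormal_cols (1\<^sub>m n)"
  by (simp add: orthonormal_cols_def)

lemma orthonormal_square_right_inverse:
  assumes "orthonormal_cols U" "U \<in> carrier_mat n n"
  shows "U * U\<^sup>T = 1\<^sub>m n"
  using assms mat_mult_left_right_inverse[of "U\<^sup>T" n U] orthonormal_colsD[OF assms]
  by auto

lemma orthonormal_square_transpose:
  assumes "orthonormal_cols U" "U \<in> carrier_mat n n"
  shows "orthonormal_cols (U\<^sup>T)"
  using orthonormal_square_right_inverse[OF assms] assms by (simp add: orthonormal_cols_def)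

definition take_cols :: "nat \<Rightarrow> real mat \<Rightarrow> real mat" where
  "take_cols k P = Matrix.mat (dim_row P) k (\<lambda>(i, j). P $$ (i, j))"

lemma take_cols_carrier [simp, intro]: "P \<in> carrier_mat m n \<Longrightarrow> take_cols k P \<in> carrier_mat m k"
  unfolding take_cols_def by auto

lemma dim_take_cols [simp]: "dim_row (take_cols k P) = dim_row P" "dim_col (take_cols k P) = k"
  unfolding take_cols_def by auto

lemma col_take_cols: "P \<in> carrier_mat m n \<Longrightarrow> j < k \<Longrightarrow> k \<le> n \<Longrightarrow> col (take_cols k P) j = col P j"
  unfolding take_cols_def by (intro eq_vecI) auto

lemma orthonormal_take_cols:
  assumes "orthonormal_cols P" "P \<in> carrier_mat m n" "k \<le> n"
  shows "orthonormal_cols (take_cols k P)"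
  unfolding orthonormal_cols_def
proof (rule eq_matI)
  fix i j assume "i < dim_row (1\<^sub>m (dim_col (take_cols k P)) :: real mat)"
    "j < dim_col (1\<^sub>m (dim_col (take_cols k P)) :: real mat)"
  hence ij: "i < k" "j < k" by auto
  have "(transpose_mat (take_cols k P) * take_cols k P) $$ (i, j) = col (take_cols k P) i \<bullet> col (take_cols k P) j"
    using ij by auto
  also have "\<dots> = (P\<^sup>T * P) $$ (i, j)"
    using ij assms by (auto simp: col_take_cols[OF assms(2)])
  also have "\<dots> = 1\<^sub>m k $$ (i, j)"
    using ij assms(3) by (simp add: orthonormal_colsD[OF assms(1,2)])
  finally show "(transpose_mat (take_cols k P) * take_cols k P) $$ (i, j)
      = 1\<^sub>m (dim_col (take_cols k P)) $$ (i, j)" by simp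
qed auto

lemma take_cols_transpose_mult_vec:
  assumes "P \<in> carrier_mat m n" "k \<le> n" "i < k" "x \<in> carrier_vec m"
  shows "(transpose_mat (take_cols k P) *\<^sub>v x) $ i = (P\<^sup>T *\<^sub>v x) $ i"
  using assms by (simp add: col_take_cols[OF assms(1)])

lemma take_cols_complement_zero:
  assumes P: "P \<in> carrier_mat n n" "orthonormal_cols P" and k: "k \<le> n" and i: "k \<le> i" "i < n"
    and y: "y \<in> carrier_vec k"
  shows "(P\<^sup>T *\<^sub>v (take_cols k P *\<^sub>v y)) $ i = 0"
proof -
  let ?U = "take_cols k P"
  have U: "?U \<in> carrier_mat n k" using P by auto
  have Uy: "?U *\<^sub>v y \<in> carrier_vec n" using U y by auto
  have "(P\<^sup>T *\<^sub>v (?U *\<^sub>v y)) $ i = unit_vec n i \<bullet> (P\<^sup>T *\<^sub>v (?U *\<^sub>v y))"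
    using i P Uy by (simp add: scalar_prod_left_unit)
  also have "\<dots> = (P *\<^sub>v unit_vec n i) \<bullet> (?U *\<^sub>v y)"
    using scalar_prod_mult_mat_vec[of "P\<^sup>T" n n "unit_vec n i" "?U *\<^sub>v y"] P Uy by auto
  also have "\<dots> = (?U\<^sup>T *\<^sub>v (P *\<^sub>v unit_vec n i)) \<bullet> y"
    using scalar_prod_mult_mat_vec[OF U, of "P *\<^sub>v unit_vec n i" y] P y by auto
  also have "?U\<^sup>T *\<^sub>v (P *\<^sub>v unit_vec n i) = 0\<^sub>v k"
  proof (rule eq_vecI)
    fix j assume "j < dim_vec (0\<^sub>v k :: real vec)"
    hence j: "j < k" by simp
    have "(?U\<^sup>T *\<^sub>v (P *\<^sub>v unit_vec n i)) $ j = (P\<^sup>T *\<^sub>v (P *\<^sub>v unit_vec n i)) $ j"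
      using j k P by (intro take_cols_transpose_mult_vec[OF P(1)]) auto
    also have "\<dots> = unit_vec n i $ j"
      using orthonormal_cols_transpose_mult_vec[OF P(2,1), of "unit_vec n i"] by simp
    finally show "(?U\<^sup>T *\<^sub>v (P *\<^sub>v unit_vec n i)) $ j = 0\<^sub>v k $ j"
      using j i by simp
  qed auto
  finally show ?thesis using y by simp
qed

lemma underdetermined_system:
  assumes "(C :: real mat) \<in> carrier_mat r m" "r < m"
  obtains v where "v \<in> carrier_vec m" "v \<noteq> 0\<^sub>v m" "C *\<^sub>v v = 0\<^sub>v r"
proof -
  define D where "D = Matrix.mat m m (\<lambda>(i, j). if i < r then C $$ (i, j) else 0)"
  have D: "D \<in> carrier_mat m m" by (simp add: D_def)
  have "row D r = 0\<^sub>v m" using assms(2) by (intro eq_vecI) (auto simp: D_def)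
  hence "D\<^sup>T *\<^sub>v unit_vec m r = 0\<^sub>v m"
    using D assms(2) by (intro eq_vecI) (auto simp: D_def scalar_prod_right_unit)
  hence "det (D\<^sup>T) = 0"
    using D assms(2) det_0_iff_vec_prod_zero[of "D\<^sup>T" m]
    by (metis transpose_carrier_mat unit_vec_carrier unit_vec_nonzero)
  hence "det D = 0" using det_transpose[OF D] by simp
  then obtain v where v: "v \<in> carrier_vec m" "v \<noteq> 0\<^sub>v m" "D *\<^sub>v v = 0\<^sub>v m"
    using det_0_iff_vec_prod_zero[OF D] by auto
  have "C *\<^sub>v v = 0\<^sub>v r"
  proof (rule eq_vecI)
    fix i assume "i < dim_vec (0\<^sub>v r :: real vec)"
    hence i: "i < r" by simp
    have "row D i = row C i" using i assms by (intro eq_vecI) (auto simp: D_def)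
    hence "(C *\<^sub>v v) $ i = (D *\<^sub>v v) $ i" using i assms D by auto
    thus "(C *\<^sub>v v) $ i = 0\<^sub>v r $ i" using v(3) i assms(2) by simp
  qed (use assms in auto)
  thus thesis using v that by blast
qed

context vec_space
begin

lemma rank_factorization:
  assumes A: "A \<in> carrier_mat n nc"
  shows "\<exists>F C. F \<in> carrier_mat n (rank A) \<and> C \<in> carrier_mat (rank A) nc \<and> A = F * C"
proof -
  obtain S where S: "maximal S (\<lambda>T. T \<subseteq> set (cols A) \<and> lin_indpt T)"
    using maximal_exists_superset[of "set (cols A)" "(\<lambda>T. T \<subseteq> set (cols A) \<and> lin_indpt T)" "{}"]
    by (auto simp: lin_dep_def)
  have Ss: "S \<subseteq> set (cols A)" and ind: "lin_indpt S" using S by (auto simp: maximal_def)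
  have fin: "finite S" using Ss finite_subset by auto
  have Sc: "S \<subseteq> carrier_vec n" using Ss cols_dim[of A] A by auto
  have rk: "rank A = card S" using rank_card_indpt[OF A S] .
  obtain bs where bs: "set bs = S" "distinct bs" using finite_distinct_list[OF fin] by auto
  define F where "F = mat_of_cols n bs"
  have len: "length bs = card S" using bs distinct_card by metis
  have F: "F \<in> carrier_mat n (card S)" unfolding F_def using len by (auto simp: mat_of_cols_def)
  have cF: "cols F = bs" unfolding F_def using bs Sc by (intro cols_mat_of_cols) auto
  have ex: "\<exists>w \<in> carrier_vec (card S). col A j = F *\<^sub>v w" if j: "j < nc" for j
  proof -
    have cj: "col A j \<in> set (cols A)" using A j by (auto simp: cols_def)
    have cjc: "col A j \<in> carrier_vec n" using A j by auto
    have "col A j \<in> span S"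
    proof (rule ccontr)
      assume not: "col A j \<notin> span S"
      hence "col A j \<notin> S" using in_own_span[OF Sc] by auto
      moreover have "lin_indpt (insert (col A j) S)"
        using lin_dep_iff_in_span[OF Sc ind cjc] not calculation by auto
      ultimately show False using S Ss cj unfolding maximal_def by blast
    qed
    then obtain a where a: "lincomb a S = col A j" using finite_in_span[OF fin Sc] by metis
    have "F *\<^sub>v (Matrix.vec (card S) (\<lambda>i. a (col F i))) = lincomb a (set (cols F))"
      using F cF bs by (intro mat_mult_eq_lincomb) auto
    thus ?thesis using a cF bs by (intro bexI[of _ "Matrix.vec (card S) (\<lambda>i. a (col F i))"]) auto
  qed
  then obtain w where w: "\<And>j. j < nc \<Longrightarrow> w j \<in> carrier_vec (card S) \<and> col A j = F *\<^sub>v w j" by metis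
  define C where "C = Matrix.mat (card S) nc (\<lambda>(i, j). w j $ i)"
  have C: "C \<in> carrier_mat (card S) nc" by (simp add: C_def)
  have "A = F * C"
  proof (rule eq_matI)
    fix i j assume "i < dim_row (F * C)" "j < dim_col (F * C)"
    hence ij: "i < n" "j < nc" using F C by auto
    have "col C j = w j" using w[OF ij(2)] ij by (intro eq_vecI) (auto simp: C_def)
    hence "(F * C) $$ (i, j) = (F *\<^sub>v w j) $ i" using F C ij by auto
    also have "\<dots> = A $$ (i, j)" using w[OF ij(2)] A ij by (metis carrier_matD index_col)
    finally show "A $$ (i, j) = (F * C) $$ (i, j)" by simp
  qed (use A F C in auto)
  thus ?thesis using F C rk by metis
qed

end

lemma is_svd_carriers:
  assumes "is_svd A U s V" "A \<in> carrier_mat m n"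
  shows "U \<in> carrier_mat m m" "orthonormal_cols U" "V \<in> carrier_mat n n" "orthonormal_cols V"
    and is_svd_nonneg: "\<And>i. 1 \<le> i \<Longrightarrow> i \<le> min m n \<Longrightarrow> 0 \<le> s i"
    and is_svd_antimono: "\<And>i j. 1 \<le> i \<Longrightarrow> i \<le> j \<Longrightarrow> j \<le> min m n \<Longrightarrow> s j \<le> s i"
  using assms unfolding is_svd_def by (auto simp: monotone_on_def)

lemma is_svd_transpose:
  assumes "is_svd A U s V" "A \<in> carrier_mat m n"
  shows "is_svd (A\<^sup>T) V s U"
proof -
  note c = is_svd_carriers[OF assms]
  let ?S = "Matrix.mat m n (\<lambda>(i, j). if i = j then s (i + 1) else 0)"
  have "A = U * ?S * V\<^sup>T" using assms unfolding is_svd_def by auto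
  hence "A\<^sup>T = V * (?S\<^sup>T * U\<^sup>T)"
    using transpose_mult[of "U * ?S" m n "V\<^sup>T" n] transpose_mult[of U m m ?S n] c by auto
  also have "?S\<^sup>T = Matrix.mat n m (\<lambda>(i, j). if i = j then s (i + 1) else 0)"
    by (intro eq_matI) auto
  finally have "A\<^sup>T = V * Matrix.mat n m (\<lambda>(i, j). if i = j then s (i + 1) else 0) * U\<^sup>T"
    using c by (simp add: assoc_mult_mat[of _ n n _ m _ m])
  thus ?thesis using assms unfolding is_svd_def by (auto simp: min.commute)
qed

lemma is_svd_transpose_mult_vec:
  assumes "is_svd A U s V" "A \<in> carrier_mat m n" "x \<in> carrier_vec n" "i < m"
  shows "(U\<^sup>T *\<^sub>v (A *\<^sub>v x)) $ i = (if i < n then s (i + 1) * (V\<^sup>T *\<^sub>v x) $ i else 0)"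
proof -
  note c = is_svd_carriers[OF assms(1,2)]
  let ?S = "Matrix.mat m n (\<lambda>(i, j). if i = j then s (i + 1) else 0)"
  let ?w = "V\<^sup>T *\<^sub>v x"
  have w: "?w \<in> carrier_vec n" using c assms by auto
  have A: "A = U * ?S * V\<^sup>T" using assms unfolding is_svd_def by auto
  have "A *\<^sub>v x = U *\<^sub>v (?S *\<^sub>v ?w)"
    unfolding A using c assms(3) w
    by (simp add: assoc_mult_mat_vec[of "U * ?S" m n "V\<^sup>T" n] assoc_mult_mat_vec[of U m m ?S n])
  hence "U\<^sup>T *\<^sub>v (A *\<^sub>v x) = ?S *\<^sub>v ?w"
    using orthonormal_cols_transpose_mult_vec[OF c(2,1), of "?S *\<^sub>v ?w"]
      mult_mat_vec_carrier[of ?S m n ?w] w by simp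
  hence "(U\<^sup>T *\<^sub>v (A *\<^sub>v x)) $ i = row ?S i \<bullet> ?w" using assms(4) by simp
  also have "\<dots> = (\<Sum>j<n. (if i = j then s (i + 1) else 0) * ?w $ j)"
    unfolding scalar_prod_def using w assms(4) c by (auto simp: atLeast0LessThan intro!: sum.cong)
  also have "\<dots> = (\<Sum>j<n. if i = j then s (i + 1) * ?w $ j else 0)"
    by (intro sum.cong) auto
  also have "\<dots> = (if i < n then s (i + 1) * ?w $ i else 0)" by simp
  finally show ?thesis .
qed

lemma l2_norm_square_sum: "v \<in> carrier_vec n \<Longrightarrow> (l2_norm v)\<^sup>2 = (\<Sum>i<n. (v $ i)\<^sup>2)"
  unfolding l2_norm_square by (auto simp: scalar_prod_def atLeast0LessThan power2_eq_square)

lemma l2_norm_transpose_square: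
  assumes "orthonormal_cols V" "V \<in> carrier_mat n n" "x \<in> carrier_vec n"
  shows "l2_norm (V\<^sup>T *\<^sub>v x) = l2_norm x"
  using orthonormal_cols_l2_norm[OF orthonormal_square_transpose[OF assms(1,2)], of n n x] assms by auto

lemma is_svd_l2_norm:
  assumes "is_svd A U s V" "A \<in> carrier_mat m n" "x \<in> carrier_vec n"
  shows "(l2_norm (A *\<^sub>v x))\<^sup>2 = (\<Sum>i<min m n. (s (i + 1) * (V\<^sup>T *\<^sub>v x) $ i)\<^sup>2)"
proof -
  note c = is_svd_carriers[OF assms(1,2)]
  have Ax: "A *\<^sub>v x \<in> carrier_vec m" using assms by auto
  have "(l2_norm (A *\<^sub>v x))\<^sup>2 = (l2_norm (U\<^sup>T *\<^sub>v (A *\<^sub>v x)))\<^sup>2"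
    using l2_norm_transpose_square[OF c(2,1) Ax] by simp
  also have "\<dots> = (\<Sum>i<m. ((U\<^sup>T *\<^sub>v (A *\<^sub>v x)) $ i)\<^sup>2)"
    using c Ax by (intro l2_norm_square_sum) auto
  also have "\<dots> = (\<Sum>i<m. (if i < n then s (i + 1) * (V\<^sup>T *\<^sub>v x) $ i else 0)\<^sup>2)"
    using assms by (intro sum.cong refl) (simp add: is_svd_transpose_mult_vec[OF assms])
  also have "\<dots> = (\<Sum>i<min m n. (s (i + 1) * (V\<^sup>T *\<^sub>v x) $ i)\<^sup>2)"
    by (intro sum.mono_neutral_cong_right) auto
  finally show ?thesis .
qed

lemma is_svd_norm_le:
  assumes "is_svd A U s V" "A \<in> carrier_mat m n" "x \<in> carrier_vec n" "k < min m n"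
    and zero: "\<And>i. i < k \<Longrightarrow> (V\<^sup>T *\<^sub>v x) $ i = 0"
  shows "l2_norm (A *\<^sub>v x) \<le> s (k + 1) * l2_norm x"
proof -
  note c = is_svd_carriers[OF assms(1,2)]
  let ?w = "V\<^sup>T *\<^sub>v x"
  have w: "?w \<in> carrier_vec n" using c assms by auto
  have s0: "0 \<le> s (k + 1)" using is_svd_nonneg[OF assms(1,2), of "k + 1"] assms(4) by auto
  have "(l2_norm (A *\<^sub>v x))\<^sup>2 = (\<Sum>i<min m n. (s (i + 1) * ?w $ i)\<^sup>2)"
    by (rule is_svd_l2_norm[OF assms(1-3)])
  also have "\<dots> \<le> (\<Sum>i<min m n. (s (k + 1))\<^sup>2 * (?w $ i)\<^sup>2)"
  proof (intro sum_mono)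
    fix i assume i: "i \<in> {..<min m n}"
    show "(s (i + 1) * ?w $ i)\<^sup>2 \<le> (s (k + 1))\<^sup>2 * (?w $ i)\<^sup>2"
    proof (cases "i < k")
      case False
      have "s (i + 1) \<le> s (k + 1)" "0 \<le> s (i + 1)"
        using is_svd_antimono[OF assms(1,2), of "k + 1" "i + 1"] is_svd_nonneg[OF assms(1,2), of "i + 1"] False i by auto
      thus ?thesis by (auto simp: power_mult_distrib intro!: mult_right_mono power_mono)
    qed (simp add: zero)
  qed
  also have "\<dots> \<le> (\<Sum>i<n. (s (k + 1))\<^sup>2 * (?w $ i)\<^sup>2)"
    by (intro sum_mono2) auto
  also have "\<dots> = (s (k + 1) * l2_norm x)\<^sup>2"
    using l2_norm_square_sum[OF w] l2_norm_transpose_square[OF c(4,3) assms(3)]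
    by (simp add: sum_distrib_left[symmetric] power_mult_distrib)
  finally show ?thesis using s0 by (simp add: power2_le_iff_abs_le)
qed

lemma is_svd_norm_ge:
  assumes "is_svd A U s V" "A \<in> carrier_mat m n" "x \<in> carrier_vec n" "k < min m n"
    and zero: "\<And>i. k < i \<Longrightarrow> i < n \<Longrightarrow> (V\<^sup>T *\<^sub>v x) $ i = 0"
  shows "s (k + 1) * l2_norm x \<le> l2_norm (A *\<^sub>v x)"
proof -
  note c = is_svd_carriers[OF assms(1,2)]
  let ?w = "V\<^sup>T *\<^sub>v x"
  have w: "?w \<in> carrier_vec n" using c assms by auto
  have s0: "0 \<le> s (k + 1)" using is_svd_nonneg[OF assms(1,2), of "k + 1"] assms(4) by auto
  have "(s (k + 1) * l2_norm x)\<^sup>2 = (\<Sum>i<n. (s (k + 1))\<^sup>2 * (?w $ i)\<^sup>2)"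
    using l2_norm_square_sum[OF w] l2_norm_transpose_square[OF c(4,3) assms(3)]
    by (simp add: sum_distrib_left[symmetric] power_mult_distrib)
  also have "\<dots> = (\<Sum>i<min m n. (s (k + 1))\<^sup>2 * (?w $ i)\<^sup>2)"
    using zero assms(4) by (intro sum.mono_neutral_right) auto
  also have "\<dots> \<le> (\<Sum>i<min m n. (s (i + 1) * ?w $ i)\<^sup>2)"
  proof (intro sum_mono)
    fix i assume i: "i \<in> {..<min m n}"
    show "(s (k + 1))\<^sup>2 * (?w $ i)\<^sup>2 \<le> (s (i + 1) * ?w $ i)\<^sup>2"
    proof (cases "k < i")
      case False
      have "s (k + 1) \<le> s (i + 1)"
        using is_svd_antimono[OF assms(1,2), of "i + 1" "k + 1"] False i assms(4) by auto
      thus ?thesis using s0 by (auto simp: power_mult_distrib intro!: mult_right_mono power_mono)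
    qed (use zero i in simp)
  qed
  also have "\<dots> = (l2_norm (A *\<^sub>v x))\<^sup>2"
    by (rule is_svd_l2_norm[OF assms(1-3), symmetric])
  finally show ?thesis using s0 by (simp add: power2_le_iff_abs_le)
qed

lemma l2_norm_pos: "v \<in> carrier_vec n \<Longrightarrow> v \<noteq> 0\<^sub>v n \<Longrightarrow> 0 < l2_norm v"
  using l2_norm_eq_0[of v n] l2_norm_nonneg[of v] by linarith

lemma singular_value_ge:
  assumes svd: "is_svd A U s V" and A: "A \<in> carrier_mat m n" and k: "1 \<le> k" "k \<le> min m n"
    and B: "B \<in> carrier_mat n k" "orthonormal_cols B"
    and ge: "\<And>y. y \<in> carrier_vec k \<Longrightarrow> a * l2_norm y \<le> l2_norm (A *\<^sub>v (B *\<^sub>v y))"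
  shows "a \<le> s k"
proof -
  note c = is_svd_carriers[OF svd A]
  let ?V' = "take_cols (k - 1) V"
  have V': "?V' \<in> carrier_mat n (k - 1)" using c by auto
  have "?V'\<^sup>T * B \<in> carrier_mat (k - 1) k" using V' B by auto
  then obtain y where y: "y \<in> carrier_vec k" "y \<noteq> 0\<^sub>v k" "(?V'\<^sup>T * B) *\<^sub>v y = 0\<^sub>v (k - 1)"
    using underdetermined_system[of _ "k - 1" k] k by auto
  let ?x = "B *\<^sub>v y"
  have x: "?x \<in> carrier_vec n" using B y by auto
  have "?V'\<^sup>T *\<^sub>v ?x = 0\<^sub>v (k - 1)" using y V' B by (simp add: assoc_mult_mat_vec[of _ "k - 1" n B k])
  hence zero: "(V\<^sup>T *\<^sub>v ?x) $ i = 0" if "i < k - 1" for i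
    using take_cols_transpose_mult_vec[OF c(3), of "k - 1" i ?x] that k x by auto
  have "a * l2_norm y \<le> l2_norm (A *\<^sub>v ?x)" by (rule ge[OF y(1)])
  also have "\<dots> \<le> s (k - 1 + 1) * l2_norm ?x"
    using zero k by (intro is_svd_norm_le[OF svd A x]) auto
  also have "\<dots> = s k * l2_norm y" using k orthonormal_cols_l2_norm[OF B(2,1) y(1)] by simp
  finally show ?thesis using l2_norm_pos[OF y(1,2)] by simp
qed

lemma singular_value_le:
  assumes svd: "is_svd A U s V" and A: "A \<in> carrier_mat m n" and k: "k < min m n"
    and C: "C \<in> carrier_mat k n"
    and le: "\<And>x. x \<in> carrier_vec n \<Longrightarrow> C *\<^sub>v x = 0\<^sub>v k \<Longrightarrow> l2_norm (A *\<^sub>v x) \<le> a * l2_norm x"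
  shows "s (k + 1) \<le> a"
proof -
  note c = is_svd_carriers[OF svd A]
  let ?B = "take_cols (k + 1) V"
  have B: "?B \<in> carrier_mat n (k + 1)" using c by auto
  have oB: "orthonormal_cols ?B" using c k by (intro orthonormal_take_cols[of V n n]) auto
  have "C * ?B \<in> carrier_mat k (k + 1)" using C B by auto
  then obtain y where y: "y \<in> carrier_vec (k + 1)" "y \<noteq> 0\<^sub>v (k + 1)" "(C * ?B) *\<^sub>v y = 0\<^sub>v k"
    using underdetermined_system[of _ k "k + 1"] by auto
  let ?x = "?B *\<^sub>v y"
  have x: "?x \<in> carrier_vec n" using B y by auto
  have zero: "(V\<^sup>T *\<^sub>v ?x) $ i = 0" if "k < i" "i < n" for i
    using take_cols_complement_zero[OF c(3,4) _ _ _ y(1), of i] k that by simp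
  have "s (k + 1) * l2_norm ?x \<le> l2_norm (A *\<^sub>v ?x)"
    by (rule is_svd_norm_ge[OF svd A x k zero])
  also have "\<dots> \<le> a * l2_norm ?x"
    using y C B by (intro le[OF x]) (simp add: assoc_mult_mat_vec[of C k n ?B "k + 1"])
  finally have "s (k + 1) * l2_norm y \<le> a * l2_norm y"
    using orthonormal_cols_l2_norm[OF oB B y(1)] by simp
  thus ?thesis using l2_norm_pos[OF y(1,2)] by simp
qed

section \<open>Approximation by orthogonal matrices\<close>

lemma smult_mat_mult_vec:
  assumes "(A :: real mat) \<in> carrier_mat m n" "v \<in> carrier_vec n"
  shows "(c \<cdot>\<^sub>m A) *\<^sub>v v = c \<cdot>\<^sub>v (A *\<^sub>v v)"
  using assms by (intro eq_vecI) auto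

lemma norm_bound_of_gram_defect:
  assumes X: "X \<in> carrier_mat k k" and D: "norm_bound (1\<^sub>m k - X\<^sup>T * X) \<delta>" and "\<delta> \<le> 1"
  shows "norm_bound X 2"
proof (rule norm_boundI[OF X])
  fix v :: "real vec" assume v: "v \<in> carrier_vec k"
  let ?D = "1\<^sub>m k - X\<^sup>T * X"
  have Dc: "?D \<in> carrier_mat k k" using X by auto
  have Xv: "X *\<^sub>v v \<in> carrier_vec k" using X v by auto
  have "?D *\<^sub>v v = v - X\<^sup>T *\<^sub>v (X *\<^sub>v v)"
    using X v by (simp add: minus_mult_distrib_mat_vec[of _ k k] assoc_mult_mat_vec[of _ k k X k])
  hence "(?D *\<^sub>v v) \<bullet> v = v \<bullet> v - (X *\<^sub>v v) \<bullet> (X *\<^sub>v v)"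
    using X v Xv scalar_prod_mult_mat_vec[OF X Xv v]
    by (simp add: minus_scalar_prod_distrib[of _ k])
  hence "(l2_norm (X *\<^sub>v v))\<^sup>2 = (l2_norm v)\<^sup>2 - (?D *\<^sub>v v) \<bullet> v"
    by (simp add: l2_norm_square)
  also have "\<dots> \<le> (l2_norm v)\<^sup>2 + l2_norm (?D *\<^sub>v v) * l2_norm v"
    using scalar_prod_le_l2_norm[of "?D *\<^sub>v v" k v] Dc v mult_mat_vec_carrier[OF Dc v] by auto
  also have "\<dots> \<le> (l2_norm v)\<^sup>2 + (\<delta> * l2_norm v) * l2_norm v"
    by (intro add_left_mono mult_right_mono norm_boundD[OF D Dc v]) simp
  also have "\<dots> \<le> (l2_norm v)\<^sup>2 + (1 * l2_norm v) * l2_norm v"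
    using assms(3) by (intro add_left_mono mult_right_mono) simp_all
  also have "\<dots> \<le> (2 * l2_norm v)\<^sup>2" by (simp add: power2_eq_square)
  finally show "l2_norm (X *\<^sub>v v) \<le> 2 * l2_norm v" by (rule power2_le_imp_le) simp
qed

definition newton_schulz :: "real mat \<Rightarrow> real mat" where
  "newton_schulz X = X + (1/2) \<cdot>\<^sub>m (X * (1\<^sub>m (dim_col X) - X\<^sup>T * X))"

lemma newton_schulz_carrier [intro]: "X \<in> carrier_mat k k \<Longrightarrow> newton_schulz X \<in> carrier_mat k k"
  unfolding newton_schulz_def by auto

text \<open>With \<open>D = 1 - X\<^sup>T X\<close>, one step turns the defect \<open>D\<close> into \<open>(3/4) D\<^sup>2 + (1/4) D\<^sup>3\<close>.\<close>

lemma newton_schulz_defect: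
  assumes X: "X \<in> carrier_mat k k" and D: "norm_bound (1\<^sub>m k - X\<^sup>T * X) \<delta>"
    and \<delta>: "0 \<le> \<delta>" "\<delta> \<le> 1"
  shows "norm_bound (1\<^sub>m k - transpose_mat (newton_schulz X) * newton_schulz X) (\<delta>\<^sup>2)"
proof -
  let ?D = "1\<^sub>m k - X\<^sup>T * X"
  let ?X' = "newton_schulz X"
  have Dc: "?D \<in> carrier_mat k k" using X by auto
  have X': "?X' \<in> carrier_mat k k" using X by auto
  have Dt: "?D\<^sup>T = ?D"
    using X by (simp add: transpose_minus[of _ k k] transpose_mult[of _ k k])
  have Xt: "X\<^sup>T \<in> carrier_mat k k" using X by auto
  have dimX: "dim_col X = k" using X by auto
  have app: "?X' *\<^sub>v v = X *\<^sub>v (v + (1/2) \<cdot>\<^sub>v (?D *\<^sub>v v))" if v: "v \<in> carrier_vec k" for v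
  proof -
    have Dv: "?D *\<^sub>v v \<in> carrier_vec k" by (rule mult_mat_vec_carrier[OF Dc v])
    have "((1/2) \<cdot>\<^sub>m (X * ?D)) *\<^sub>v v = (1/2) \<cdot>\<^sub>v ((X * ?D) *\<^sub>v v)"
      by (rule smult_mat_mult_vec[OF mult_carrier_mat[OF X Dc] v])
    moreover have "(X * ?D) *\<^sub>v v = X *\<^sub>v (?D *\<^sub>v v)" using X Dc v by (rule assoc_mult_mat_vec)
    moreover have "X *\<^sub>v ((1/2) \<cdot>\<^sub>v (?D *\<^sub>v v)) = (1/2) \<cdot>\<^sub>v (X *\<^sub>v (?D *\<^sub>v v))"
      by (rule mult_mat_vec[OF X Dv])
    moreover have "?X' *\<^sub>v v = X *\<^sub>v v + ((1/2) \<cdot>\<^sub>m (X * ?D)) *\<^sub>v v"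
      unfolding newton_schulz_def dimX using X Dc v
      by (intro add_mult_distrib_mat_vec[of _ k k]) auto
    moreover have "X *\<^sub>v (v + (1/2) \<cdot>\<^sub>v (?D *\<^sub>v v)) = X *\<^sub>v v + X *\<^sub>v ((1/2) \<cdot>\<^sub>v (?D *\<^sub>v v))"
      using v Dv by (intro mult_add_distrib_mat_vec[OF X]) auto
    ultimately show ?thesis by simp
  qed
  have tapp: "?X'\<^sup>T *\<^sub>v u = X\<^sup>T *\<^sub>v u + (1/2) \<cdot>\<^sub>v (?D *\<^sub>v (X\<^sup>T *\<^sub>v u))"
    if u: "u \<in> carrier_vec k" for u
  proof -
    have "?X'\<^sup>T = X\<^sup>T + (1/2) \<cdot>\<^sub>m (?D * X\<^sup>T)"
    proof -
      have "transpose_mat (X * ?D) = ?D * X\<^sup>T"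
        using transpose_mult[OF X Dc] Dt by simp
      thus ?thesis unfolding newton_schulz_def dimX using X Dc
        by (intro eq_matI) (auto simp: transpose_mat_def mat_eq_iff)
    qed
    moreover have "((1/2) \<cdot>\<^sub>m (?D * X\<^sup>T)) *\<^sub>v u = (1/2) \<cdot>\<^sub>v ((?D * X\<^sup>T) *\<^sub>v u)"
      by (rule smult_mat_mult_vec[OF mult_carrier_mat[OF Dc Xt] u])
    moreover have "(?D * X\<^sup>T) *\<^sub>v u = ?D *\<^sub>v (X\<^sup>T *\<^sub>v u)"
      using Dc Xt u by (rule assoc_mult_mat_vec)
    moreover have "(X\<^sup>T + (1/2) \<cdot>\<^sub>m (?D * X\<^sup>T)) *\<^sub>v u =
        X\<^sup>T *\<^sub>v u + ((1/2) \<cdot>\<^sub>m (?D * X\<^sup>T)) *\<^sub>v u"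
      using Xt Dc u by (intro add_mult_distrib_mat_vec[of _ k k]) auto
    ultimately show ?thesis by simp
  qed
  have gram: "X\<^sup>T *\<^sub>v (X *\<^sub>v w) = w - ?D *\<^sub>v w" if w: "w \<in> carrier_vec k" for w
  proof -
    have "?D *\<^sub>v w = w - X\<^sup>T *\<^sub>v (X *\<^sub>v w)"
      using X w by (simp add: minus_mult_distrib_mat_vec[of _ k k] assoc_mult_mat_vec[of _ k k X k])
    moreover have "X\<^sup>T *\<^sub>v (X *\<^sub>v w) \<in> carrier_vec k" using X w by auto
    ultimately show ?thesis using w by (auto intro!: eq_vecI)
  qed
  show ?thesis
  proof (rule norm_boundI)
    show E: "1\<^sub>m k - ?X'\<^sup>T * ?X' \<in> carrier_mat k k" using X' by auto
    fix v :: "real vec" assume v: "v \<in> carrier_vec k"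
    let ?a = "?D *\<^sub>v v"
    let ?b = "?D *\<^sub>v ?a"
    let ?c = "?D *\<^sub>v ?b"
    have a: "?a \<in> carrier_vec k" by (rule mult_mat_vec_carrier[OF Dc v])
    have b: "?b \<in> carrier_vec k" by (rule mult_mat_vec_carrier[OF Dc a])
    have c: "?c \<in> carrier_vec k" by (rule mult_mat_vec_carrier[OF Dc b])
    let ?w = "v + (1/2) \<cdot>\<^sub>v ?a"
    have w: "?w \<in> carrier_vec k" using v a by auto
    have Dw: "?D *\<^sub>v ?w = ?a + (1/2) \<cdot>\<^sub>v ?b"
      using mult_add_distrib_mat_vec[OF Dc v, of "(1/2) \<cdot>\<^sub>v ?a"] mult_mat_vec[OF Dc a, of "1/2"] a by auto
    have Db: "?D *\<^sub>v (?a + (1/2) \<cdot>\<^sub>v ?b) = ?b + (1/2) \<cdot>\<^sub>v ?c"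
      using mult_add_distrib_mat_vec[OF Dc a, of "(1/2) \<cdot>\<^sub>v ?b"] mult_mat_vec[OF Dc b, of "1/2"] b by auto
    have u: "?X' *\<^sub>v v \<in> carrier_vec k" by (rule mult_mat_vec_carrier[OF X' v])
    have *: "X\<^sup>T *\<^sub>v (?X' *\<^sub>v v) = ?w - (?a + (1/2) \<cdot>\<^sub>v ?b)"
      unfolding app[OF v] gram[OF w] Dw ..
    have **: "?D *\<^sub>v (?w - (?a + (1/2) \<cdot>\<^sub>v ?b)) = ?a + (1/2) \<cdot>\<^sub>v ?b - (?b + (1/2) \<cdot>\<^sub>v ?c)"
      using mult_minus_distrib_mat_vec[OF Dc w, of "?a + (1/2) \<cdot>\<^sub>v ?b"] a b Dw Db by auto
    have "(1\<^sub>m k - ?X'\<^sup>T * ?X') *\<^sub>v v = v - ?X'\<^sup>T *\<^sub>v (?X' *\<^sub>v v)"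
      using X' v by (simp add: minus_mult_distrib_mat_vec[of _ k k] assoc_mult_mat_vec[of _ k k ?X' k])
    also have "\<dots> = v - ((?w - (?a + (1/2) \<cdot>\<^sub>v ?b)) + (1/2) \<cdot>\<^sub>v (?a + (1/2) \<cdot>\<^sub>v ?b - (?b + (1/2) \<cdot>\<^sub>v ?c)))"
      unfolding tapp[OF u] * ** ..
    also have "\<dots> = (3/4) \<cdot>\<^sub>v ?b + (1/4) \<cdot>\<^sub>v ?c"
    proof (rule eq_vecI)
      fix i assume "i < dim_vec ((3/4) \<cdot>\<^sub>v ?b + (1/4) \<cdot>\<^sub>v ?c)"
      hence i: "i < k" unfolding index_add_vec(2) index_smult_vec(2) carrier_vecD[OF c] .
      have gen: "(v - ((v + (1/2) \<cdot>\<^sub>v a - (a + (1/2) \<cdot>\<^sub>v b)) + (1/2) \<cdot>\<^sub>v (a + (1/2) \<cdot>\<^sub>v b - (b + (1/2) \<cdot>\<^sub>v c)))) $ i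
          = ((3/4) \<cdot>\<^sub>v b + (1/4) \<cdot>\<^sub>v c) $ i"
        if "a \<in> carrier_vec k" "b \<in> carrier_vec k" "c \<in> carrier_vec k" for a b c :: "real vec"
        using that v i by (simp add: algebra_simps)
      show "(v - ((?w - (?a + (1/2) \<cdot>\<^sub>v ?b)) + (1/2) \<cdot>\<^sub>v (?a + (1/2) \<cdot>\<^sub>v ?b - (?b + (1/2) \<cdot>\<^sub>v ?c)))) $ i
          = ((3/4) \<cdot>\<^sub>v ?b + (1/4) \<cdot>\<^sub>v ?c) $ i"
        by (rule gen[OF a b c])
    qed (use v a b c in auto)
    finally have eq: "(1\<^sub>m k - ?X'\<^sup>T * ?X') *\<^sub>v v = (3/4) \<cdot>\<^sub>v ?b + (1/4) \<cdot>\<^sub>v ?c" .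
    have na: "l2_norm ?a \<le> \<delta> * l2_norm v" by (rule norm_boundD[OF D Dc v])
    have nb: "l2_norm ?b \<le> \<delta> * (\<delta> * l2_norm v)"
      using norm_boundD[OF D Dc a] mult_left_mono[OF na \<delta>(1)] by linarith
    have nc: "l2_norm ?c \<le> 1 * (\<delta> * (\<delta> * l2_norm v))"
      using norm_boundD[OF D Dc b] mult_mono[OF \<delta>(2) nb] by auto
    have "l2_norm ((3/4) \<cdot>\<^sub>v ?b + (1/4) \<cdot>\<^sub>v ?c) \<le> 3/4 * l2_norm ?b + 1/4 * l2_norm ?c"
      using l2_norm_triangle[of "(3/4) \<cdot>\<^sub>v ?b" k "(1/4) \<cdot>\<^sub>v ?c"] b c by auto
    also have "\<dots> \<le> \<delta>\<^sup>2 * l2_norm v"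
      using nb nc by (simp add: power2_eq_square)
    finally show "l2_norm ((1\<^sub>m k - ?X'\<^sup>T * ?X') *\<^sub>v v) \<le> \<delta>\<^sup>2 * l2_norm v"
      unfolding eq .
  qed
qed

lemma newton_schulz_diff:
  assumes X: "X \<in> carrier_mat k k" and D: "norm_bound (1\<^sub>m k - X\<^sup>T * X) \<delta>"
    and \<delta>: "0 \<le> \<delta>" "\<delta> \<le> 1"
  shows "norm_bound (newton_schulz X - X) \<delta>"
proof -
  let ?D = "1\<^sub>m k - X\<^sup>T * X"
  have Dc: "?D \<in> carrier_mat k k" using X by auto
  have "newton_schulz X - X = (1/2) \<cdot>\<^sub>m (X * ?D)"
    unfolding newton_schulz_def using X by (intro eq_matI) auto
  moreover have "norm_bound ((1/2) \<cdot>\<^sub>m (X * ?D)) (\<bar>1/2\<bar> * (2 * \<delta>))"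
    by (intro norm_bound_smult norm_bound_mult[OF X Dc norm_bound_of_gram_defect[OF X D \<delta>(2)] D]) simp
  ultimately show ?thesis by simp
qed

lemma tendsto_mat_mult_entry:
  assumes "\<And>m. X m \<in> carrier_mat p q" "\<And>m. Y m \<in> carrier_mat q r"
    and "L \<in> carrier_mat p q" "K \<in> carrier_mat q r"
    and "\<And>i j. i < p \<Longrightarrow> j < q \<Longrightarrow> (\<lambda>m. X m $$ (i, j)) \<longlonglongrightarrow> (L $$ (i, j) :: real)"
    and "\<And>i j. i < q \<Longrightarrow> j < r \<Longrightarrow> (\<lambda>m. Y m $$ (i, j)) \<longlonglongrightarrow> K $$ (i, j)"
    and ij: "i < p" "j < r"
  shows "(\<lambda>m. (X m * Y m) $$ (i, j)) \<longlonglongrightarrow> (L * K) $$ (i, j)"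
proof -
  have expand: "(A * B) $$ (i, j) = (\<Sum>l<q. A $$ (i, l) * B $$ (l, j))"
    if "A \<in> carrier_mat p q" "B \<in> carrier_mat q r" for A B :: "real mat"
    using that ij by (auto simp: scalar_prod_def atLeast0LessThan)
  have "(\<lambda>m. \<Sum>l<q. X m $$ (i, l) * Y m $$ (l, j)) \<longlonglongrightarrow> (\<Sum>l<q. L $$ (i, l) * K $$ (l, j))"
    using assms by (intro tendsto_sum tendsto_mult) auto
  thus ?thesis using expand assms(1-4) by simp
qed

lemma norm_bound_limit:
  assumes X: "\<And>m. X m \<in> carrier_mat p q" and L: "L \<in> carrier_mat p q"
    and lim: "\<And>i j. i < p \<Longrightarrow> j < q \<Longrightarrow> (\<lambda>m. X m $$ (i, j)) \<longlonglongrightarrow> L $$ (i, j)"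
    and bound: "\<And>m. norm_bound (X m) \<beta>"
  shows "norm_bound L \<beta>"
proof (rule norm_boundI[OF L])
  fix v :: "real vec" assume v: "v \<in> carrier_vec q"
  have expand: "l2_norm (A *\<^sub>v v) = sqrt (\<Sum>i<p. (\<Sum>l<q. A $$ (i, l) * v $ l)\<^sup>2)"
    if "A \<in> carrier_mat p q" for A :: "real mat"
    using that v unfolding l2_norm_L2_set L2_set_def
    by (auto simp: scalar_prod_def atLeast0LessThan intro!: sum.cong)
  have "(\<lambda>m. sqrt (\<Sum>i<p. (\<Sum>l<q. X m $$ (i, l) * v $ l)\<^sup>2)) \<longlonglongrightarrow> sqrt (\<Sum>i<p. (\<Sum>l<q. L $$ (i, l) * v $ l)\<^sup>2)"
    using lim by (intro tendsto_real_sqrt tendsto_sum tendsto_power tendsto_mult tendsto_const) auto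
  hence "(\<lambda>m. l2_norm (X m *\<^sub>v v)) \<longlonglongrightarrow> l2_norm (L *\<^sub>v v)"
    using expand X L by simp
  thus "l2_norm (L *\<^sub>v v) \<le> \<beta> * l2_norm v"
    using norm_boundD[OF bound X v] by (intro LIMSEQ_le_const2) auto
qed

text \<open>The orthogonal matrix is the polar factor, reached as the limit of the Newton--Schulz iteration;
  this needs neither a spectral theorem nor square roots of matrices.\<close>

lemma orthogonal_approximation:
  assumes A: "A \<in> carrier_mat k k" and nA: "norm_bound A 1"
    and D: "norm_bound (1\<^sub>m k - A\<^sup>T * A) \<delta>" and \<delta>0: "0 \<le> \<delta>"
  shows "\<exists>W \<in> carrier_mat k k. orthonormal_cols W \<and> norm_bound (A - W) (4 * \<delta>)"
proof (cases "1/2 \<le> \<delta>")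
  case True
  have "A - 1\<^sub>m k = A + (-1) \<cdot>\<^sub>m 1\<^sub>m k" using A by (intro eq_matI) auto
  moreover have "norm_bound (A + (-1) \<cdot>\<^sub>m 1\<^sub>m k) (1 + \<bar>-1\<bar> * 1)"
    using A by (intro norm_bound_add[OF A _ nA] norm_bound_smult norm_bound_one) auto
  ultimately have "norm_bound (A - 1\<^sub>m k) (4 * \<delta>)"
    using True by (auto intro: norm_bound_mono)
  thus ?thesis using orthonormal_cols_one by (intro bexI[of _ "1\<^sub>m k"]) auto
next
  case False
  hence \<delta>: "0 \<le> \<delta>" "\<delta> \<le> 1/2" using \<delta>0 by auto
  define X where "X m = (newton_schulz ^^ m) A" for m
  have X0: "X 0 = A" and XS: "X (Suc m) = newton_schulz (X m)" for m by (auto simp: X_def)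
  have Xc: "X m \<in> carrier_mat k k" for m by (induction m) (auto simp: X0 XS A)
  have Dm: "norm_bound (1\<^sub>m k - transpose_mat (X m) * X m) (\<delta> * (1/2)^m)" for m
  proof (induction m)
    case (Suc m)
    have p: "(1/2 :: real)^m \<le> 1" by (intro power_le_one) auto
    have b: "\<delta> * (1/2)^m \<le> 1/2" using mult_mono[OF \<delta>(2) p] by auto
    have "norm_bound (1\<^sub>m k - transpose_mat (X (Suc m)) * X (Suc m)) ((\<delta> * (1/2)^m)\<^sup>2)"
      unfolding XS using b \<delta> by (intro newton_schulz_defect[OF Xc Suc.IH]) auto
    moreover have "(\<delta> * (1/2)^m)\<^sup>2 \<le> \<delta> * (1/2)^Suc m"
      using mult_left_mono[OF b, of "\<delta> * (1/2)^m"] \<delta> by (simp add: power2_eq_square)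
    ultimately show ?case by (rule norm_bound_mono)
  qed (simp add: X0 D)
  have diff: "norm_bound (X (Suc m) - X m) (\<delta> * (1/2)^m)" for m
  proof -
    have "\<delta> * (1/2)^m \<le> 1 * 1" using \<delta> by (intro mult_mono power_le_one) auto
    thus ?thesis unfolding XS using \<delta> by (intro newton_schulz_diff[OF Xc Dm]) auto
  qed
  have total: "norm_bound (A - X m) (2 * \<delta> * (1 - (1/2)^m))" for m
  proof (induction m)
    case 0
    have "A - X 0 = 0\<^sub>m k k" using A by (simp add: X0)
    moreover have "(0\<^sub>m k k :: real mat) *\<^sub>v v = 0\<^sub>v k" if "v \<in> carrier_vec k" for v :: "real vec"
      using that by (intro eq_vecI) auto
    ultimately show ?case by (auto intro: norm_boundI[of _ k k])
  next
    case (Suc m)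
    have "A - X (Suc m) = (A - X m) + (-1) \<cdot>\<^sub>m (X (Suc m) - X m)"
      using A Xc[of m] Xc[of "Suc m"] by (intro eq_matI) auto
    moreover have "norm_bound ((A - X m) + (-1) \<cdot>\<^sub>m (X (Suc m) - X m))
        (2 * \<delta> * (1 - (1/2)^m) + \<bar>-1\<bar> * (\<delta> * (1/2)^m))"
      using A Xc by (intro norm_bound_add[of _ k k] norm_bound_smult diff Suc.IH
          smult_carrier_mat minus_carrier_mat) auto
    moreover have "2 * \<delta> * (1 - (1/2)^m) + \<bar>-1\<bar> * (\<delta> * (1/2)^m) = 2 * \<delta> * (1 - (1/2)^Suc m)"
      by (simp add: field_simps)
    ultimately show ?case by simp
  qed
  have conv: "convergent (\<lambda>m. X m $$ (i, j))" if ij: "i < k" "j < k" for i j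
  proof -
    have "summable (\<lambda>m. X (Suc m) $$ (i, j) - X m $$ (i, j))"
    proof (rule summable_comparison_test)
      show "summable (\<lambda>m. \<delta> * (1/2 :: real)^m)" by (intro summable_mult summable_geometric) auto
      show "\<exists>N. \<forall>m\<ge>N. norm (X (Suc m) $$ (i, j) - X m $$ (i, j)) \<le> \<delta> * (1/2)^m"
        using abs_index_le_norm_bound[OF _ diff, of _ k k i j] ij Xc
        by (metis carrier_matD index_minus_mat(1) minus_carrier_mat real_norm_def)
    qed
    hence "(\<lambda>N. \<Sum>m<N. X (Suc m) $$ (i, j) - X m $$ (i, j)) \<longlonglongrightarrow> suminf (\<lambda>m. X (Suc m) $$ (i, j) - X m $$ (i, j))"
      by (rule summable_LIMSEQ)
    hence "(\<lambda>N. (X N $$ (i, j) - X 0 $$ (i, j)) + X 0 $$ (i, j)) \<longlonglongrightarrow> suminf (\<lambda>m. X (Suc m) $$ (i, j) - X m $$ (i, j)) + X 0 $$ (i, j)"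
      by (intro tendsto_add tendsto_const) (simp add: sum_lessThan_telescope[of "\<lambda>m. X m $$ (i, j)"])
    thus ?thesis unfolding convergent_def by auto
  qed
  define W where "W = Matrix.mat k k (\<lambda>(i, j). lim (\<lambda>m. X m $$ (i, j)))"
  have W: "W \<in> carrier_mat k k" by (simp add: W_def)
  have lim: "(\<lambda>m. X m $$ (i, j)) \<longlonglongrightarrow> W $$ (i, j)" if "i < k" "j < k" for i j
    using conv[OF that] that by (simp add: W_def convergent_LIMSEQ_iff)
  have "W\<^sup>T * W = 1\<^sub>m k"
  proof (rule eq_matI)
    fix i j assume "i < dim_row (1\<^sub>m k :: real mat)" "j < dim_col (1\<^sub>m k :: real mat)"
    hence ij: "i < k" "j < k" by auto
    have "(\<lambda>m. (transpose_mat (X m) * X m) $$ (i, j)) \<longlonglongrightarrow> (W\<^sup>T * W) $$ (i, j)"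
    proof (rule tendsto_mat_mult_entry[where p = k and q = k and r = k])
      show "transpose_mat (X m) \<in> carrier_mat k k" "X m \<in> carrier_mat k k" for m
        using Xc[of m] by auto
      show "W\<^sup>T \<in> carrier_mat k k" "W \<in> carrier_mat k k" using W by auto
      fix i j assume ij: "i < k" "j < k"
      have "transpose_mat (X m) $$ (i, j) = X m $$ (j, i)" for m using Xc[of m] ij by auto
      moreover have "W\<^sup>T $$ (i, j) = W $$ (j, i)" using W ij by auto
      ultimately show "(\<lambda>m. transpose_mat (X m) $$ (i, j)) \<longlonglongrightarrow> W\<^sup>T $$ (i, j)"
        using lim[OF ij(2,1)] by simp
      show "(\<lambda>m. X m $$ (i, j)) \<longlonglongrightarrow> W $$ (i, j)" by (rule lim[OF ij])
    qed (rule ij)+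
    hence l1: "(\<lambda>m. 1\<^sub>m k $$ (i, j) - (transpose_mat (X m) * X m) $$ (i, j)) \<longlonglongrightarrow> 1\<^sub>m k $$ (i, j) - (W\<^sup>T * W) $$ (i, j)"
      by (intro tendsto_diff tendsto_const)
    have l2: "(\<lambda>m. 1\<^sub>m k $$ (i, j) - (transpose_mat (X m) * X m) $$ (i, j)) \<longlonglongrightarrow> 0"
    proof (rule Lim_null_comparison)
      show "\<forall>\<^sub>F m in sequentially. norm (1\<^sub>m k $$ (i, j) - (transpose_mat (X m) * X m) $$ (i, j)) \<le> \<delta> * (1/2)^m"
      proof (intro always_eventually allI)
        fix m
        have c: "1\<^sub>m k - transpose_mat (X m) * X m \<in> carrier_mat k k" using Xc[of m] by auto
        have "(1\<^sub>m k - transpose_mat (X m) * X m) $$ (i, j) = 1\<^sub>m k $$ (i, j) - (transpose_mat (X m) * X m) $$ (i, j)"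
          using ij Xc[of m] by (intro index_minus_mat) auto
        thus "norm (1\<^sub>m k $$ (i, j) - (transpose_mat (X m) * X m) $$ (i, j)) \<le> \<delta> * (1/2)^m"
          using abs_index_le_norm_bound[OF c Dm[of m] ij] by simp
      qed
      show "(\<lambda>m. \<delta> * (1/2 :: real)^m) \<longlonglongrightarrow> 0"
        by (intro tendsto_mult_right_zero LIMSEQ_realpow_zero) auto
    qed
    show "(W\<^sup>T * W) $$ (i, j) = 1\<^sub>m k $$ (i, j)"
      using LIMSEQ_unique[OF l1 l2] by simp
  qed (use W in auto)
  moreover have "norm_bound (A - W) (2 * \<delta>)"
  proof (rule norm_bound_limit[where X = "\<lambda>m. A - X m"])
    show "norm_bound (A - X m) (2 * \<delta>)" for m
      using total[of m] by (rule norm_bound_mono) (use \<delta> in \<open>auto intro: mult_left_le\<close>)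
    fix i j assume ij: "i < k" "j < k"
    have "(\<lambda>m. A $$ (i, j) - X m $$ (i, j)) \<longlonglongrightarrow> A $$ (i, j) - W $$ (i, j)"
      by (intro tendsto_diff tendsto_const lim ij)
    thus "(\<lambda>m. (A - X m) $$ (i, j)) \<longlonglongrightarrow> (A - W) $$ (i, j)"
      using ij A W by (simp add: carrier_matD[OF Xc])
  qed (use A W Xc in \<open>auto intro: minus_carrier_mat\<close>)
  ultimately show ?thesis
    using W \<delta> by (intro bexI[of _ W]) (auto simp: orthonormal_cols_def intro: norm_bound_mono)
qed

section \<open>Leading singular subspaces of a power sketch\<close>

lemma index_mult_mat_vec_sum:
  assumes "(A :: real mat) \<in> carrier_mat m n" "w \<in> carrier_vec n" "i < m"
  shows "(A *\<^sub>v w) $ i = (\<Sum>j<n. A $$ (i, j) * w $ j)"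
  using assms by (auto simp: scalar_prod_def atLeast0LessThan)

lemma leading_left_svE:
  assumes "leading_left_sv k A U" "A \<in> carrier_mat m n"
  obtains P s V where "is_svd A P s V" "U = take_cols k P" "k \<le> min m n"
  using assms unfolding leading_left_sv_def is_svd_def take_cols_def by auto

lemma leading_left_sv_orthonormal:
  assumes "leading_left_sv k A U" "A \<in> carrier_mat m n"
  shows "U \<in> carrier_mat m k" "orthonormal_cols U" "k \<le> m" "k \<le> n"
proof -
  from assms obtain P s V where *: "is_svd A P s V" "U = take_cols k P" "k \<le> min m n"
    by (rule leading_left_svE)
  note c = is_svd_carriers[OF *(1) assms(2)]
  show "U \<in> carrier_mat m k" "orthonormal_cols U" "k \<le> m" "k \<le> n"
    using * c orthonormal_take_cols[of P m m k] by auto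
qed

definition spectral_split :: "nat \<Rightarrow> nat \<Rightarrow> real mat \<Rightarrow> real mat \<Rightarrow> real \<Rightarrow> real \<Rightarrow> bool" where
  "spectral_split n k H U s e \<longleftrightarrow>
     H \<in> carrier_mat n n \<and> H\<^sup>T = H \<and> U \<in> carrier_mat n k \<and> orthonormal_cols U \<and>
     0 < s \<and> 0 \<le> e \<and>
     (\<forall>y \<in> carrier_vec k. s * l2_norm y \<le> l2_norm (H *\<^sub>v (U *\<^sub>v y))) \<and>
     (\<forall>x \<in> carrier_vec n. U\<^sup>T *\<^sub>v x = 0\<^sub>v k \<longrightarrow>
        U\<^sup>T *\<^sub>v (H *\<^sub>v x) = 0\<^sub>v k \<and> l2_norm (H *\<^sub>v x) \<le> e * l2_norm x)"

text \<open>In the basis of the left singular vectors, \<open>H\<close> commutes with the diagonal matrix of squared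
  singular values of \<open>H\<close>, so it has no entries between singular values on different sides of the gap.\<close>

lemma symmetric_svd_gap:
  assumes svd: "is_svd H P s V" and H: "H \<in> carrier_mat n n" and sym: "H\<^sup>T = H"
    and ij: "i < n" "j < n" and gap: "s (j + 1) < s (i + 1)"
  shows "(P\<^sup>T *\<^sub>v (H *\<^sub>v (P *\<^sub>v unit_vec n j))) $ i = 0"
proof -
  note c = is_svd_carriers[OF svd H]
  have svd': "is_svd H V s P" using is_svd_transpose[OF svd H] sym by simp
  have sq: "(P\<^sup>T *\<^sub>v (H *\<^sub>v (H *\<^sub>v x))) $ l = (s (l + 1))\<^sup>2 * (P\<^sup>T *\<^sub>v x) $ l"
    if x: "x \<in> carrier_vec n" and l: "l < n" for x l
    using is_svd_transpose_mult_vec[OF svd H mult_mat_vec_carrier[OF H x] l]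
      is_svd_transpose_mult_vec[OF svd' H x l] l by (simp add: power2_eq_square)
  let ?e = "\<lambda>l. unit_vec n l :: real vec"
  let ?p = "\<lambda>l. P *\<^sub>v ?e l"
  have p: "?p l \<in> carrier_vec n" for l using c by auto
  have Pp: "P\<^sup>T *\<^sub>v ?p l = ?e l" for l
    using orthonormal_cols_transpose_mult_vec[OF c(2,1), of "?e l"] by simp
  have PPt: "P *\<^sub>v (P\<^sup>T *\<^sub>v x) = x" if "x \<in> carrier_vec n" for x
    using assoc_mult_mat_vec[of P n n "P\<^sup>T" n x] c that orthonormal_square_right_inverse[OF c(2,1)] by auto
  have HHp: "H *\<^sub>v (H *\<^sub>v ?p j) = (s (j + 1))\<^sup>2 \<cdot>\<^sub>v ?p j"
  proof -
    have HH: "H *\<^sub>v (H *\<^sub>v ?p j) \<in> carrier_vec n" using H p by auto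
    have "P\<^sup>T *\<^sub>v (H *\<^sub>v (H *\<^sub>v ?p j)) = (s (j + 1))\<^sup>2 \<cdot>\<^sub>v ?e j"
    proof (rule eq_vecI)
      fix l assume "l < dim_vec ((s (j + 1))\<^sup>2 \<cdot>\<^sub>v ?e j)"
      hence l: "l < n" by simp
      show "(P\<^sup>T *\<^sub>v (H *\<^sub>v (H *\<^sub>v ?p j))) $ l = ((s (j + 1))\<^sup>2 \<cdot>\<^sub>v ?e j) $ l"
        unfolding sq[OF p l] Pp using l ij by (auto simp: unit_vec_def)
    qed (use c in auto)
    hence "P *\<^sub>v (P\<^sup>T *\<^sub>v (H *\<^sub>v (H *\<^sub>v ?p j))) = (s (j + 1))\<^sup>2 \<cdot>\<^sub>v ?p j"
      using mult_mat_vec[OF c(1), of "?e j"] by simp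
    thus ?thesis using PPt[OF HH] by simp
  qed
  let ?b = "(P\<^sup>T *\<^sub>v (H *\<^sub>v ?p j)) $ i"
  have Hp: "H *\<^sub>v ?p j \<in> carrier_vec n" using H p by auto
  have "(s (i + 1))\<^sup>2 * ?b = (P\<^sup>T *\<^sub>v (H *\<^sub>v (H *\<^sub>v (H *\<^sub>v ?p j)))) $ i"
    using sq[OF Hp ij(1)] by simp
  also have "H *\<^sub>v (H *\<^sub>v (H *\<^sub>v ?p j)) = (s (j + 1))\<^sup>2 \<cdot>\<^sub>v (H *\<^sub>v ?p j)"
    unfolding HHp by (rule mult_mat_vec[OF H p])
  also have "P\<^sup>T *\<^sub>v \<dots> = (s (j + 1))\<^sup>2 \<cdot>\<^sub>v (P\<^sup>T *\<^sub>v (H *\<^sub>v ?p j))"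
    using c by (intro mult_mat_vec[OF _ Hp]) auto
  finally have "((s (i + 1))\<^sup>2 - (s (j + 1))\<^sup>2) * ?b = 0" using ij c by (simp add: algebra_simps)
  moreover have "0 \<le> s (j + 1)" using is_svd_nonneg[OF svd H, of "j + 1"] ij by auto
  hence "(s (j + 1))\<^sup>2 < (s (i + 1))\<^sup>2" using gap by (intro power_strict_mono) auto
  ultimately show ?thesis by simp
qed

lemma spectral_splitI:
  assumes svd: "is_svd H P s V" and H: "H \<in> carrier_mat n n" and sym: "H\<^sup>T = H"
    and k: "1 \<le> k" "k \<le> n" and a: "0 < a" "a \<le> s k" and e: "0 \<le> e" "e < a" "k < n \<Longrightarrow> s (k + 1) \<le> e"
  shows "spectral_split n k H (take_cols k P) a e"
proof -
  note c = is_svd_carriers[OF svd H]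
  have svd': "is_svd H V s P" using is_svd_transpose[OF svd H] sym by simp
  let ?U = "take_cols k P"
  have U: "?U \<in> carrier_mat n k" using c by auto
  have oU: "orthonormal_cols ?U" using c k by (intro orthonormal_take_cols[of P n n]) auto
  have PU: "(P\<^sup>T *\<^sub>v (?U *\<^sub>v y)) $ i = 0" if "k \<le> i" "i < n" "y \<in> carrier_vec k" for y i
    using take_cols_complement_zero[OF c(1,2) k(2)] that by simp
  have lower: "a * l2_norm y \<le> l2_norm (H *\<^sub>v (?U *\<^sub>v y))" if y: "y \<in> carrier_vec k" for y
  proof -
    have Uy: "?U *\<^sub>v y \<in> carrier_vec n" using U y by auto
    have "a * l2_norm y \<le> s (k - 1 + 1) * l2_norm (?U *\<^sub>v y)"
      using a k orthonormal_cols_l2_norm[OF oU U y] by (auto intro: mult_right_mono)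
    also have "\<dots> \<le> l2_norm (H *\<^sub>v (?U *\<^sub>v y))"
      using PU[OF _ _ y] k by (intro is_svd_norm_ge[OF svd' H Uy]) auto
    finally show ?thesis .
  qed
  have inv: "?U\<^sup>T *\<^sub>v (H *\<^sub>v x) = 0\<^sub>v k" and upper: "l2_norm (H *\<^sub>v x) \<le> e * l2_norm x"
    if x: "x \<in> carrier_vec n" and x0: "?U\<^sup>T *\<^sub>v x = 0\<^sub>v k" for x
  proof -
    let ?w = "P\<^sup>T *\<^sub>v x"
    have w: "?w \<in> carrier_vec n" using c x by auto
    have w0: "?w $ i = 0" if "i < k" for i
      using take_cols_transpose_mult_vec[OF c(1) k(2) that x] x0 that by simp
    have xw: "x = P *\<^sub>v ?w"
      using assoc_mult_mat_vec[of P n n "P\<^sup>T" n x] c x orthonormal_square_right_inverse[OF c(2,1)] by auto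
    define B where "B = P\<^sup>T * (H * P)"
    have B: "B \<in> carrier_mat n n" using c H by (auto simp: B_def)
    have Bv: "B *\<^sub>v u = P\<^sup>T *\<^sub>v (H *\<^sub>v (P *\<^sub>v u))" if "u \<in> carrier_vec n" for u
      using c H that unfolding B_def
      by (simp add: assoc_mult_mat_vec[of "P\<^sup>T" n n "H * P" n] assoc_mult_mat_vec[of H n n P n])
    have Bij: "B $$ (i, j) = 0" if "i < k" "k \<le> j" "j < n" for i j
    proof -
      have "s (j + 1) \<le> s (k + 1)" "s k \<le> s (i + 1)"
        using is_svd_antimono[OF svd H, of "k + 1" "j + 1"] is_svd_antimono[OF svd H, of "i + 1" k] that k by auto
      hence gap: "s (j + 1) < s (i + 1)" using a e that by auto
      have "B $$ (i, j) = (B *\<^sub>v unit_vec n j) $ i"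
        using B that k by (auto simp: scalar_prod_right_unit)
      thus ?thesis using Bv[of "unit_vec n j"] symmetric_svd_gap[OF svd H sym _ _ gap] that k by auto
    qed
    show "?U\<^sup>T *\<^sub>v (H *\<^sub>v x) = 0\<^sub>v k"
    proof (rule eq_vecI)
      fix i assume "i < dim_vec (0\<^sub>v k :: real vec)"
      hence i: "i < k" by simp
      have "(?U\<^sup>T *\<^sub>v (H *\<^sub>v x)) $ i = (P\<^sup>T *\<^sub>v (H *\<^sub>v x)) $ i"
        using H x by (intro take_cols_transpose_mult_vec[OF c(1) k(2) i]) auto
      also have "P\<^sup>T *\<^sub>v (H *\<^sub>v x) = B *\<^sub>v ?w"
        using Bv[OF w] xw by simp
      also have "(B *\<^sub>v ?w) $ i = (\<Sum>j<n. B $$ (i, j) * ?w $ j)"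
        using i k by (intro index_mult_mat_vec_sum[OF B w]) auto
      also have "\<dots> = 0"
      proof (intro sum.neutral ballI)
        fix j assume "j \<in> {..<n}"
        thus "B $$ (i, j) * ?w $ j = 0" using Bij[OF i, of j] w0[of j] by (cases "j < k") auto
      qed
      finally show "(?U\<^sup>T *\<^sub>v (H *\<^sub>v x)) $ i = 0\<^sub>v k $ i" using i by simp
    qed (use U in auto)
    show "l2_norm (H *\<^sub>v x) \<le> e * l2_norm x"
    proof (cases "k < n")
      case True
      have "l2_norm (H *\<^sub>v x) \<le> s (k + 1) * l2_norm x"
        using w0 True by (intro is_svd_norm_le[OF svd' H x]) auto
      also have "\<dots> \<le> e * l2_norm x" using e True by (intro mult_right_mono) auto
      finally show ?thesis .
    next
      case False
      hence "?w = 0\<^sub>v n" using w0 k c(1) by (intro eq_vecI) auto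
      hence "x = 0\<^sub>v n" using xw mult_mat_vec_zero[OF c(1)] by simp
      thus ?thesis using mult_mat_vec_zero[OF H] by simp
    qed
  qed
  show ?thesis unfolding spectral_split_def
    using H sym U oU a e(1) lower inv upper by auto
qed

lemma orthonormal_decompose:
  assumes U: "U \<in> carrier_mat n k" "orthonormal_cols U" and x: "x \<in> carrier_vec n"
  defines "v \<equiv> x - U *\<^sub>v (U\<^sup>T *\<^sub>v x)"
  shows "v \<in> carrier_vec n" "U\<^sup>T *\<^sub>v v = 0\<^sub>v k" "x = U *\<^sub>v (U\<^sup>T *\<^sub>v x) + v"
    "l2_norm v \<le> l2_norm x"
proof -
  have Ut: "U\<^sup>T \<in> carrier_mat k n" using U by auto
  have w: "U\<^sup>T *\<^sub>v x \<in> carrier_vec k" using Ut x by (rule mult_mat_vec_carrier)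
  have Uw: "U *\<^sub>v (U\<^sup>T *\<^sub>v x) \<in> carrier_vec n" using U(1) w by (rule mult_mat_vec_carrier)
  show v: "v \<in> carrier_vec n" using Uw x by (simp add: v_def)
  show 0: "U\<^sup>T *\<^sub>v v = 0\<^sub>v k"
    unfolding v_def mult_minus_distrib_mat_vec[OF Ut x Uw] orthonormal_cols_transpose_mult_vec[OF U(2,1) w]
    using w by auto
  show eq: "x = U *\<^sub>v (U\<^sup>T *\<^sub>v x) + v"
    unfolding v_def using x Uw U(1) by (intro eq_vecI) auto
  have "(U *\<^sub>v (U\<^sup>T *\<^sub>v x)) \<bullet> v = 0"
    using scalar_prod_mult_mat_vec[OF U(1) v w] comm_scalar_prod[OF Uw v] 0 w by simp
  hence "(l2_norm x)\<^sup>2 = (l2_norm (U *\<^sub>v (U\<^sup>T *\<^sub>v x)))\<^sup>2 + (l2_norm v)\<^sup>2"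
    using l2_norm_add_square[OF Uw v] eq by simp
  hence "(l2_norm v)\<^sup>2 \<le> (l2_norm x)\<^sup>2" by simp
  thus "l2_norm v \<le> l2_norm x" by (rule power2_le_imp_le) simp
qed

lemma pow_mat_symmetric:
  assumes "H \<in> carrier_mat n n" "H\<^sup>T = (H :: real mat)"
  shows "transpose_mat (H ^\<^sub>m g) = H ^\<^sub>m g"
proof (induction g)
  case (Suc g)
  have "transpose_mat (H ^\<^sub>m Suc g) = H * H ^\<^sub>m g"
    using transpose_mult[of "H ^\<^sub>m g" n n H n] assms Suc by simp
  also have "\<dots> = H ^\<^sub>m Suc g"
  proof (induction g)
    case (Suc g)
    have "H * H ^\<^sub>m Suc g = (H * H ^\<^sub>m g) * H"
      using assms by (simp add: assoc_mult_mat[of H n n "H ^\<^sub>m g" n H n])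
    thus ?case using Suc by simp
  qed (use assms in simp)
  finally show ?case .
qed (use assms in simp)

lemma pow_mat_Suc_mult_vec:
  assumes "H \<in> carrier_mat n n" "(x :: real vec) \<in> carrier_vec n"
  shows "H ^\<^sub>m Suc g *\<^sub>v x = H ^\<^sub>m g *\<^sub>v (H *\<^sub>v x)"
  using assms by (simp add: assoc_mult_mat_vec[of "H ^\<^sub>m g" n n H n])

lemma spectral_split_power_complement:
  assumes sp: "spectral_split n k H U s e" and x: "x \<in> carrier_vec n" "U\<^sup>T *\<^sub>v x = 0\<^sub>v k"
  shows "U\<^sup>T *\<^sub>v (H ^\<^sub>m g *\<^sub>v x) = 0\<^sub>v k \<and> l2_norm (H ^\<^sub>m g *\<^sub>v x) \<le> e ^ g * l2_norm x"
  using x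
proof (induction g arbitrary: x)
  case 0
  thus ?case using sp by (auto simp: spectral_split_def)
next
  case (Suc g)
  have H: "H \<in> carrier_mat n n" and e: "0 \<le> e" using sp by (auto simp: spectral_split_def)
  have Hx: "H *\<^sub>v x \<in> carrier_vec n" "U\<^sup>T *\<^sub>v (H *\<^sub>v x) = 0\<^sub>v k" "l2_norm (H *\<^sub>v x) \<le> e * l2_norm x"
    using sp Suc.prems H by (auto simp: spectral_split_def)
  have "l2_norm (H ^\<^sub>m g *\<^sub>v (H *\<^sub>v x)) \<le> e ^ g * l2_norm (H *\<^sub>v x)" using Suc.IH[OF Hx(1,2)] by simp
  also have "\<dots> \<le> e ^ g * (e * l2_norm x)" using Hx(3) e by (intro mult_left_mono) auto
  finally show ?case unfolding pow_mat_Suc_mult_vec[OF H Suc.prems(1)]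
    using Suc.IH[OF Hx(1,2)] by (simp add: ac_simps)
qed

lemma spectral_split_range:
  assumes sp: "spectral_split n k H U s e" and y: "y \<in> carrier_vec k"
  shows "\<exists>z \<in> carrier_vec k. H *\<^sub>v (U *\<^sub>v y) = U *\<^sub>v z \<and> s * l2_norm y \<le> l2_norm z"
proof -
  have H: "H \<in> carrier_mat n n" "H\<^sup>T = H" and U: "U \<in> carrier_mat n k" "orthonormal_cols U"
    using sp by (auto simp: spectral_split_def)
  let ?x = "H *\<^sub>v (U *\<^sub>v y)"
  have x: "?x \<in> carrier_vec n" using H U y by auto
  let ?z = "U\<^sup>T *\<^sub>v ?x"
  let ?v = "?x - U *\<^sub>v ?z"
  note d = orthonormal_decompose[OF U x]
  have z: "?z \<in> carrier_vec k" using U x by auto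
  have Uy: "U *\<^sub>v y \<in> carrier_vec n" using U y by auto
  have Hv: "U\<^sup>T *\<^sub>v (H *\<^sub>v ?v) = 0\<^sub>v k" using sp d(1,2) by (auto simp: spectral_split_def)
  have Hvc: "H *\<^sub>v ?v \<in> carrier_vec n" using H d(1) by auto
  have "?v \<bullet> ?x = (H *\<^sub>v ?v) \<bullet> (U *\<^sub>v y)"
    using scalar_prod_mult_mat_vec[OF H(1) d(1) Uy] H(2) by simp
  also have "\<dots> = 0" using scalar_prod_mult_mat_vec[OF U(1) Hvc y] Hv y by simp
  finally have vx: "?v \<bullet> ?x = 0" .
  have Uz: "U *\<^sub>v ?z \<in> carrier_vec n" using U z by auto
  have "?v \<bullet> (U *\<^sub>v ?z) = 0" using scalar_prod_mult_mat_vec[OF U(1) d(1) z] d(2) z by simp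
  hence "?v \<bullet> ?v = 0" using vx scalar_prod_minus_distrib[OF d(1) x Uz] by simp
  hence "l2_norm ?v = 0" by (simp add: l2_norm_def)
  hence "?v = 0\<^sub>v n" using l2_norm_eq_0[OF d(1)] by simp
  hence eq: "?x = U *\<^sub>v ?z" using d(3) Uz by simp
  have "s * l2_norm y \<le> l2_norm ?x" using sp y by (auto simp: spectral_split_def)
  also have "\<dots> = l2_norm ?z" using eq orthonormal_cols_l2_norm[OF U(2,1) z] by simp
  finally show ?thesis using eq z by blast
qed

lemma spectral_split_power_range:
  assumes sp: "spectral_split n k H U s e" and y: "y \<in> carrier_vec k"
  shows "\<exists>z \<in> carrier_vec k. H ^\<^sub>m g *\<^sub>v (U *\<^sub>v y) = U *\<^sub>v z \<and> s ^ g * l2_norm y \<le> l2_norm z"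
  using y
proof (induction g arbitrary: y)
  case 0
  have "H \<in> carrier_mat n n" "U \<in> carrier_mat n k" using sp by (auto simp: spectral_split_def)
  thus ?case using 0 by (intro bexI[of _ y]) auto
next
  case (Suc g)
  have H: "H \<in> carrier_mat n n" and U: "U \<in> carrier_mat n k" and s: "0 < s" using sp by (auto simp: spectral_split_def)
  obtain w where w: "w \<in> carrier_vec k" "H *\<^sub>v (U *\<^sub>v y) = U *\<^sub>v w" "s * l2_norm y \<le> l2_norm w"
    using spectral_split_range[OF sp Suc.prems] by auto
  obtain z where z: "z \<in> carrier_vec k" "H ^\<^sub>m g *\<^sub>v (U *\<^sub>v w) = U *\<^sub>v z" "s ^ g * l2_norm w \<le> l2_norm z"
    using Suc.IH[OF w(1)] by auto
  have "s ^ g * (s * l2_norm y) \<le> s ^ g * l2_norm w" using w(3) s by (intro mult_left_mono) auto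
  hence "s ^ Suc g * l2_norm y \<le> l2_norm z" using z(3) by (simp add: ac_simps)
  moreover have "H ^\<^sub>m Suc g *\<^sub>v (U *\<^sub>v y) = U *\<^sub>v z"
    using pow_mat_Suc_mult_vec[OF H, of "U *\<^sub>v y" g] U Suc.prems w(2) z(2) by auto
  ultimately show ?case using z(1) by blast
qed

lemma transpose_mult_mat_vec_carrier: "A \<in> carrier_mat m n \<Longrightarrow> A\<^sup>T *\<^sub>v v \<in> carrier_vec n"
  by (intro carrier_vecI) auto

lemma scaled_vec_norm:
  assumes "u \<in> carrier_vec k" "w \<in> carrier_vec k" "0 \<le> a"
    and "\<And>i. i < k \<Longrightarrow> \<exists>c\<ge>a. u $ i = c * w $ i"
  shows "a * l2_norm w \<le> l2_norm u"
proof -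
  have "(a * l2_norm w)\<^sup>2 = (\<Sum>i<k. a\<^sup>2 * (w $ i)\<^sup>2)"
    using l2_norm_square_sum[OF assms(2)] by (simp add: power_mult_distrib sum_distrib_left)
  also have "\<dots> \<le> (\<Sum>i<k. (u $ i)\<^sup>2)"
  proof (intro sum_mono)
    fix i assume "i \<in> {..<k}"
    then obtain c where "a \<le> c" "u $ i = c * w $ i" using assms(4) by auto
    thus "a\<^sup>2 * (w $ i)\<^sup>2 \<le> (u $ i)\<^sup>2"
      using assms(3) by (auto simp: power_mult_distrib intro!: mult_right_mono power_mono)
  qed
  also have "\<dots> = (l2_norm u)\<^sup>2" using l2_norm_square_sum[OF assms(1)] by simp
  finally show ?thesis by (rule power2_le_imp_le) simp
qed

lemma leading_singular_pair:
  assumes svd: "is_svd Y P s V" and Y: "Y \<in> carrier_mat n kt" and k: "1 \<le> k" "k \<le> min n kt"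
    and a: "0 \<le> a" "a \<le> s k"
  defines "Q \<equiv> take_cols k P" and "W \<equiv> take_cols k V"
  shows "\<And>v. v \<in> carrier_vec n \<Longrightarrow>
      a * l2_norm (Q\<^sup>T *\<^sub>v v) \<le> l2_norm (W\<^sup>T *\<^sub>v (Y\<^sup>T *\<^sub>v v))"
    and "\<And>h. h \<in> carrier_vec kt \<Longrightarrow>
      a * l2_norm (W\<^sup>T *\<^sub>v h) \<le> l2_norm (Q\<^sup>T *\<^sub>v (Y *\<^sub>v h))"
proof -
  note c = is_svd_carriers[OF svd Y]
  have Yt: "Y\<^sup>T \<in> carrier_mat kt n" using Y by auto
  have svdt: "is_svd (Y\<^sup>T) V s P" by (rule is_svd_transpose[OF svd Y])
  have Q: "Q \<in> carrier_mat n k" and W: "W \<in> carrier_mat kt k" using c by (auto simp: Q_def W_def)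
  have sa: "a \<le> s (i + 1)" if "i < k" for i
    using is_svd_antimono[OF svd Y, of "i + 1" k] that k a by auto
  show "a * l2_norm (Q\<^sup>T *\<^sub>v v) \<le> l2_norm (W\<^sup>T *\<^sub>v (Y\<^sup>T *\<^sub>v v))"
    if v: "v \<in> carrier_vec n" for v
  proof (rule scaled_vec_norm[where k = k])
    fix i assume i: "i < k"
    have Yv: "Y\<^sup>T *\<^sub>v v \<in> carrier_vec kt" using Yt v by (rule mult_mat_vec_carrier)
    have "(W\<^sup>T *\<^sub>v (Y\<^sup>T *\<^sub>v v)) $ i = s (i + 1) * (Q\<^sup>T *\<^sub>v v) $ i"
      unfolding W_def Q_def using k i is_svd_transpose_mult_vec[OF svdt Yt v, of i]
        take_cols_transpose_mult_vec[OF c(3) _ i Yv] take_cols_transpose_mult_vec[OF c(1) _ i v] by auto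
    thus "\<exists>c\<ge>a. (W\<^sup>T *\<^sub>v (Y\<^sup>T *\<^sub>v v)) $ i = c * (Q\<^sup>T *\<^sub>v v) $ i"
      using sa[OF i] by auto
  qed (use Q W a in \<open>auto intro: transpose_mult_mat_vec_carrier\<close>)
  show "a * l2_norm (W\<^sup>T *\<^sub>v h) \<le> l2_norm (Q\<^sup>T *\<^sub>v (Y *\<^sub>v h))"
    if h: "h \<in> carrier_vec kt" for h
  proof (rule scaled_vec_norm[where k = k])
    fix i assume i: "i < k"
    have Yh: "Y *\<^sub>v h \<in> carrier_vec n" using Y h by (rule mult_mat_vec_carrier)
    have "(Q\<^sup>T *\<^sub>v (Y *\<^sub>v h)) $ i = s (i + 1) * (W\<^sup>T *\<^sub>v h) $ i"
      unfolding W_def Q_def using k i is_svd_transpose_mult_vec[OF svd Y h, of i]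
        take_cols_transpose_mult_vec[OF c(1) _ i Yh] take_cols_transpose_mult_vec[OF c(3) _ i h] by auto
    thus "\<exists>c\<ge>a. (Q\<^sup>T *\<^sub>v (Y *\<^sub>v h)) $ i = c * (W\<^sup>T *\<^sub>v h) $ i"
      using sa[OF i] by auto
  qed (use Q W a in \<open>auto intro: transpose_mult_mat_vec_carrier\<close>)
qed

text \<open>\<open>A\<^sup>T w\<close> is the projection of \<open>h\<close> to the row space of \<open>A\<close>.\<close>

lemma row_space_decompose:
  assumes A: "A \<in> carrier_mat k m" and h: "h \<in> carrier_vec m" and b: "0 < b"
    and ge: "\<And>y. y \<in> carrier_vec k \<Longrightarrow> b * l2_norm y \<le> l2_norm (A\<^sup>T *\<^sub>v y)"
  obtains w r where "w \<in> carrier_vec k" "r \<in> carrier_vec m" "h = A\<^sup>T *\<^sub>v w + r"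
    "A *\<^sub>v r = 0\<^sub>v k" "b * l2_norm (A\<^sup>T *\<^sub>v w) \<le> l2_norm (A *\<^sub>v h)" "l2_norm r \<le> l2_norm h"
proof -
  have At: "A\<^sup>T \<in> carrier_mat m k" using A by auto
  define K where "K = A * A\<^sup>T"
  have K: "K \<in> carrier_mat k k" using A At by (auto simp: K_def)
  have Kv: "K *\<^sub>v y = A *\<^sub>v (A\<^sup>T *\<^sub>v y)" if "y \<in> carrier_vec k" for y
    unfolding K_def using A At that by (rule assoc_mult_mat_vec)
  have "det K \<noteq> 0"
  proof
    assume "det K = 0"
    then obtain y where y: "y \<in> carrier_vec k" "y \<noteq> 0\<^sub>v k" "K *\<^sub>v y = 0\<^sub>v k"
      using det_0_iff_vec_prod_zero[OF K] by auto
    have Ay: "A\<^sup>T *\<^sub>v y \<in> carrier_vec m" using At y(1) by (rule mult_mat_vec_carrier)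
    have "(A\<^sup>T *\<^sub>v y) \<bullet> (A\<^sup>T *\<^sub>v y) = y \<bullet> (A *\<^sub>v (A\<^sup>T *\<^sub>v y))"
      using scalar_prod_mult_mat_vec[OF A y(1) Ay] by simp
    also have "\<dots> = 0" using y Kv[OF y(1)] by simp
    finally have "l2_norm (A\<^sup>T *\<^sub>v y) = 0" by (simp add: l2_norm_def)
    hence "b * l2_norm y \<le> 0" using ge[OF y(1)] by simp
    thus False using b l2_norm_pos[OF y(1,2)] by (simp add: mult_le_0_iff)
  qed
  then obtain B where B: "B \<in> carrier_mat k k" "K * B = 1\<^sub>m k"
    using det_non_zero_imp_unit[OF K, unfolded Units_def] by (auto simp: ring_mat_def)
  define w where "w = B *\<^sub>v (A *\<^sub>v h)"
  have Ah: "A *\<^sub>v h \<in> carrier_vec k" using A h by (rule mult_mat_vec_carrier)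
  have w: "w \<in> carrier_vec k" unfolding w_def using B(1) Ah by (rule mult_mat_vec_carrier)
  have Aw: "A\<^sup>T *\<^sub>v w \<in> carrier_vec m" using At w by (rule mult_mat_vec_carrier)
  define r where "r = h - A\<^sup>T *\<^sub>v w"
  have r: "r \<in> carrier_vec m" using h Aw by (simp add: r_def)
  have "K *\<^sub>v w = A *\<^sub>v h"
    unfolding w_def using assoc_mult_mat_vec[OF K B(1) Ah] B(2) Ah by simp
  hence Kw: "A *\<^sub>v (A\<^sup>T *\<^sub>v w) = A *\<^sub>v h" using Kv[OF w] by simp
  have Ar: "A *\<^sub>v r = 0\<^sub>v k"
    unfolding r_def mult_minus_distrib_mat_vec[OF A h Aw] Kw using Ah by auto
  have hr: "h = A\<^sup>T *\<^sub>v w + r"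
    unfolding r_def using h Aw A by (intro eq_vecI) auto
  have "(A\<^sup>T *\<^sub>v w) \<bullet> r = 0"
    using scalar_prod_mult_mat_vec[OF A w r] Ar w by simp
  hence "(l2_norm h)\<^sup>2 = (l2_norm (A\<^sup>T *\<^sub>v w))\<^sup>2 + (l2_norm r)\<^sup>2"
    using l2_norm_add_square[OF Aw r] hr by simp
  hence "(l2_norm r)\<^sup>2 \<le> (l2_norm h)\<^sup>2" by simp
  hence rh: "l2_norm r \<le> l2_norm h" by (rule power2_le_imp_le) simp
  let ?t = "l2_norm (A\<^sup>T *\<^sub>v w)"
  have "?t * ?t = w \<bullet> (A *\<^sub>v h)"
    using scalar_prod_mult_mat_vec[OF A w Aw] Kw by (simp add: l2_norm_square[symmetric] power2_eq_square)
  also have "\<dots> \<le> l2_norm w * l2_norm (A *\<^sub>v h)" using scalar_prod_le_l2_norm[OF w Ah] by simp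
  finally have "b * (?t * ?t) \<le> (b * l2_norm w) * l2_norm (A *\<^sub>v h)"
    using b by (simp add: mult.assoc)
  also have "\<dots> \<le> ?t * l2_norm (A *\<^sub>v h)" using ge[OF w] by (intro mult_right_mono) auto
  finally have *: "(b * ?t) * ?t \<le> l2_norm (A *\<^sub>v h) * ?t" by (simp add: ac_simps)
  have "b * ?t \<le> l2_norm (A *\<^sub>v h)"
  proof (cases "?t = 0")
    case False
    hence "0 < ?t" using l2_norm_nonneg[of "A\<^sup>T *\<^sub>v w"] by linarith
    thus ?thesis using * by simp
  qed simp
  thus thesis using that w r hr Ar rh by blast
qed

text \<open>The second bound exploits that the leading right singular vectors of the sketch nearly span the
  row space of \<open>U\<^sup>T G\<close>.\<close>

lemma sketch_complement_bounds:
  assumes sp: "spectral_split n k H U s e" and k: "1 \<le> k" and G: "G \<in> carrier_mat n kt"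
    and sv: "leading_left_sv k (H ^\<^sub>m g * G) Q"
    and a: "0 \<le> a" "\<And>z. z \<in> carrier_vec n \<Longrightarrow> l2_norm (G\<^sup>T *\<^sub>v z) \<le> a * l2_norm z"
    and b: "0 < b" "\<And>y. y \<in> carrier_vec k \<Longrightarrow> b * l2_norm y \<le> l2_norm (G\<^sup>T *\<^sub>v (U *\<^sub>v y))"
    and v: "v \<in> carrier_vec n" "U\<^sup>T *\<^sub>v v = 0\<^sub>v k"
  defines "\<tau> \<equiv> e ^ g * a / (s ^ g * b)" and "h \<equiv> G\<^sup>T *\<^sub>v (H ^\<^sub>m g *\<^sub>v v)"
  shows "l2_norm (Q\<^sup>T *\<^sub>v v) \<le> \<tau> * l2_norm v"
    and "l2_norm (Q\<^sup>T *\<^sub>v v)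
      \<le> (l2_norm (U\<^sup>T *\<^sub>v (G *\<^sub>v h)) / b + \<tau>\<^sup>2 * l2_norm h) / (s ^ g * b)"
proof -
  have H: "H \<in> carrier_mat n n" "H\<^sup>T = H" and U: "U \<in> carrier_mat n k" "orthonormal_cols U"
    and s: "0 < s" and e: "0 \<le> e" using sp by (auto simp: spectral_split_def)
  have Hg: "H ^\<^sub>m g \<in> carrier_mat n n" using H by auto
  have Hgt: "transpose_mat (H ^\<^sub>m g) = H ^\<^sub>m g" by (rule pow_mat_symmetric[OF H])
  define Y where "Y = H ^\<^sub>m g * G"
  have Y: "Y \<in> carrier_mat n kt" using Hg G by (auto simp: Y_def)
  have Gt: "G\<^sup>T \<in> carrier_mat kt n" using G by auto
  have Ut: "U\<^sup>T \<in> carrier_mat k n" using U by auto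
  have Yt: "Y\<^sup>T *\<^sub>v x = G\<^sup>T *\<^sub>v (H ^\<^sub>m g *\<^sub>v x)" if "x \<in> carrier_vec n" for x
    unfolding Y_def transpose_mult[OF Hg G] Hgt using Gt Hg that by (rule assoc_mult_mat_vec)
  have Yv: "Y *\<^sub>v x = H ^\<^sub>m g *\<^sub>v (G *\<^sub>v x)" if "x \<in> carrier_vec kt" for x
    unfolding Y_def using Hg G that by (rule assoc_mult_mat_vec)
  from sv obtain P \<sigma> V where svd: "is_svd Y P \<sigma> V" and Q_def: "Q = take_cols k P" and km: "k \<le> min n kt"
    unfolding Y_def[symmetric] by (rule leading_left_svE[OF _ Y])
  note c = is_svd_carriers[OF svd Y]
  define W where "W = take_cols k V"
  define c0 where "c0 = s ^ g * b"
  have c0: "0 < c0" using s b by (simp add: c0_def)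
  have \<tau>0: "0 \<le> \<tau>" using e a s b by (simp add: \<tau>_def)
  have "c0 \<le> \<sigma> k"
  proof (rule singular_value_ge[OF is_svd_transpose[OF svd Y], where B = U])
    fix y :: "real vec" assume y: "y \<in> carrier_vec k"
    obtain z where z: "z \<in> carrier_vec k" "H ^\<^sub>m g *\<^sub>v (U *\<^sub>v y) = U *\<^sub>v z" "s ^ g * l2_norm y \<le> l2_norm z"
      using spectral_split_power_range[OF sp y] by blast
    have Uy: "U *\<^sub>v y \<in> carrier_vec n" using U(1) y by (rule mult_mat_vec_carrier)
    have "c0 * l2_norm y \<le> b * l2_norm z"
      using mult_left_mono[OF z(3), of b] b by (simp add: c0_def ac_simps)
    also have "\<dots> \<le> l2_norm (Y\<^sup>T *\<^sub>v (U *\<^sub>v y))"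
      using b(2)[OF z(1)] Yt[OF Uy] z(2) by simp
    finally show "c0 * l2_norm y \<le> l2_norm (Y\<^sup>T *\<^sub>v (U *\<^sub>v y))" .
  qed (use Y U k km in auto)
  note pair = leading_singular_pair[OF svd Y k km less_imp_le[OF c0] this, folded Q_def W_def]
  have W: "W \<in> carrier_mat kt k" "orthonormal_cols W"
    using c km orthonormal_take_cols[of V kt kt k] by (auto simp: W_def)
  have Wn: "l2_norm (W\<^sup>T *\<^sub>v x) \<le> l2_norm x" if "x \<in> carrier_vec kt" for x
    using norm_boundD[OF orthonormal_cols_norm_bound(2)[OF W(2)], of k kt x] W(1) that by auto
  have first: "l2_norm (Q\<^sup>T *\<^sub>v v) \<le> \<tau> * l2_norm v"
    if v: "v \<in> carrier_vec n" "U\<^sup>T *\<^sub>v v = 0\<^sub>v k" for v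
  proof -
    have Hv: "H ^\<^sub>m g *\<^sub>v v \<in> carrier_vec n" using Hg v(1) by (rule mult_mat_vec_carrier)
    have GHv: "G\<^sup>T *\<^sub>v (H ^\<^sub>m g *\<^sub>v v) \<in> carrier_vec kt" using Gt Hv by (rule mult_mat_vec_carrier)
    have "c0 * l2_norm (Q\<^sup>T *\<^sub>v v) \<le> l2_norm (G\<^sup>T *\<^sub>v (H ^\<^sub>m g *\<^sub>v v))"
      using pair(1)[OF v(1)] Wn[OF GHv] unfolding Yt[OF v(1)] by linarith
    also have "\<dots> \<le> a * (e ^ g * l2_norm v)"
      using a(2)[OF Hv] mult_left_mono[OF conjunct2[OF spectral_split_power_complement[OF sp v, of g]] a(1)] by linarith
    finally show ?thesis using c0 unfolding \<tau>_def c0_def[symmetric] by (simp add: field_simps)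
  qed
  show "l2_norm (Q\<^sup>T *\<^sub>v v) \<le> \<tau> * l2_norm v" by (rule first[OF v])
  have Hv: "H ^\<^sub>m g *\<^sub>v v \<in> carrier_vec n" using Hg v(1) by (rule mult_mat_vec_carrier)
  have h: "h \<in> carrier_vec kt" unfolding h_def using Gt Hv by (rule mult_mat_vec_carrier)
  define A where "A = U\<^sup>T * G"
  have A: "A \<in> carrier_mat k kt" using Ut G by (auto simp: A_def)
  have Av: "A *\<^sub>v x = U\<^sup>T *\<^sub>v (G *\<^sub>v x)" if "x \<in> carrier_vec kt" for x
    unfolding A_def using Ut G that by (rule assoc_mult_mat_vec)
  have At: "A\<^sup>T *\<^sub>v y = G\<^sup>T *\<^sub>v (U *\<^sub>v y)" if "y \<in> carrier_vec k" for y
  proof -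
    have "A\<^sup>T = G\<^sup>T * U" unfolding A_def transpose_mult[OF Ut G] by simp
    thus ?thesis using assoc_mult_mat_vec[OF Gt U(1) that] by simp
  qed
  obtain w r where wr: "w \<in> carrier_vec k" "r \<in> carrier_vec kt" "h = A\<^sup>T *\<^sub>v w + r"
    "A *\<^sub>v r = 0\<^sub>v k" "b * l2_norm (A\<^sup>T *\<^sub>v w) \<le> l2_norm (A *\<^sub>v h)" "l2_norm r \<le> l2_norm h"
    using row_space_decompose[OF A h b(1)] At b(2) by auto
  have Aw: "A\<^sup>T *\<^sub>v w \<in> carrier_vec kt" using A wr(1) by auto
  have Gr: "G *\<^sub>v r \<in> carrier_vec n" using G wr(2) by (rule mult_mat_vec_carrier)
  have Gr0: "U\<^sup>T *\<^sub>v (G *\<^sub>v r) = 0\<^sub>v k" using Av[OF wr(2)] wr(4) by simp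
  have HGr: "H ^\<^sub>m g *\<^sub>v (G *\<^sub>v r) \<in> carrier_vec n" using Hg Gr by (rule mult_mat_vec_carrier)
  note comp = spectral_split_power_complement[OF sp Gr Gr0, of g]
  have normG: "l2_norm (G *\<^sub>v r) \<le> a * l2_norm r"
  proof -
    have "norm_bound (G\<^sup>T) a" using Gt a(2) by (intro norm_boundI) auto
    hence "norm_bound G a" using norm_bound_transpose[of "G\<^sup>T" a] a(1) by simp
    thus ?thesis using G wr(2) by (rule norm_boundD)
  qed
  have "c0 * l2_norm (W\<^sup>T *\<^sub>v r) \<le> l2_norm (Q\<^sup>T *\<^sub>v (H ^\<^sub>m g *\<^sub>v (G *\<^sub>v r)))"
    using pair(2)[OF wr(2)] unfolding Yv[OF wr(2)] .
  also have "\<dots> \<le> \<tau> * l2_norm (H ^\<^sub>m g *\<^sub>v (G *\<^sub>v r))" by (rule first[OF HGr conjunct1[OF comp]])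
  also have "\<dots> \<le> \<tau> * (e ^ g * l2_norm (G *\<^sub>v r))" using \<tau>0 comp by (intro mult_left_mono) auto
  also have "\<dots> \<le> \<tau> * (e ^ g * (a * l2_norm h))"
    using \<tau>0 e a mult_left_mono[OF wr(6) a(1)] normG by (intro mult_left_mono) auto
  also have "\<dots> = c0 * (\<tau>\<^sup>2 * l2_norm h)"
    using c0 unfolding \<tau>_def c0_def[symmetric] by (simp add: power2_eq_square)
  finally have Wr: "l2_norm (W\<^sup>T *\<^sub>v r) \<le> \<tau>\<^sup>2 * l2_norm h" using c0 by simp
  have Wt: "W\<^sup>T \<in> carrier_mat k kt" using W by auto
  have "W\<^sup>T *\<^sub>v h = W\<^sup>T *\<^sub>v (A\<^sup>T *\<^sub>v w) + W\<^sup>T *\<^sub>v r"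
    unfolding wr(3) by (rule mult_add_distrib_mat_vec[OF Wt Aw wr(2)])
  hence "l2_norm (W\<^sup>T *\<^sub>v h) \<le> l2_norm (W\<^sup>T *\<^sub>v (A\<^sup>T *\<^sub>v w)) + l2_norm (W\<^sup>T *\<^sub>v r)"
    using l2_norm_triangle[of "W\<^sup>T *\<^sub>v (A\<^sup>T *\<^sub>v w)" k "W\<^sup>T *\<^sub>v r"]
      mult_mat_vec_carrier[OF Wt Aw] mult_mat_vec_carrier[OF Wt wr(2)] by simp
  also have "\<dots> \<le> l2_norm (A *\<^sub>v h) / b + \<tau>\<^sup>2 * l2_norm h"
  proof (rule add_mono[OF _ Wr])
    have "l2_norm (A\<^sup>T *\<^sub>v w) \<le> l2_norm (A *\<^sub>v h) / b"
      using wr(5) b(1) by (simp add: pos_le_divide_eq mult.commute)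
    thus "l2_norm (W\<^sup>T *\<^sub>v (A\<^sup>T *\<^sub>v w)) \<le> l2_norm (A *\<^sub>v h) / b"
      using Wn[OF Aw] by linarith
  qed
  finally have "c0 * l2_norm (Q\<^sup>T *\<^sub>v v) \<le> l2_norm (A *\<^sub>v h) / b + \<tau>\<^sup>2 * l2_norm h"
    using pair(1)[OF v(1)] unfolding Yt[OF v(1)] h_def[symmetric] by linarith
  thus "l2_norm (Q\<^sup>T *\<^sub>v v)
      \<le> (l2_norm (U\<^sup>T *\<^sub>v (G *\<^sub>v h)) / b + \<tau>\<^sup>2 * l2_norm h) / (s ^ g * b)"
    using c0 unfolding Av[OF h] c0_def[symmetric] by (simp add: pos_le_divide_eq mult.commute)
qed

lemma perturbed_spectral_split:
  assumes M: "M \<in> carrier_mat n n" and E: "E \<in> carrier_mat n n" and sym: "transpose_mat (M + E) = M + E"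
    and rank: "vec_space.rank n M = k" and k: "1 \<le> k" and \<sigma>: "singular_values M \<sigma>"
    and U: "leading_left_sv k (M + E) U" and e: "norm_bound E e" "0 \<le> e" "2 * e < \<sigma> k"
  shows "spectral_split n k (M + E) U (\<sigma> k / 2) e" "norm_bound (M + E) (\<sigma> 1 + e)"
proof -
  have H: "M + E \<in> carrier_mat n n" using M E by auto
  from \<sigma> obtain U1 V1 where svd1: "is_svd M U1 \<sigma> V1" unfolding singular_values_def by auto
  note c1 = is_svd_carriers[OF svd1 M]
  from U obtain P s V where svd: "is_svd (M + E) P s V" and UP: "U = take_cols k P" and kn: "k \<le> min n n"
    by (rule leading_left_svE[OF _ H])
  have kn: "k \<le> n" using kn by simp
  have Hv: "(M + E) *\<^sub>v x = M *\<^sub>v x + E *\<^sub>v x" if "x \<in> carrier_vec n" for x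
    by (rule add_mult_distrib_mat_vec[OF M E that])
  have "\<sigma> k - e \<le> s k"
  proof (rule singular_value_ge[OF svd H k])
    let ?B = "take_cols k V1"
    show B: "?B \<in> carrier_mat n k" using c1 by auto
    show oB: "orthonormal_cols ?B" by (rule orthonormal_take_cols[OF c1(4,3) kn])
    fix y :: "real vec" assume y: "y \<in> carrier_vec k"
    let ?x = "?B *\<^sub>v y"
    have x: "?x \<in> carrier_vec n" using B y by (rule mult_mat_vec_carrier)
    have nx: "l2_norm ?x = l2_norm y" by (rule orthonormal_cols_l2_norm[OF oB B y])
    have "\<sigma> (k - 1 + 1) * l2_norm ?x \<le> l2_norm (M *\<^sub>v ?x)"
      using kn k by (intro is_svd_norm_ge[OF svd1 M x] take_cols_complement_zero[OF c1(3,4) kn _ _ y]) auto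
    hence "\<sigma> k * l2_norm y \<le> l2_norm (M *\<^sub>v ?x)" using k nx by simp
    moreover have "l2_norm (E *\<^sub>v ?x) \<le> e * l2_norm y" using norm_boundD[OF e(1) E x] nx by simp
    ultimately show "(\<sigma> k - e) * l2_norm y \<le> l2_norm ((M + E) *\<^sub>v ?x)"
      unfolding Hv[OF x]
      using l2_norm_diff_ge[OF mult_mat_vec_carrier[OF M x] mult_mat_vec_carrier[OF E x]] by (simp add: left_diff_distrib)
  qed (use kn in simp)
  hence sk: "\<sigma> k / 2 \<le> s k" using e by simp
  have sk1: "s (k + 1) \<le> e" if "k < n"
  proof -
    obtain F C where FC: "F \<in> carrier_mat n k" "C \<in> carrier_mat k n" "M = F * C"
      using vec_space.rank_factorization[OF M] rank by auto
    show ?thesis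
    proof (rule singular_value_le[OF svd H _ FC(2)])
      fix x :: "real vec" assume x: "x \<in> carrier_vec n" "C *\<^sub>v x = 0\<^sub>v k"
      have "M *\<^sub>v x = F *\<^sub>v (C *\<^sub>v x)" unfolding FC(3) by (rule assoc_mult_mat_vec[OF FC(1,2) x(1)])
      also have "\<dots> = 0\<^sub>v n" unfolding x(2) by (rule mult_mat_vec_zero[OF FC(1)])
      finally have "(M + E) *\<^sub>v x = E *\<^sub>v x" using Hv[OF x(1)] mult_mat_vec_carrier[OF E x(1)] by simp
      thus "l2_norm ((M + E) *\<^sub>v x) \<le> e * l2_norm x" using norm_boundD[OF e(1) E x(1)] by simp
    qed (use that in simp)
  qed
  show "spectral_split n k (M + E) U (\<sigma> k / 2) e"
    unfolding UP by (rule spectral_splitI[OF svd H sym k kn _ sk e(2) _ sk1]) (use e in auto)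
  have "norm_bound M (\<sigma> (0 + 1))"
    by (rule norm_boundI[OF M], rule is_svd_norm_le[OF svd1 M]) (use k kn in auto)
  thus "norm_bound (M + E) (\<sigma> 1 + e)" using norm_bound_add[OF M E _ e(1)] by simp
qed

lemma transpose_mult_unit_vec:
  assumes "(A :: real mat) \<in> carrier_mat n k" "i < n"
  shows "A\<^sup>T *\<^sub>v unit_vec n i = row A i"
  using assms by (intro eq_vecI) (auto simp: scalar_prod_right_unit)

lemma norm_2inf_le:
  assumes "A \<in> carrier_mat n k" "0 < n" "\<And>i. i < n \<Longrightarrow> l2_norm (A\<^sup>T *\<^sub>v unit_vec n i) \<le> c"
  shows "norm_2inf A \<le> c"
  unfolding norm_2inf_def using assms by (subst Max_le_iff) (auto simp: transpose_mult_unit_vec)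

lemma norm_2inf_ge:
  assumes "A \<in> carrier_mat n k" "i < n"
  shows "l2_norm (A\<^sup>T *\<^sub>v unit_vec n i) \<le> norm_2inf A"
  unfolding norm_2inf_def transpose_mult_unit_vec[OF assms] using assms by (intro Max_ge) auto

lemma norm_2inf_nonneg: "A \<in> carrier_mat n k \<Longrightarrow> 0 < n \<Longrightarrow> 0 \<le> norm_2inf A"
  using norm_2inf_ge[of A n k 0] l2_norm_nonneg order.trans by blast

lemma d_2inf_le:
  assumes U: "U1 \<in> carrier_mat n k" "U2 \<in> carrier_mat n k" and n: "0 < n"
    and W: "W \<in> carrier_mat k k" "orthonormal_cols W"
  shows "d_2inf U1 U2 \<le> norm_2inf (U1 - U2 * W)"
  unfolding d_2inf_def
proof (rule cINF_lower)
  show "W \<in> {W \<in> carrier_mat (dim_col U2) (dim_col U2). orthonormal_cols W}" using U W by auto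
  show "bdd_below ((\<lambda>W. norm_2inf (U1 - U2 * W)) ` {W \<in> carrier_mat (dim_col U2) (dim_col U2). orthonormal_cols W})"
    using U n by (intro bdd_belowI2[of _ 0] norm_2inf_nonneg[of _ n k]) auto
qed

lemma d_2inf_ge:
  assumes U: "U1 \<in> carrier_mat n k" "U2 \<in> carrier_mat n k"
    and W: "\<And>W. W \<in> carrier_mat k k \<Longrightarrow> orthonormal_cols W \<Longrightarrow> c \<le> norm_2inf (U1 - U2 * W)"
  shows "c \<le> d_2inf U1 U2"
  unfolding d_2inf_def
  using U W orthonormal_cols_one[of k] by (intro cINF_greatest) (auto intro: exI[of _ "1\<^sub>m k"])

lemma transpose_diff_mult_vec:
  assumes A: "(A :: real mat) \<in> carrier_mat n k" and U: "U \<in> carrier_mat n k" and W: "W \<in> carrier_mat k k"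
    and x: "x \<in> carrier_vec n"
  shows "transpose_mat (A - U * W) *\<^sub>v x = A\<^sup>T *\<^sub>v x - W\<^sup>T *\<^sub>v (U\<^sup>T *\<^sub>v x)"
proof -
  have UW: "U * W \<in> carrier_mat n k" using U W by auto
  have At: "A\<^sup>T \<in> carrier_mat k n" using A by auto
  have Ut: "U\<^sup>T \<in> carrier_mat k n" using U by auto
  have Wt: "W\<^sup>T \<in> carrier_mat k k" using W by auto
  have t: "transpose_mat (A - U * W) = A\<^sup>T - W\<^sup>T * U\<^sup>T"
    unfolding transpose_minus[OF A UW] transpose_mult[OF U W] ..
  show ?thesis unfolding t minus_mult_distrib_mat_vec[OF At mult_carrier_mat[OF Wt Ut] x]
    using assoc_mult_mat_vec[OF Wt Ut x] by simp
qed

lemma d_2inf_rotate_le: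
  assumes Q: "Q \<in> carrier_mat n k" and U: "U \<in> carrier_mat n k" and Uh: "Uh \<in> carrier_mat n k" and n: "0 < n"
    and W: "W \<in> carrier_mat k k" "orthonormal_cols W"
    and R: "\<And>i. i < n \<Longrightarrow> l2_norm (Q\<^sup>T *\<^sub>v unit_vec n i
      - W\<^sup>T *\<^sub>v (Uh\<^sup>T *\<^sub>v unit_vec n i)) \<le> R"
  shows "d_2inf Q U \<le> d_2inf Uh U + R"
proof -
  have "d_2inf Q U - R \<le> d_2inf Uh U"
  proof (rule d_2inf_ge[OF Uh U])
    fix W' :: "real mat" assume W': "W' \<in> carrier_mat k k" "orthonormal_cols W'"
    have WW: "W' * W \<in> carrier_mat k k" "orthonormal_cols (W' * W)"
      using W W' orthonormal_cols_mult by auto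
    have UW': "Uh - U * W' \<in> carrier_mat n k" using Uh U W' by auto
    have "d_2inf Q U \<le> norm_2inf (Q - U * (W' * W))" by (rule d_2inf_le[OF Q U n WW])
    also have "\<dots> \<le> norm_2inf (Uh - U * W') + R"
    proof (rule norm_2inf_le[OF _ n])
      show "Q - U * (W' * W) \<in> carrier_mat n k"
        by (intro minus_carrier_mat mult_carrier_mat[OF U WW(1)])
      fix i assume i: "i < n"
      let ?e = "unit_vec n i :: real vec"
      let ?q = "Q\<^sup>T *\<^sub>v ?e" and ?h = "Uh\<^sup>T *\<^sub>v ?e" and ?u = "U\<^sup>T *\<^sub>v ?e"
      have q: "?q \<in> carrier_vec k" and h: "?h \<in> carrier_vec k" and u: "?u \<in> carrier_vec k"
        using Q Uh U by (auto intro: transpose_mult_mat_vec_carrier)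
      have Wt: "W\<^sup>T \<in> carrier_mat k k" and Wt': "W'\<^sup>T \<in> carrier_mat k k" using W W' by auto
      have w'u: "W'\<^sup>T *\<^sub>v ?u \<in> carrier_vec k" using Wt' u by (rule mult_mat_vec_carrier)
      have wh: "W\<^sup>T *\<^sub>v ?h \<in> carrier_vec k" using Wt h by (rule mult_mat_vec_carrier)
      have "transpose_mat (W' * W) *\<^sub>v ?u = W\<^sup>T *\<^sub>v (W'\<^sup>T *\<^sub>v ?u)"
        unfolding transpose_mult[OF W'(1) W(1)] by (rule assoc_mult_mat_vec[OF Wt Wt' u])
      hence "transpose_mat (Q - U * (W' * W)) *\<^sub>v ?e = ?q - W\<^sup>T *\<^sub>v (W'\<^sup>T *\<^sub>v ?u)"
        using transpose_diff_mult_vec[OF Q U WW(1), of ?e] by simp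
      also have "\<dots> = (?q - W\<^sup>T *\<^sub>v ?h) + W\<^sup>T *\<^sub>v (?h - W'\<^sup>T *\<^sub>v ?u)"
        unfolding mult_minus_distrib_mat_vec[OF Wt h w'u]
        using q wh mult_mat_vec_carrier[OF Wt w'u] by (intro eq_vecI) auto
      finally have "l2_norm (transpose_mat (Q - U * (W' * W)) *\<^sub>v ?e)
          \<le> l2_norm (?q - W\<^sup>T *\<^sub>v ?h) + l2_norm (W\<^sup>T *\<^sub>v (?h - W'\<^sup>T *\<^sub>v ?u))"
        using l2_norm_triangle[of "?q - W\<^sup>T *\<^sub>v ?h" k "W\<^sup>T *\<^sub>v (?h - W'\<^sup>T *\<^sub>v ?u)"]
          q wh h w'u Wt by (metis minus_carrier_vec mult_mat_vec_carrier)
      also have "\<dots> \<le> R + l2_norm (?h - W'\<^sup>T *\<^sub>v ?u)"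
        using R[OF i] norm_boundD[OF orthonormal_cols_norm_bound(2)[OF W(2)] Wt, of "?h - W'\<^sup>T *\<^sub>v ?u"] h w'u
        by auto
      also have "?h - W'\<^sup>T *\<^sub>v ?u = transpose_mat (Uh - U * W') *\<^sub>v ?e"
        using transpose_diff_mult_vec[OF Uh U W'(1), of ?e] by simp
      also have "l2_norm \<dots> \<le> norm_2inf (Uh - U * W')" by (rule norm_2inf_ge[OF UW' i])
      finally show "l2_norm (transpose_mat (Q - U * (W' * W)) *\<^sub>v ?e) \<le> norm_2inf (Uh - U * W') + R" by simp
    qed
    finally show "d_2inf Q U - R \<le> norm_2inf (Uh - U * W')" by simp
  qed
  thus ?thesis by simp
qed

lemma row_norm_le_d_2inf:
  assumes Uh: "Uh \<in> carrier_mat n k" and U: "U \<in> carrier_mat n k" and i: "i < n"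
  shows "l2_norm (Uh\<^sup>T *\<^sub>v unit_vec n i) \<le> d_2inf Uh U + norm_2inf U"
proof -
  let ?e = "unit_vec n i :: real vec"
  have "l2_norm (Uh\<^sup>T *\<^sub>v ?e) - norm_2inf U \<le> d_2inf Uh U"
  proof (rule d_2inf_ge[OF Uh U])
    fix W :: "real mat" assume W: "W \<in> carrier_mat k k" "orthonormal_cols W"
    let ?h = "Uh\<^sup>T *\<^sub>v ?e" and ?u = "U\<^sup>T *\<^sub>v ?e"
    have h: "?h \<in> carrier_vec k" and u: "?u \<in> carrier_vec k"
      using Uh U by (auto intro: transpose_mult_mat_vec_carrier)
    have Wt: "W\<^sup>T \<in> carrier_mat k k" using W by auto
    have wu: "W\<^sup>T *\<^sub>v ?u \<in> carrier_vec k" using Wt u by (rule mult_mat_vec_carrier)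
    have "?h = (?h - W\<^sup>T *\<^sub>v ?u) + W\<^sup>T *\<^sub>v ?u"
      using h wu Uh W(1) by (intro eq_vecI) auto
    hence "l2_norm ?h \<le> l2_norm (?h - W\<^sup>T *\<^sub>v ?u) + l2_norm (W\<^sup>T *\<^sub>v ?u)"
      using l2_norm_triangle[of "?h - W\<^sup>T *\<^sub>v ?u" k "W\<^sup>T *\<^sub>v ?u"] h wu by auto
    also have "l2_norm (?h - W\<^sup>T *\<^sub>v ?u) \<le> norm_2inf (Uh - U * W)"
      using norm_2inf_ge[OF minus_carrier_mat[OF mult_carrier_mat[OF U W(1)]] i, of Uh]
        transpose_diff_mult_vec[OF Uh U W(1), of ?e] by simp
    also have "l2_norm (W\<^sup>T *\<^sub>v ?u) \<le> 1 * l2_norm ?u"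
      by (rule norm_boundD[OF orthonormal_cols_norm_bound(2)[OF W(2)] Wt u])
    also have "l2_norm ?u \<le> norm_2inf U" by (rule norm_2inf_ge[OF U i])
    finally show "l2_norm ?h - norm_2inf U \<le> norm_2inf (Uh - U * W)" by simp
  qed
  thus ?thesis by simp
qed

lemma norm_2inf_orthonormal_bounds:
  assumes U: "U \<in> carrier_mat n k" "orthonormal_cols U" and k: "1 \<le> k" and n: "0 < n"
  shows "1 \<le> norm_2inf U * sqrt (real n)" "norm_2inf U \<le> 1"
proof -
  have u0: "0 \<le> norm_2inf U" by (rule norm_2inf_nonneg[OF U(1) n])
  show "norm_2inf U \<le> 1"
  proof (rule norm_2inf_le[OF U(1) n])
    fix i assume i: "i < n"
    have "l2_norm (U\<^sup>T *\<^sub>v unit_vec n i) \<le> 1 * l2_norm (unit_vec n i)"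
      using U by (intro norm_boundD[OF orthonormal_cols_norm_bound(2)[OF U(2)]]) auto
    thus "l2_norm (U\<^sup>T *\<^sub>v unit_vec n i) \<le> 1" using i by (simp add: l2_norm_def)
  qed
  let ?e = "unit_vec k 0 :: real vec"
  have "1 = (l2_norm (U *\<^sub>v ?e))\<^sup>2"
    using orthonormal_cols_l2_norm[OF U(2,1), of ?e] k by (simp add: l2_norm_def)
  also have "\<dots> = (\<Sum>i<n. ((U *\<^sub>v ?e) $ i)\<^sup>2)"
    using U(1) by (intro l2_norm_square_sum) auto
  also have "\<dots> \<le> (\<Sum>i<n. (norm_2inf U)\<^sup>2)"
  proof (intro sum_mono)
    fix i assume "i \<in> {..<n}"
    hence i: "i < n" by simp
    have "(U *\<^sub>v ?e) $ i = row U i $ 0" using U(1) i k by (auto simp: scalar_prod_right_unit)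
    also have "row U i = U\<^sup>T *\<^sub>v unit_vec n i" by (rule transpose_mult_unit_vec[OF U(1) i, symmetric])
    finally have "\<bar>(U *\<^sub>v ?e) $ i\<bar> \<le> l2_norm (U\<^sup>T *\<^sub>v unit_vec n i)"
      using abs_index_le_l2_norm[of 0 "U\<^sup>T *\<^sub>v unit_vec n i"] U(1) k by auto
    also have "\<dots> \<le> norm_2inf U" by (rule norm_2inf_ge[OF U(1) i])
    finally show "((U *\<^sub>v ?e) $ i)\<^sup>2 \<le> (norm_2inf U)\<^sup>2" using u0 by (simp add: abs_le_square_iff[symmetric])
  qed
  also have "\<dots> = (norm_2inf U * sqrt (real n))\<^sup>2" by (simp add: power_mult_distrib)
  finally have "1\<^sup>2 \<le> (norm_2inf U * sqrt (real n))\<^sup>2" by simp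
  thus "1 \<le> norm_2inf U * sqrt (real n)" using u0 by (intro power2_le_imp_le[of 1]) auto
qed

lemma norm_max_le:
  assumes "A \<in> carrier_mat n m" "0 < n" "0 < m" "\<And>i j. i < n \<Longrightarrow> j < m \<Longrightarrow> \<bar>A $$ (i, j)\<bar> \<le> c"
  shows "norm_max A \<le> c"
  unfolding norm_max_def using assms by (subst Max_le_iff) auto

lemma norm_max_ge:
  assumes "A \<in> carrier_mat n m" "i < n" "j < m"
  shows "\<bar>A $$ (i, j)\<bar> \<le> norm_max A"
  unfolding norm_max_def using assms by (intro Max_ge) (auto intro: rev_image_eqI[of "(i, j)"])

lemma norm_max_diff_le:
  assumes A: "A \<in> carrier_mat n n" and B: "B \<in> carrier_mat n n" and M: "M \<in> carrier_mat n n" and n: "0 < n"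
    and D: "\<And>i j. i < n \<Longrightarrow> j < n \<Longrightarrow> \<bar>A $$ (i, j) - B $$ (i, j)\<bar> \<le> D"
  shows "norm_max (A - M) \<le> norm_max (B - M) + D"
proof (rule norm_max_le[OF minus_carrier_mat[OF M] n n])
  fix i j assume ij: "i < n" "j < n"
  have "\<bar>(B - M) $$ (i, j)\<bar> \<le> norm_max (B - M)" by (rule norm_max_ge[OF minus_carrier_mat[OF M] ij])
  thus "\<bar>(A - M) $$ (i, j)\<bar> \<le> norm_max (B - M) + D" using D[OF ij] ij A B M by auto
qed

lemma projected_entry:
  assumes Q: "(Q :: real mat) \<in> carrier_mat n k" and H: "H \<in> carrier_mat n n" and ij: "i < n" "j < n"
  shows "(Q * Q\<^sup>T * H) $$ (i, j)
    = (Q\<^sup>T *\<^sub>v unit_vec n i) \<bullet> (Q\<^sup>T *\<^sub>v (H *\<^sub>v unit_vec n j))"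
proof -
  have Qt: "Q\<^sup>T \<in> carrier_mat k n" using Q by auto
  have QQ: "Q * Q\<^sup>T \<in> carrier_mat n n" using Q Qt by (rule mult_carrier_mat)
  have c: "Q * Q\<^sup>T * H \<in> carrier_mat n n" using QQ H by (rule mult_carrier_mat)
  let ?e = "unit_vec n i :: real vec" and ?f = "unit_vec n j :: real vec"
  have Hf: "H *\<^sub>v ?f \<in> carrier_vec n" using H by (rule mult_mat_vec_carrier) simp
  have QHf: "Q\<^sup>T *\<^sub>v (H *\<^sub>v ?f) \<in> carrier_vec k" using Qt Hf by (rule mult_mat_vec_carrier)
  have "(Q * Q\<^sup>T * H) $$ (i, j) = ((Q * Q\<^sup>T * H) *\<^sub>v ?f) $ i"
  proof -
    have "(B *\<^sub>v ?f) $ i = B $$ (i, j)" if "B \<in> carrier_mat n n" for B :: "real mat"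
      using that ij by (auto simp: scalar_prod_right_unit)
    thus ?thesis using c by simp
  qed
  also have "(Q * Q\<^sup>T * H) *\<^sub>v ?f = Q *\<^sub>v (Q\<^sup>T *\<^sub>v (H *\<^sub>v ?f))"
    using assoc_mult_mat_vec[OF QQ H, of ?f] assoc_mult_mat_vec[OF Q Qt Hf] by simp
  also have "\<dots> $ i = ?e \<bullet> \<dots>"
    using ij mult_mat_vec_carrier[OF Q QHf] by (simp add: scalar_prod_left_unit)
  also have "\<dots> = (Q\<^sup>T *\<^sub>v ?e) \<bullet> (Q\<^sup>T *\<^sub>v (H *\<^sub>v ?f))"
    by (rule scalar_prod_mult_mat_vec[OF Q _ QHf]) simp
  finally show ?thesis .
qed

lemma sketch_error_bounds:
  assumes sp: "spectral_split n k H Uh s e" and k: "1 \<le> k" and n: "0 < n" and G: "G \<in> carrier_mat n kt"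
    and sv: "leading_left_sv k (H ^\<^sub>m g * G) Q"
    and a: "0 \<le> a" "\<And>z. z \<in> carrier_vec n \<Longrightarrow> l2_norm (G\<^sup>T *\<^sub>v z) \<le> a * l2_norm z"
    and b: "0 < b" "\<And>y. y \<in> carrier_vec k \<Longrightarrow> b * l2_norm y \<le> l2_norm (G\<^sup>T *\<^sub>v (Uh *\<^sub>v y))"
    and v: "\<And>i. v i = unit_vec n i - Uh *\<^sub>v (Uh\<^sup>T *\<^sub>v unit_vec n i)"
    and rows: "\<And>i. i < n \<Longrightarrow> l2_norm (G\<^sup>T *\<^sub>v (H ^\<^sub>m g *\<^sub>v v i)) \<le> \<alpha>"
      "\<And>i. i < n \<Longrightarrow> l2_norm (Uh\<^sup>T *\<^sub>v (G *\<^sub>v (G\<^sup>T *\<^sub>v (H ^\<^sub>m g *\<^sub>v v i)))) \<le> \<beta>"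
      "\<And>i. i < n \<Longrightarrow> l2_norm (G\<^sup>T *\<^sub>v (H ^\<^sub>m g *\<^sub>v (H *\<^sub>v v i))) \<le> e * \<alpha>"
      "\<And>i. i < n \<Longrightarrow> l2_norm (Uh\<^sup>T *\<^sub>v (G *\<^sub>v (G\<^sup>T *\<^sub>v (H ^\<^sub>m g *\<^sub>v (H *\<^sub>v v i))))) \<le> e * \<beta>"
    and \<mu>: "\<And>i. i < n \<Longrightarrow> l2_norm (Uh\<^sup>T *\<^sub>v unit_vec n i) \<le> \<mu>"
    and \<eta>: "norm_bound H \<eta>" "0 \<le> \<eta>"
  defines "\<tau> \<equiv> e ^ g * a / (s ^ g * b)"
  defines "\<rho> \<equiv> (\<beta> / b + \<tau>\<^sup>2 * \<alpha>) / (s ^ g * b)"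
  defines "R \<equiv> 4 * \<tau>\<^sup>2 * \<mu> + \<rho>"
  shows "U \<in> carrier_mat n k \<Longrightarrow> d_2inf Q U \<le> d_2inf Uh U + R"
    and "M \<in> carrier_mat n n \<Longrightarrow> norm_max (Q * Q\<^sup>T * H - M)
      \<le> norm_max (Uh * Uh\<^sup>T * H - M) + ((R + 4 * \<tau>\<^sup>2 * \<mu>) * (\<eta> * \<mu>) + (\<mu> + R) * (e * \<rho>))"
proof -
  have H: "H \<in> carrier_mat n n" "H\<^sup>T = H" and U: "Uh \<in> carrier_mat n k" "orthonormal_cols Uh"
    and s: "0 < s" and e: "0 \<le> e" using sp by (auto simp: spectral_split_def)
  have HgG: "H ^\<^sub>m g * G \<in> carrier_mat n kt" using H G by auto
  have Q: "Q \<in> carrier_mat n k" "orthonormal_cols Q" by (rule leading_left_sv_orthonormal[OF sv HgG])+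
  have Ut: "Uh\<^sup>T \<in> carrier_mat k n" and Qt: "Q\<^sup>T \<in> carrier_mat k n" using U Q by auto
  have c0: "0 < s ^ g * b" using s b by simp
  have \<tau>0: "0 \<le> \<tau>" using e a s b by (simp add: \<tau>_def)
  have comp1: "l2_norm (Q\<^sup>T *\<^sub>v y) \<le> \<tau> * l2_norm y"
    and comp2: "l2_norm (Q\<^sup>T *\<^sub>v y)
      \<le> (l2_norm (Uh\<^sup>T *\<^sub>v (G *\<^sub>v (G\<^sup>T *\<^sub>v (H ^\<^sub>m g *\<^sub>v y)))) / b
        + \<tau>\<^sup>2 * l2_norm (G\<^sup>T *\<^sub>v (H ^\<^sub>m g *\<^sub>v y))) / (s ^ g * b)"
    if "y \<in> carrier_vec n" "Uh\<^sup>T *\<^sub>v y = 0\<^sub>v k" for y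
    unfolding \<tau>_def
    using sketch_complement_bounds[OF sp k G sv a(1) _ b(1)] a(2) b(2) that by blast+
  have U1: "l2_norm (Uh\<^sup>T *\<^sub>v x) \<le> l2_norm x" if "x \<in> carrier_vec n" for x
    using norm_boundD[OF orthonormal_cols_norm_bound(2)[OF U(2)] Ut that] by simp
  define A where "A = Uh\<^sup>T * Q"
  have A: "A \<in> carrier_mat k k" using Ut Q by (auto simp: A_def)
  have At: "A\<^sup>T \<in> carrier_mat k k" using A by auto
  have Av: "A *\<^sub>v x = Uh\<^sup>T *\<^sub>v (Q *\<^sub>v x)" if "x \<in> carrier_vec k" for x
    unfolding A_def by (rule assoc_mult_mat_vec[OF Ut Q(1) that])
  have Atv: "A\<^sup>T *\<^sub>v x = Q\<^sup>T *\<^sub>v (Uh *\<^sub>v x)" if "x \<in> carrier_vec k" for x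
  proof -
    have "A\<^sup>T = Q\<^sup>T * Uh" unfolding A_def transpose_mult[OF Ut Q(1)] by simp
    thus ?thesis using assoc_mult_mat_vec[OF Qt U(1) that] by simp
  qed
  have nA: "norm_bound A 1"
    using norm_bound_mult[OF Ut Q(1) orthonormal_cols_norm_bound(2)[OF U(2)] orthonormal_cols_norm_bound(1)[OF Q(2)]]
    by (simp add: A_def)
  have D: "norm_bound (1\<^sub>m k - A\<^sup>T * A) (\<tau>\<^sup>2)"
  proof (rule norm_boundI[of _ k k])
    show "1\<^sub>m k - A\<^sup>T * A \<in> carrier_mat k k" using A by auto
    fix x :: "real vec" assume x: "x \<in> carrier_vec k"
    let ?p = "Q *\<^sub>v x"
    have p: "?p \<in> carrier_vec n" using Q(1) x by (rule mult_mat_vec_carrier)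
    let ?w = "?p - Uh *\<^sub>v (Uh\<^sup>T *\<^sub>v ?p)"
    note d = orthonormal_decompose[OF U p]
    have Up: "Uh\<^sup>T *\<^sub>v ?p \<in> carrier_vec k" using Ut p by (rule mult_mat_vec_carrier)
    have UUp: "Uh *\<^sub>v (Uh\<^sup>T *\<^sub>v ?p) \<in> carrier_vec n" using U(1) Up by (rule mult_mat_vec_carrier)
    have AAx: "(A\<^sup>T * A) *\<^sub>v x = Q\<^sup>T *\<^sub>v (Uh *\<^sub>v (Uh\<^sup>T *\<^sub>v ?p))"
      using assoc_mult_mat_vec[OF At A x] Av[OF x] Atv[OF Up] by simp
    have "(1\<^sub>m k - A\<^sup>T * A) *\<^sub>v x = x - (A\<^sup>T * A) *\<^sub>v x"
      using minus_mult_distrib_mat_vec[of "1\<^sub>m k" k k "A\<^sup>T * A" x] A x by simp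
    also have "\<dots> = Q\<^sup>T *\<^sub>v ?w"
      unfolding AAx mult_minus_distrib_mat_vec[OF Qt p UUp] orthonormal_cols_transpose_mult_vec[OF Q(2,1) x] ..
    finally have eq: "(1\<^sub>m k - A\<^sup>T * A) *\<^sub>v x = Q\<^sup>T *\<^sub>v ?w" .
    have "?w \<bullet> (Uh *\<^sub>v (Uh\<^sup>T *\<^sub>v ?p)) = 0"
      using scalar_prod_mult_mat_vec[OF U(1) d(1) Up] d(2) Up by simp
    hence "?w \<bullet> ?w = ?w \<bullet> ?p" using scalar_prod_minus_distrib[OF d(1) p UUp] by simp
    also have "\<dots> = (Q\<^sup>T *\<^sub>v ?w) \<bullet> x" by (rule scalar_prod_mult_mat_vec[OF Q(1) d(1) x])
    also have "\<dots> \<le> l2_norm (Q\<^sup>T *\<^sub>v ?w) * l2_norm x"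
      using scalar_prod_le_l2_norm[OF mult_mat_vec_carrier[OF Qt d(1)] x] by simp
    also have "\<dots> \<le> (\<tau> * l2_norm ?w) * l2_norm x" by (intro mult_right_mono comp1[OF d(1,2)]) simp
    finally have "l2_norm ?w * l2_norm ?w \<le> (\<tau> * l2_norm x) * l2_norm ?w"
      by (simp add: l2_norm_square[symmetric] power2_eq_square ac_simps)
    hence w: "l2_norm ?w \<le> \<tau> * l2_norm x"
    proof (cases "l2_norm ?w = 0")
      case False
      hence "0 < l2_norm ?w" using l2_norm_nonneg[of ?w] by linarith
      thus ?thesis using \<open>l2_norm ?w * l2_norm ?w \<le> (\<tau> * l2_norm x) * l2_norm ?w\<close> by simp
    qed (simp add: \<tau>0)
    have "l2_norm (Q\<^sup>T *\<^sub>v ?w) \<le> \<tau> * (\<tau> * l2_norm x)"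
      using comp1[OF d(1,2)] mult_left_mono[OF w \<tau>0] by linarith
    thus "l2_norm ((1\<^sub>m k - A\<^sup>T * A) *\<^sub>v x) \<le> \<tau>\<^sup>2 * l2_norm x"
      unfolding eq by (simp add: power2_eq_square)
  qed
  obtain W where W: "W \<in> carrier_mat k k" "orthonormal_cols W" "norm_bound (A - W) (4 * \<tau>\<^sup>2)"
    using orthogonal_approximation[OF A nA D] by auto
  have Wt: "W\<^sup>T \<in> carrier_mat k k" using W by auto
  have AW: "A - W \<in> carrier_mat k k" using W(1) by (rule minus_carrier_mat)
  have AWt: "norm_bound (transpose_mat (A - W)) (4 * \<tau>\<^sup>2)" by (rule norm_bound_transpose[OF W(3)]) simp
  let ?x = "\<lambda>i. Uh\<^sup>T *\<^sub>v unit_vec n i"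
  let ?q = "\<lambda>i. Q\<^sup>T *\<^sub>v unit_vec n i"
  have xc: "?x i \<in> carrier_vec k" for i using Ut by (rule mult_mat_vec_carrier) simp
  have qc: "?q i \<in> carrier_vec k" for i using Qt by (rule mult_mat_vec_carrier) simp
  have ec: "unit_vec n i \<in> carrier_vec n" for i :: nat by simp
  note dv = orthonormal_decompose[OF U ec, folded v]
  have \<rho>: "l2_norm (Q\<^sup>T *\<^sub>v v i) \<le> \<rho>" if i: "i < n" for i
  proof -
    have "l2_norm (Q\<^sup>T *\<^sub>v v i) \<le> (l2_norm (Uh\<^sup>T *\<^sub>v (G *\<^sub>v (G\<^sup>T *\<^sub>v (H ^\<^sub>m g *\<^sub>v v i)))) / b
        + \<tau>\<^sup>2 * l2_norm (G\<^sup>T *\<^sub>v (H ^\<^sub>m g *\<^sub>v v i))) / (s ^ g * b)"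
      by (rule comp2[OF dv(1,2)])
    also have "\<dots> \<le> \<rho>" unfolding \<rho>_def using rows(1,2)[OF i] b c0
      by (intro divide_right_mono add_mono mult_left_mono) auto
    finally show ?thesis .
  qed
  have Hv: "H *\<^sub>v v i \<in> carrier_vec n" "Uh\<^sup>T *\<^sub>v (H *\<^sub>v v i) = 0\<^sub>v k" for i
    using sp dv(1,2)[of i] H by (auto simp: spectral_split_def)
  have \<rho>': "l2_norm (Q\<^sup>T *\<^sub>v (H *\<^sub>v v i)) \<le> e * \<rho>" if i: "i < n" for i
  proof -
    have "l2_norm (Q\<^sup>T *\<^sub>v (H *\<^sub>v v i)) \<le> (l2_norm (Uh\<^sup>T *\<^sub>v (G *\<^sub>v (G\<^sup>T *\<^sub>v (H ^\<^sub>m g *\<^sub>v (H *\<^sub>v v i))))) / b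
        + \<tau>\<^sup>2 * l2_norm (G\<^sup>T *\<^sub>v (H ^\<^sub>m g *\<^sub>v (H *\<^sub>v v i)))) / (s ^ g * b)"
      by (rule comp2[OF Hv])
    also have "\<dots> \<le> (e * \<beta> / b + \<tau>\<^sup>2 * (e * \<alpha>)) / (s ^ g * b)" using rows(3,4)[OF i] b c0
      by (intro divide_right_mono add_mono mult_left_mono) auto
    also have "\<dots> = e * \<rho>" by (simp add: \<rho>_def algebra_simps add_divide_distrib)
    finally show ?thesis .
  qed
  have row: "l2_norm (?q i - W\<^sup>T *\<^sub>v ?x i) \<le> R" if i: "i < n" for i
  proof -
    have Ux: "Uh *\<^sub>v ?x i \<in> carrier_vec n" using U(1) xc by (rule mult_mat_vec_carrier)
    have "?q i = Q\<^sup>T *\<^sub>v (Uh *\<^sub>v ?x i) + Q\<^sup>T *\<^sub>v v i"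
      using mult_add_distrib_mat_vec[OF Qt Ux dv(1)[of i]] dv(3)[of i] by simp
    hence "?q i = A\<^sup>T *\<^sub>v ?x i + Q\<^sup>T *\<^sub>v v i" unfolding Atv[OF xc] .
    moreover have "transpose_mat (A - W) *\<^sub>v ?x i = A\<^sup>T *\<^sub>v ?x i - W\<^sup>T *\<^sub>v ?x i"
      unfolding transpose_minus[OF A W(1)] by (rule minus_mult_distrib_mat_vec[OF At Wt xc])
    moreover have c: "A\<^sup>T *\<^sub>v ?x i \<in> carrier_vec k" "W\<^sup>T *\<^sub>v ?x i \<in> carrier_vec k"
      "Q\<^sup>T *\<^sub>v v i \<in> carrier_vec k"
      by (rule mult_mat_vec_carrier[OF At xc], rule mult_mat_vec_carrier[OF Wt xc], rule mult_mat_vec_carrier[OF Qt dv(1)])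
    have "(t + r) - w = (t - w) + r" if "t \<in> carrier_vec k" "w \<in> carrier_vec k" "r \<in> carrier_vec k" for t w r :: "real vec"
      using that by (intro eq_vecI) auto
    ultimately have "?q i - W\<^sup>T *\<^sub>v ?x i = transpose_mat (A - W) *\<^sub>v ?x i + Q\<^sup>T *\<^sub>v v i"
      using c by simp
    hence "l2_norm (?q i - W\<^sup>T *\<^sub>v ?x i) \<le> l2_norm (transpose_mat (A - W) *\<^sub>v ?x i) + l2_norm (Q\<^sup>T *\<^sub>v v i)"
      using l2_norm_triangle[of "transpose_mat (A - W) *\<^sub>v ?x i" k "Q\<^sup>T *\<^sub>v v i"] c(3)
        transpose_mult_mat_vec_carrier[OF AW] by simp
    also have "\<dots> \<le> 4 * \<tau>\<^sup>2 * \<mu> + \<rho>"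
    proof (rule add_mono[OF _ \<rho>[OF i]])
      have "l2_norm (transpose_mat (A - W) *\<^sub>v ?x i) \<le> 4 * \<tau>\<^sup>2 * l2_norm (?x i)"
        by (rule norm_boundD[OF AWt _ xc]) (use AW in auto)
      also have "\<dots> \<le> 4 * \<tau>\<^sup>2 * \<mu>" using \<mu>[OF i] by (intro mult_left_mono) auto
      finally show "l2_norm (transpose_mat (A - W) *\<^sub>v ?x i) \<le> 4 * \<tau>\<^sup>2 * \<mu>" .
    qed
    finally show ?thesis by (simp add: R_def)
  qed
  show "d_2inf Q U \<le> d_2inf Uh U + R" if "U \<in> carrier_mat n k"
    by (rule d_2inf_rotate_le[OF Q(1) that U(1) n W(1,2) row])
  have \<mu>0: "0 \<le> \<mu>" using \<mu>[OF n] l2_norm_nonneg order.trans by blast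
  have R0: "0 \<le> R" using row[OF n] l2_norm_nonneg order.trans by blast
  have \<rho>0: "0 \<le> e * \<rho>" using \<rho>'[OF n] l2_norm_nonneg order.trans by blast
  show "norm_max (Q * Q\<^sup>T * H - M)
      \<le> norm_max (Uh * Uh\<^sup>T * H - M) + ((R + 4 * \<tau>\<^sup>2 * \<mu>) * (\<eta> * \<mu>) + (\<mu> + R) * (e * \<rho>))"
    if M: "M \<in> carrier_mat n n"
  proof (rule norm_max_diff_le[OF _ _ M n])
    show "Q * Q\<^sup>T * H \<in> carrier_mat n n" using Q H by auto
    show "Uh * Uh\<^sup>T * H \<in> carrier_mat n n" using U H by auto
    fix i j assume ij: "i < n" "j < n"
    obtain z where z: "z \<in> carrier_vec k" "H *\<^sub>v (Uh *\<^sub>v ?x j) = Uh *\<^sub>v z"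
      using spectral_split_range[OF sp xc] by blast
    have Ux: "Uh *\<^sub>v ?x j \<in> carrier_vec n" using U(1) xc by (rule mult_mat_vec_carrier)
    have Uz: "Uh *\<^sub>v z \<in> carrier_vec n" using U(1) z(1) by (rule mult_mat_vec_carrier)
    have zn: "l2_norm z \<le> \<eta> * \<mu>"
    proof -
      have "l2_norm z = l2_norm (H *\<^sub>v (Uh *\<^sub>v ?x j))" unfolding z(2) orthonormal_cols_l2_norm[OF U(2,1) z(1)] ..
      also have "\<dots> \<le> \<eta> * l2_norm (Uh *\<^sub>v ?x j)" by (rule norm_boundD[OF \<eta>(1) H(1) Ux])
      also have "\<dots> \<le> \<eta> * \<mu>"
        unfolding orthonormal_cols_l2_norm[OF U(2,1) xc] using \<eta>(2) \<mu>[OF ij(2)] by (intro mult_left_mono)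
      finally show ?thesis .
    qed
    have "H *\<^sub>v unit_vec n j = H *\<^sub>v (Uh *\<^sub>v ?x j + v j)" using dv(3)[of j] by simp
    also have "\<dots> = Uh *\<^sub>v z + H *\<^sub>v v j"
      unfolding mult_add_distrib_mat_vec[OF H(1) Ux dv(1)] z(2) ..
    finally have He: "H *\<^sub>v unit_vec n j = Uh *\<^sub>v z + H *\<^sub>v v j" .
    have "Q\<^sup>T *\<^sub>v (H *\<^sub>v unit_vec n j) = A\<^sup>T *\<^sub>v z + Q\<^sup>T *\<^sub>v (H *\<^sub>v v j)"
      unfolding He mult_add_distrib_mat_vec[OF Qt Uz Hv(1)] Atv[OF z(1)] ..
    moreover have c: "A\<^sup>T *\<^sub>v z \<in> carrier_vec k" "Q\<^sup>T *\<^sub>v (H *\<^sub>v v j) \<in> carrier_vec k"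
      by (rule mult_mat_vec_carrier[OF At z(1)], rule mult_mat_vec_carrier[OF Qt Hv(1)])
    moreover have "?q i \<bullet> (A\<^sup>T *\<^sub>v z) = (A *\<^sub>v ?q i) \<bullet> z"
      using scalar_prod_mult_mat_vec[OF At qc z(1)] by simp
    ultimately have e1: "(Q * Q\<^sup>T * H) $$ (i, j)
        = (A *\<^sub>v ?q i) \<bullet> z + ?q i \<bullet> (Q\<^sup>T *\<^sub>v (H *\<^sub>v v j))"
      unfolding projected_entry[OF Q(1) H(1) ij] using scalar_prod_add_distrib[OF qc c] by simp
    have "Uh\<^sup>T *\<^sub>v (H *\<^sub>v unit_vec n j) = z"
      unfolding He mult_add_distrib_mat_vec[OF Ut Uz Hv(1)] Hv(2) orthonormal_cols_transpose_mult_vec[OF U(2,1) z(1)]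
      using z(1) by simp
    hence e2: "(Uh * Uh\<^sup>T * H) $$ (i, j) = ?x i \<bullet> z"
      unfolding projected_entry[OF U(1) H(1) ij] by simp
    let ?r = "?q i - W\<^sup>T *\<^sub>v ?x i"
    have wx: "W\<^sup>T *\<^sub>v ?x i \<in> carrier_vec k" using Wt xc by (rule mult_mat_vec_carrier)
    have r: "?r \<in> carrier_vec k" using qc wx by simp
    have Aq: "A *\<^sub>v ?q i \<in> carrier_vec k" using A qc by (rule mult_mat_vec_carrier)
    have WWx: "W *\<^sub>v (W\<^sup>T *\<^sub>v ?x i) = ?x i"
      using assoc_mult_mat_vec[OF W(1) Wt xc] orthonormal_square_right_inverse[OF W(2,1)] xc by simp
    have "A *\<^sub>v ?q i = A *\<^sub>v ?r + A *\<^sub>v (W\<^sup>T *\<^sub>v ?x i)"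
      unfolding mult_minus_distrib_mat_vec[OF A qc wx]
      using Aq mult_mat_vec_carrier[OF A wx] by (intro eq_vecI) auto
    moreover have "(A - W) *\<^sub>v (W\<^sup>T *\<^sub>v ?x i) = A *\<^sub>v (W\<^sup>T *\<^sub>v ?x i) - ?x i"
      unfolding minus_mult_distrib_mat_vec[OF A W(1) wx] WWx ..
    moreover have "(t + y) - w = t + (y - w)" if "t \<in> carrier_vec k" "w \<in> carrier_vec k" "y \<in> carrier_vec k" for t w y :: "real vec"
      using that by (intro eq_vecI) auto
    ultimately have "A *\<^sub>v ?q i - ?x i = A *\<^sub>v ?r + (A - W) *\<^sub>v (W\<^sup>T *\<^sub>v ?x i)"
      using mult_mat_vec_carrier[OF A r] mult_mat_vec_carrier[OF A wx] xc by simp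
    hence "l2_norm (A *\<^sub>v ?q i - ?x i) \<le> l2_norm (A *\<^sub>v ?r) + l2_norm ((A - W) *\<^sub>v (W\<^sup>T *\<^sub>v ?x i))"
      using l2_norm_triangle[OF mult_mat_vec_carrier[OF A r] mult_mat_vec_carrier[OF AW wx]] by simp
    also have "\<dots> \<le> R + 4 * \<tau>\<^sup>2 * \<mu>"
    proof (rule add_mono)
      show "l2_norm (A *\<^sub>v ?r) \<le> R" using norm_boundD[OF nA A r] row[OF ij(1)] by linarith
      have "l2_norm (W\<^sup>T *\<^sub>v ?x i) \<le> \<mu>"
        using norm_boundD[OF orthonormal_cols_norm_bound(2)[OF W(2)] Wt xc] \<mu>[OF ij(1)] by (smt (verit))
      hence "4 * \<tau>\<^sup>2 * l2_norm (W\<^sup>T *\<^sub>v ?x i) \<le> 4 * \<tau>\<^sup>2 * \<mu>" by (intro mult_left_mono) auto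
      thus "l2_norm ((A - W) *\<^sub>v (W\<^sup>T *\<^sub>v ?x i)) \<le> 4 * \<tau>\<^sup>2 * \<mu>"
        using norm_boundD[OF W(3) AW wx] by linarith
    qed
    finally have d1: "l2_norm (A *\<^sub>v ?q i - ?x i) \<le> R + 4 * \<tau>\<^sup>2 * \<mu>" .
    have "\<bar>(A *\<^sub>v ?q i - ?x i) \<bullet> z\<bar> \<le> l2_norm (A *\<^sub>v ?q i - ?x i) * l2_norm z"
      using Aq xc z(1) by (intro scalar_prod_le_l2_norm[of _ k]) auto
    also have "\<dots> \<le> (R + 4 * \<tau>\<^sup>2 * \<mu>) * (\<eta> * \<mu>)"
      using d1 zn R0 \<mu>0 by (intro mult_mono) auto
    finally have t1: "\<bar>(A *\<^sub>v ?q i - ?x i) \<bullet> z\<bar> \<le> (R + 4 * \<tau>\<^sup>2 * \<mu>) * (\<eta> * \<mu>)" .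
    have "?q i = W\<^sup>T *\<^sub>v ?x i + ?r" using qc wx Q(1) W(1) by (intro eq_vecI) auto
    hence "l2_norm (?q i) \<le> l2_norm (W\<^sup>T *\<^sub>v ?x i) + l2_norm ?r"
      using l2_norm_triangle[OF wx r] by simp
    also have "\<dots> \<le> \<mu> + R"
      using norm_boundD[OF orthonormal_cols_norm_bound(2)[OF W(2)] Wt xc, of i] \<mu>[OF ij(1)] row[OF ij(1)] by linarith
    finally have qn: "l2_norm (?q i) \<le> \<mu> + R" .
    have "\<bar>?q i \<bullet> (Q\<^sup>T *\<^sub>v (H *\<^sub>v v j))\<bar> \<le> l2_norm (?q i) * l2_norm (Q\<^sup>T *\<^sub>v (H *\<^sub>v v j))"
      by (rule scalar_prod_le_l2_norm[OF qc c(2)])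
    also have "\<dots> \<le> (\<mu> + R) * (e * \<rho>)"
      using qn \<rho>'[OF ij(2)] R0 \<mu>0 by (intro mult_mono) auto
    finally have t2: "\<bar>?q i \<bullet> (Q\<^sup>T *\<^sub>v (H *\<^sub>v v j))\<bar> \<le> (\<mu> + R) * (e * \<rho>)" .
    show "\<bar>(Q * Q\<^sup>T * H) $$ (i, j) - (Uh * Uh\<^sup>T * H) $$ (i, j)\<bar>
        \<le> (R + 4 * \<tau>\<^sup>2 * \<mu>) * (\<eta> * \<mu>) + (\<mu> + R) * (e * \<rho>)"
      using t1 t2 minus_scalar_prod_distrib[OF Aq xc[of i] z(1)] unfolding e1 e2 by linarith
  qed
qed

section \<open>Gaussian matrices\<close>

lemma prob_space_std_normal: "prob_space std_normal_distribution"
  by (rule prob_space_normal_density) simp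

lemma prob_space_gaussian_entries: "prob_space (gaussian_entries n k)"
  unfolding gaussian_entries_def by (intro prob_space_PiM prob_space_std_normal)

lemma gaussian_entries_measurable [measurable]:
  "i < n \<Longrightarrow> j < k \<Longrightarrow> (\<lambda>\<omega>. \<omega> (i, j)) \<in> borel_measurable (gaussian_entries n k)"
proof -
  assume "i < n" "j < k"
  hence "(\<lambda>\<omega>. \<omega> (i, j)) \<in> measurable (gaussian_entries n k) std_normal_distribution"
    unfolding gaussian_entries_def by (intro measurable_component_singleton) auto
  thus ?thesis by (simp add: measurable_def)
qed

lemma gaussian_entries_distributed:
  assumes "i < n" "j < k"
  shows "distributed (gaussian_entries n k) lborel (\<lambda>\<omega>. \<omega> (i, j)) std_normal_density"
proof -
  have "distr (gaussian_entries n k) std_normal_distribution (\<lambda>\<omega>. \<omega> (i, j)) = std_normal_distribution"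
    unfolding gaussian_entries_def using assms
    by (intro distr_PiM_component prob_space_std_normal) auto
  moreover have "distr (gaussian_entries n k) lborel (\<lambda>\<omega>. \<omega> (i, j))
      = distr (gaussian_entries n k) std_normal_distribution (\<lambda>\<omega>. \<omega> (i, j))"
    by (intro distr_cong) auto
  ultimately have "distr (gaussian_entries n k) lborel (\<lambda>\<omega>. \<omega> (i, j)) = std_normal_distribution"
    by simp
  thus ?thesis unfolding distributed_def using assms by simp
qed

lemma gaussian_entries_indep:
  assumes "0 < n" "0 < k"
  shows "prob_space.indep_vars (gaussian_entries n k) (\<lambda>_. borel) (\<lambda>i \<omega>. \<omega> i) ({..<n} \<times> {..<k})"
proof -
  interpret prob_space "gaussian_entries n k" by (rule prob_space_gaussian_entries)
  let ?I = "{..<n} \<times> {..<k}"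
  have ne: "?I \<noteq> {}" using assms by auto
  have rv: "random_variable borel (\<lambda>\<omega>. \<omega> i)" if "i \<in> ?I" for i
    using that by (cases i) auto
  have d: "distr (gaussian_entries n k) borel (\<lambda>\<omega>. \<omega> i) = std_normal_distribution" if "i \<in> ?I" for i
  proof -
    have "distr (gaussian_entries n k) borel (\<lambda>\<omega>. \<omega> i) = distr (gaussian_entries n k) lborel (\<lambda>\<omega>. \<omega> i)"
      by (intro distr_cong) auto
    also have "\<dots> = std_normal_distribution"
      using gaussian_entries_distributed[of "fst i" n "snd i" k] that by (auto simp: distributed_def)
    finally show ?thesis .
  qed
  have "distr (gaussian_entries n k) (\<Pi>\<^sub>M i\<in>?I. borel) (\<lambda>x. \<lambda>i\<in>?I. x i)
      = distr (gaussian_entries n k) (gaussian_entries n k) (\<lambda>x. x)"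
  proof (intro distr_cong refl)
    show "sets (\<Pi>\<^sub>M i\<in>?I. borel) = sets (gaussian_entries n k)"
      unfolding gaussian_entries_def by (intro sets_PiM_cong) auto
    fix x assume "x \<in> space (gaussian_entries n k)"
    thus "(\<lambda>i\<in>?I. x i) = x"
      unfolding gaussian_entries_def space_PiM by (simp add: PiE_def extensional_restrict)
  qed
  also have "\<dots> = gaussian_entries n k" by (rule distr_id)
  also have "\<dots> = (\<Pi>\<^sub>M i\<in>?I. std_normal_distribution)" by (rule gaussian_entries_def)
  also have "\<dots> = (\<Pi>\<^sub>M i\<in>?I. distr (gaussian_entries n k) borel (\<lambda>\<omega>. \<omega> i))"
    using d by (intro PiM_cong) auto
  finally show ?thesis using indep_vars_iff_distr_eq_PiM'[OF ne rv] by simp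
qed

lemma normal_square_exp_moment:
  assumes "0 < \<sigma>" "2 * l * \<sigma>\<^sup>2 < 1"
  shows "(\<integral>\<^sup>+x. ennreal (normal_density 0 \<sigma> x) * ennreal (exp (l * x\<^sup>2)) \<partial>lborel)
    = ennreal (1 / sqrt (1 - 2 * l * \<sigma>\<^sup>2))"
proof -
  define q where "q = 1 - 2 * l * \<sigma>\<^sup>2"
  have q: "0 < q" using assms by (simp add: q_def)
  define \<rho> where "\<rho> = \<sigma> / sqrt q"
  have \<rho>: "0 < \<rho>" "\<rho>\<^sup>2 = \<sigma>\<^sup>2 / q" using assms q by (auto simp: \<rho>_def power_divide)
  have eq: "normal_density 0 \<sigma> x * exp (l * x\<^sup>2) = (1 / sqrt q) * normal_density 0 \<rho> x" for x
  proof -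
    have "- (x\<^sup>2 / (2 * \<sigma>\<^sup>2)) + l * x\<^sup>2 = - (x\<^sup>2 / (2 * \<rho>\<^sup>2))"
      unfolding \<rho>(2) using assms q by (simp add: q_def field_simps)
    moreover have "sqrt (2 * pi * \<rho>\<^sup>2) = sqrt (2 * pi * \<sigma>\<^sup>2) / sqrt q"
      unfolding \<rho>(2) by (simp add: real_sqrt_divide)
    ultimately show ?thesis using q
      by (simp add: normal_density_def exp_add[symmetric] mult.assoc)
  qed
  have "(\<integral>\<^sup>+x. ennreal (normal_density 0 \<sigma> x) * ennreal (exp (l * x\<^sup>2)) \<partial>lborel)
      = (\<integral>\<^sup>+x. ennreal ((1 / sqrt q) * normal_density 0 \<rho> x) \<partial>lborel)"
    by (intro nn_integral_cong) (simp add: eq ennreal_mult'[symmetric])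
  also have "\<dots> = ennreal (\<integral>x. (1 / sqrt q) * normal_density 0 \<rho> x \<partial>lborel)"
    using \<rho> q by (intro nn_integral_eq_integral) auto
  also have "\<dots> = ennreal (1 / sqrt q)" using \<rho> by simp
  finally show ?thesis by (simp add: q_def)
qed

lemma gaussian_column_distributed:
  assumes z: "z \<in> carrier_vec n" "z \<noteq> 0\<^sub>v n" and j: "j < k"
  shows "distributed (gaussian_entries n k) lborel (\<lambda>\<omega>. \<Sum>i<n. z $ i * \<omega> (i, j)) (normal_density 0 (l2_norm z))"
proof -
  interpret prob_space "gaussian_entries n k" by (rule prob_space_gaussian_entries)
  define S where "S = {i. i < n \<and> z $ i \<noteq> 0}"
  have fS: "finite S" by (simp add: S_def)
  have Sne: "S \<noteq> {}"
  proof
    assume "S = {}"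
    hence "z = 0\<^sub>v n" using z(1) by (intro eq_vecI) (auto simp: S_def)
    thus False using z by simp
  qed
  hence n: "0 < n" by (auto simp: S_def)
  let ?J = "S \<times> {j}"
  have J: "?J \<subseteq> {..<n} \<times> {..<k}" using j by (auto simp: S_def)
  have indep: "indep_vars (\<lambda>_. borel) (\<lambda>p \<omega>. z $ fst p * \<omega> p) ?J"
    using indep_vars_compose2[OF indep_vars_subset[OF gaussian_entries_indep[OF n] J],
        of "\<lambda>p x. z $ fst p * x" "\<lambda>_. borel"] j by auto
  have "distributed (gaussian_entries n k) lborel (\<lambda>\<omega>. \<Sum>p\<in>?J. z $ fst p * \<omega> p)
      (normal_density (\<Sum>p\<in>?J. 0) (sqrt (\<Sum>p\<in>?J. \<bar>z $ fst p\<bar>\<^sup>2)))"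
  proof (rule sum_indep_normal[OF _ _ indep])
    fix p assume p: "p \<in> ?J"
    show "0 < \<bar>z $ fst p\<bar>" using p by (auto simp: S_def)
    have "distributed (gaussian_entries n k) lborel (\<lambda>\<omega>. \<omega> (fst p, snd p)) std_normal_density"
      using p j by (intro gaussian_entries_distributed) (auto simp: S_def)
    from normal_density_affine[OF this, of "z $ fst p" 0]
    show "distributed (gaussian_entries n k) lborel (\<lambda>\<omega>. z $ fst p * \<omega> p) (normal_density 0 \<bar>z $ fst p\<bar>)"
      using p by (auto simp: S_def)
  qed (use fS Sne in auto)
  moreover have "(\<Sum>p\<in>?J. z $ fst p * \<omega> p) = (\<Sum>i<n. z $ i * \<omega> (i, j))" for \<omega>
  proof -
    have "(\<Sum>p\<in>?J. z $ fst p * \<omega> p) = (\<Sum>i\<in>S. z $ i * \<omega> (i, j))"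
      by (intro sum.reindex_bij_witness[of _ "\<lambda>i. (i, j)" fst]) auto
    also have "\<dots> = (\<Sum>i<n. z $ i * \<omega> (i, j))"
      by (intro sum.mono_neutral_left) (auto simp: S_def)
    finally show ?thesis .
  qed
  moreover have "sqrt (\<Sum>p\<in>?J. \<bar>z $ fst p\<bar>\<^sup>2) = l2_norm z"
  proof -
    have "(\<Sum>p\<in>?J. \<bar>z $ fst p\<bar>\<^sup>2) = (\<Sum>i\<in>S. (z $ i)\<^sup>2)"
      by (intro sum.reindex_bij_witness[of _ "\<lambda>i. (i, j)" fst]) auto
    also have "\<dots> = (\<Sum>i<n. (z $ i)\<^sup>2)"
      by (intro sum.mono_neutral_left) (auto simp: S_def)
    finally show ?thesis using z(1) by (simp add: l2_norm_L2_set L2_set_def)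
  qed
  ultimately show ?thesis by simp
qed

lemma l2_norm_transpose_mat_entries:
  assumes "z \<in> carrier_vec n"
  shows "(l2_norm (transpose_mat (Matrix.mat n k \<omega>) *\<^sub>v z))\<^sup>2 = (\<Sum>j<k. (\<Sum>i<n. z $ i * \<omega> (i, j))\<^sup>2)"
proof -
  have "(l2_norm (transpose_mat (Matrix.mat n k \<omega>) *\<^sub>v z))\<^sup>2
      = (\<Sum>j<k. ((transpose_mat (Matrix.mat n k \<omega>) *\<^sub>v z) $ j)\<^sup>2)"
    unfolding l2_norm_L2_set L2_set_def by (simp add: sum_nonneg)
  also have "\<dots> = (\<Sum>j<k. (\<Sum>i<n. z $ i * \<omega> (i, j))\<^sup>2)"
    using assms by (intro sum.cong refl) (auto simp: scalar_prod_def atLeast0LessThan mult.commute)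
  finally show ?thesis .
qed

lemma l2_norm_transpose_measurable [measurable]:
  assumes "z \<in> carrier_vec n"
  shows "(\<lambda>\<omega>. (l2_norm (transpose_mat (Matrix.mat n k \<omega>) *\<^sub>v z))\<^sup>2) \<in> borel_measurable (gaussian_entries n k)"
  unfolding l2_norm_transpose_mat_entries[OF assms] by measurable

lemma gaussian_exp_moment:
  assumes z: "z \<in> carrier_vec n" "z \<noteq> 0\<^sub>v n" and l: "2 * l * (l2_norm z)\<^sup>2 < 1"
  shows "(\<integral>\<^sup>+\<omega>. ennreal (exp (l * (l2_norm (transpose_mat (Matrix.mat n k \<omega>) *\<^sub>v z))\<^sup>2)) \<partial>gaussian_entries n k)
    = ennreal ((1 / sqrt (1 - 2 * l * (l2_norm z)\<^sup>2)) ^ k)"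
proof (cases "k = 0")
  case True
  interpret prob_space "gaussian_entries n k" by (rule prob_space_gaussian_entries)
  show ?thesis using True emeasure_space_1 by (simp add: l2_norm_transpose_mat_entries[OF z(1)])
next
  case False
  interpret prob_space "gaussian_entries n k" by (rule prob_space_gaussian_entries)
  have n: "0 < n" using z by (cases n) auto
  have pos: "0 < l2_norm z" using l2_norm_eq_0[OF z(1)] z(2) l2_norm_nonneg[of z] by linarith
  let ?K = "\<lambda>j. {..<n} \<times> {j}"
  have "indep_vars (\<lambda>j. PiM (?K j) (\<lambda>_. borel)) (\<lambda>j \<omega>. restrict (\<lambda>i. \<omega> i) (?K j)) {..<k}"
    using False n by (intro indep_vars_restrict[OF gaussian_entries_indep]) (auto simp: disjoint_family_on_def)
  hence "indep_vars (\<lambda>_. borel) (\<lambda>j \<omega>. ennreal (exp (l * (\<Sum>i<n. z $ i * restrict (\<lambda>i. \<omega> i) (?K j) (i, j))\<^sup>2))) {..<k}"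
  proof (rule indep_vars_compose2)
    fix j
    have "(\<lambda>f. f (i, j)) \<in> borel_measurable (PiM (?K j) (\<lambda>_. borel))" if "i < n" for i
      using that by (intro measurable_component_singleton) auto
    thus "(\<lambda>f. ennreal (exp (l * (\<Sum>i<n. z $ i * f (i, j))\<^sup>2))) \<in> borel_measurable (PiM (?K j) (\<lambda>_. borel))"
      by measurable
  qed
  hence indep: "indep_vars (\<lambda>_. borel) (\<lambda>j \<omega>. ennreal (exp (l * (\<Sum>i<n. z $ i * \<omega> (i, j))\<^sup>2))) {..<k}"
    by simp
  have "(\<integral>\<^sup>+\<omega>. ennreal (exp (l * (l2_norm (transpose_mat (Matrix.mat n k \<omega>) *\<^sub>v z))\<^sup>2)) \<partial>gaussian_entries n k)
      = (\<integral>\<^sup>+\<omega>. (\<Prod>j<k. ennreal (exp (l * (\<Sum>i<n. z $ i * \<omega> (i, j))\<^sup>2))) \<partial>gaussian_entries n k)"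
    by (intro nn_integral_cong)
       (simp add: l2_norm_transpose_mat_entries[OF z(1)] prod_ennreal exp_sum sum_distrib_left)
  also have "\<dots> = (\<Prod>j<k. \<integral>\<^sup>+\<omega>. ennreal (exp (l * (\<Sum>i<n. z $ i * \<omega> (i, j))\<^sup>2)) \<partial>gaussian_entries n k)"
    using indep by (intro indep_vars_nn_integral) auto
  also have "\<dots> = (\<Prod>j<k. ennreal (1 / sqrt (1 - 2 * l * (l2_norm z)\<^sup>2)))"
  proof (intro prod.cong refl)
    fix j assume "j \<in> {..<k}"
    hence "distributed (gaussian_entries n k) lborel (\<lambda>\<omega>. \<Sum>i<n. z $ i * \<omega> (i, j)) (normal_density 0 (l2_norm z))"
      using z by (intro gaussian_column_distributed) auto
    from distributed_nn_integral[OF this, of "\<lambda>x. ennreal (exp (l * x\<^sup>2))"]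
    show "(\<integral>\<^sup>+\<omega>. ennreal (exp (l * (\<Sum>i<n. z $ i * \<omega> (i, j))\<^sup>2)) \<partial>gaussian_entries n k)
        = ennreal (1 / sqrt (1 - 2 * l * (l2_norm z)\<^sup>2))"
      using normal_square_exp_moment[OF pos l] by simp
  qed
  also have "\<dots> = ennreal ((1 / sqrt (1 - 2 * l * (l2_norm z)\<^sup>2)) ^ k)"
    using l by (simp add: ennreal_power)
  finally show ?thesis .
qed

lemma gaussian_chernoff:
  assumes z: "z \<in> carrier_vec n" "z \<noteq> 0\<^sub>v n" and l: "2 * l * (l2_norm z)\<^sup>2 < 1"
  shows "measure (gaussian_entries n k)
      {\<omega> \<in> space (gaussian_entries n k). c \<le> l * (l2_norm (transpose_mat (Matrix.mat n k \<omega>) *\<^sub>v z))\<^sup>2}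
    \<le> exp (- c) * (1 / sqrt (1 - 2 * l * (l2_norm z)\<^sup>2)) ^ k"
proof -
  interpret prob_space "gaussian_entries n k" by (rule prob_space_gaussian_entries)
  let ?M = "gaussian_entries n k"
  let ?f = "\<lambda>\<omega>. l * (l2_norm (transpose_mat (Matrix.mat n k \<omega>) *\<^sub>v z))\<^sup>2"
  have [measurable]: "?f \<in> borel_measurable ?M" using l2_norm_transpose_measurable[OF z(1)] by simp
  have eq: "{\<omega> \<in> space ?M. c \<le> ?f \<omega>} = {\<omega> \<in> space ?M. 1 \<le> ennreal (exp (- c)) * ennreal (exp (?f \<omega>))}"
    by (intro Collect_cong conj_cong refl) (simp add: ennreal_mult'[symmetric] exp_add[symmetric])
  have "emeasure ?M {\<omega> \<in> space ?M. c \<le> ?f \<omega>}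
      \<le> ennreal (exp (- c)) * (\<integral>\<^sup>+\<omega>. ennreal (exp (?f \<omega>)) * indicator (space ?M) \<omega> \<partial>?M)"
    unfolding eq by (intro nn_integral_Markov_inequality) auto
  also have "(\<integral>\<^sup>+\<omega>. ennreal (exp (?f \<omega>)) * indicator (space ?M) \<omega> \<partial>?M) = (\<integral>\<^sup>+\<omega>. ennreal (exp (?f \<omega>)) \<partial>?M)"
    by (intro nn_integral_cong) auto
  also have "\<dots> = ennreal ((1 / sqrt (1 - 2 * l * (l2_norm z)\<^sup>2)) ^ k)"
    by (rule gaussian_exp_moment[OF z l])
  finally show ?thesis using l
    by (simp add: emeasure_eq_measure ennreal_mult'[symmetric])
qed

lemma gaussian_upper_tail:
  assumes z: "z \<in> carrier_vec n"
  shows "measure (gaussian_entries n k)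
      {\<omega> \<in> space (gaussian_entries n k). a * (l2_norm z)\<^sup>2 < (l2_norm (transpose_mat (Matrix.mat n k \<omega>) *\<^sub>v z))\<^sup>2}
    \<le> exp (- (a / 4)) * sqrt 2 ^ k" (is "measure ?M ?B \<le> _")
proof (cases "z = 0\<^sub>v n")
  case True
  hence "(l2_norm (transpose_mat (Matrix.mat n k \<omega>) *\<^sub>v z))\<^sup>2 = 0 \<and> real k * (l2_norm z)\<^sup>2 = 0" for \<omega>
    unfolding l2_norm_transpose_mat_entries[OF z] by auto
  hence B: "?B = {}" using True by auto
  show ?thesis unfolding B by simp
next
  case False
  interpret prob_space ?M by (rule prob_space_gaussian_entries)
  have pos: "0 < (l2_norm z)\<^sup>2" using l2_norm_eq_0[OF z] False by auto
  define l where "l = 1 / (4 * (l2_norm z)\<^sup>2)"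
  have l: "2 * l * (l2_norm z)\<^sup>2 = 1/2" using pos by (simp add: l_def)
  have [measurable]: "(\<lambda>\<omega>. (l2_norm (transpose_mat (Matrix.mat n k \<omega>) *\<^sub>v z))\<^sup>2) \<in> borel_measurable ?M"
    using z by measurable
  have "measure ?M ?B \<le> measure ?M {\<omega> \<in> space ?M. a / 4 \<le> l * (l2_norm (transpose_mat (Matrix.mat n k \<omega>) *\<^sub>v z))\<^sup>2}"
    using pos by (intro finite_measure_mono) (auto simp: l_def field_simps)
  also have "\<dots> \<le> exp (- (a / 4)) * (1 / sqrt (1 - 2 * l * (l2_norm z)\<^sup>2)) ^ k"
    using l by (intro gaussian_chernoff[OF z False]) auto
  also have "1 / sqrt (1 - 2 * l * (l2_norm z)\<^sup>2) = sqrt 2"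
    unfolding l by (simp add: real_sqrt_divide)
  finally show ?thesis .
qed

lemma gaussian_small_ball:
  assumes z: "z \<in> carrier_vec n" and \<epsilon>: "0 < \<epsilon>"
  shows "measure (gaussian_entries n k)
      {\<omega> \<in> space (gaussian_entries n k). (l2_norm (transpose_mat (Matrix.mat n k \<omega>) *\<^sub>v z))\<^sup>2 < \<epsilon>\<^sup>2 * real k * (l2_norm z)\<^sup>2}
    \<le> (2 * \<epsilon>) ^ k" (is "measure ?M ?B \<le> _")
proof (cases "z = 0\<^sub>v n")
  case True
  hence B: "?B = {}" by (auto simp: not_less)
  show ?thesis unfolding B using \<epsilon> by simp
next
  case False
  interpret prob_space ?M by (rule prob_space_gaussian_entries)
  have pos: "0 < (l2_norm z)\<^sup>2" using l2_norm_eq_0[OF z] False by auto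
  define l where "l = - (1 / (2 * \<epsilon>\<^sup>2 * (l2_norm z)\<^sup>2))"
  have l: "2 * l * (l2_norm z)\<^sup>2 = - (1 / \<epsilon>\<^sup>2)" using pos by (simp add: l_def field_simps)
  have [measurable]: "(\<lambda>\<omega>. (l2_norm (transpose_mat (Matrix.mat n k \<omega>) *\<^sub>v z))\<^sup>2) \<in> borel_measurable ?M"
    using z by measurable
  have "- (real k / 2) \<le> l * x" if "x < \<epsilon>\<^sup>2 * real k * (l2_norm z)\<^sup>2" for x
  proof -
    have "x / (2 * \<epsilon>\<^sup>2 * (l2_norm z)\<^sup>2) \<le> real k / 2"
      using that pos \<epsilon> by (simp add: field_simps)
    thus ?thesis by (simp add: l_def)
  qed
  hence "measure ?M ?B \<le> measure ?M {\<omega> \<in> space ?M. - (real k / 2) \<le> l * (l2_norm (transpose_mat (Matrix.mat n k \<omega>) *\<^sub>v z))\<^sup>2}"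
    by (intro finite_measure_mono) auto
  also have "\<dots> \<le> exp (- (- (real k / 2))) * (1 / sqrt (1 - 2 * l * (l2_norm z)\<^sup>2)) ^ k"
  proof (rule gaussian_chernoff[OF z False])
    have "0 < 1 / \<epsilon>\<^sup>2" using \<epsilon> by simp
    thus "2 * l * (l2_norm z)\<^sup>2 < 1" unfolding l by linarith
  qed
  also have "\<dots> = (exp (1/2) * (1 / sqrt (1 + 1 / \<epsilon>\<^sup>2))) ^ k"
    unfolding l by (simp add: power_mult_distrib exp_of_nat_mult[symmetric] power_divide)
  also have "\<dots> \<le> (2 * \<epsilon>) ^ k"
  proof (intro power_mono mult_mono)
    have "(1/\<epsilon>)\<^sup>2 \<le> 1 + 1 / \<epsilon>\<^sup>2" by (simp add: power_divide)
    hence "1/\<epsilon> \<le> sqrt (1 + 1 / \<epsilon>\<^sup>2)" by (rule real_le_rsqrt)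
    from le_imp_inverse_le[OF this] show "1 / sqrt (1 + 1 / \<epsilon>\<^sup>2) \<le> \<epsilon>"
      using \<epsilon> by (simp add: inverse_eq_divide)
    have "exp (1/2) ^ 2 = exp (1 :: real)" by (simp add: exp_of_nat_mult[symmetric])
    also have "\<dots> \<le> 2 ^ 2" using exp_le by simp
    finally show "exp (1/2) \<le> (2::real)" by (rule power2_le_imp_le) simp
  qed auto
  finally show ?thesis .
qed

lemma inverse_sqrt_le_exp:
  assumes "\<bar>x\<bar> \<le> 1/4"
  shows "1 / sqrt (1 - 2 * x) \<le> exp (x + 4 * x\<^sup>2)"
proof -
  have "\<bar>ln (1 + (- 2 * x)) - (- 2 * x)\<bar> \<le> 2 * (- 2 * x)\<^sup>2"
    using assms by (intro abs_ln_one_plus_x_minus_x_bound) auto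
  hence "- 2 * (x + 4 * x\<^sup>2) \<le> ln (1 - 2 * x)" by (simp add: power_mult_distrib abs_le_iff)
  hence "exp (- 2 * (x + 4 * x\<^sup>2)) \<le> 1 - 2 * x"
    using assms by (subst (asm) ln_ge_iff) auto
  hence "sqrt (exp (- (x + 4 * x\<^sup>2)) ^ 2) \<le> sqrt (1 - 2 * x)"
    by (intro real_sqrt_le_mono) (simp add: exp_of_nat_mult[symmetric] algebra_simps)
  hence "exp (- (x + 4 * x\<^sup>2)) \<le> sqrt (1 - 2 * x)" by simp
  hence "1 / sqrt (1 - 2 * x) \<le> 1 / exp (- (x + 4 * x\<^sup>2))"
    using assms by (intro divide_left_mono mult_pos_pos) auto
  moreover have "1 / exp (- y) = exp y" for y :: real by (metis exp_minus inverse_eq_divide minus_minus)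
  ultimately show ?thesis by (simp only:)
qed

lemma gaussian_concentration:
  assumes z: "z \<in> carrier_vec n" and L: "0 \<le> L" "4 * L \<le> real k"
  shows "measure (gaussian_entries n k)
      {\<omega> \<in> space (gaussian_entries n k). 14 * sqrt (real k * L) * (l2_norm z)\<^sup>2
        < \<bar>(l2_norm (transpose_mat (Matrix.mat n k \<omega>) *\<^sub>v z))\<^sup>2 - real k * (l2_norm z)\<^sup>2\<bar>}
    \<le> 2 * exp (- 6 * L)" (is "measure ?M ?B \<le> _")
proof (cases "z = 0\<^sub>v n \<or> k = 0")
  case True
  hence "(l2_norm (transpose_mat (Matrix.mat n k \<omega>) *\<^sub>v z))\<^sup>2 = 0" for \<omega>
    unfolding l2_norm_transpose_mat_entries[OF z] by auto
  hence B: "?B = {}" using L True by auto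
  show ?thesis unfolding B by simp
next
  case False
  hence z0: "z \<noteq> 0\<^sub>v n" and k: "0 < real k" by auto
  interpret prob_space ?M by (rule prob_space_gaussian_entries)
  let ?f = "\<lambda>\<omega>. (l2_norm (transpose_mat (Matrix.mat n k \<omega>) *\<^sub>v z))\<^sup>2"
  have pos: "0 < (l2_norm z)\<^sup>2" using l2_norm_eq_0[OF z] z0 by auto
  have [measurable]: "?f \<in> borel_measurable ?M" using z by measurable
  define \<mu> where "\<mu> = sqrt (L / real k) / 2"
  have \<mu>0: "0 \<le> \<mu>" using L by (simp add: \<mu>_def)
  have \<mu>2: "4 * \<mu>\<^sup>2 * real k = L" using L k by (simp add: \<mu>_def power_divide)
  have "sqrt (L / real k) \<le> sqrt (1/4)" using L k by (intro real_sqrt_le_mono) (simp add: field_simps)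
  moreover have "sqrt (1/4) = (1/2 :: real)" by (simp add: real_sqrt_divide)
  ultimately have \<mu>4: "\<mu> \<le> 1/4" unfolding \<mu>_def by linarith
  define t where "t = 14 * sqrt (real k * L)"
  have t: "\<mu> * t = 7 * L"
  proof -
    have "sqrt (real k * L) * sqrt (L / real k) = sqrt (L * L)"
      using k by (simp add: real_sqrt_mult[symmetric])
    thus ?thesis using L by (simp add: \<mu>_def t_def)
  qed
  have side: "measure ?M {\<omega> \<in> space ?M. x * real k + 7 * L \<le> (x / (l2_norm z)\<^sup>2) * ?f \<omega>} \<le> exp (- 6 * L)"
    if x: "x = \<mu> \<or> x = - \<mu>" for x
  proof -
    have x': "2 * (x / (l2_norm z)\<^sup>2) * (l2_norm z)\<^sup>2 = 2 * x" using pos by simp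
    have xa: "\<bar>x\<bar> \<le> 1/4" using x \<mu>0 \<mu>4 by auto
    have x2: "4 * x\<^sup>2 * real k = L" using x \<mu>2 by auto
    have "measure ?M {\<omega> \<in> space ?M. x * real k + 7 * L \<le> (x / (l2_norm z)\<^sup>2) * ?f \<omega>}
        \<le> exp (- (x * real k + 7 * L)) * (1 / sqrt (1 - 2 * (x / (l2_norm z)\<^sup>2) * (l2_norm z)\<^sup>2)) ^ k"
      unfolding x' using xa by (intro gaussian_chernoff[OF z z0, of "x / (l2_norm z)\<^sup>2", unfolded x']) auto
    also have "\<dots> \<le> exp (- (x * real k + 7 * L)) * exp (x + 4 * x\<^sup>2) ^ k"
      unfolding x' using inverse_sqrt_le_exp[OF xa] xa by (intro mult_left_mono power_mono) auto
    also have "\<dots> = exp (- 6 * L)"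
      using x2 by (simp add: exp_of_nat_mult[symmetric] exp_add[symmetric] algebra_simps)
    finally show ?thesis .
  qed
  let ?S = "\<lambda>x. {\<omega> \<in> space ?M. x * real k + 7 * L \<le> (x / (l2_norm z)\<^sup>2) * ?f \<omega>}"
  have "?B \<subseteq> ?S \<mu> \<union> ?S (- \<mu>)"
  proof
    fix \<omega> assume w: "\<omega> \<in> ?B"
    define q where "q = ?f \<omega> / (l2_norm z)\<^sup>2"
    have fq: "?f \<omega> = q * (l2_norm z)\<^sup>2" using pos by (simp add: q_def)
    have "t * (l2_norm z)\<^sup>2 < \<bar>(q - real k) * (l2_norm z)\<^sup>2\<bar>"
      using w fq by (simp add: t_def algebra_simps)
    hence "t < \<bar>q - real k\<bar>" using pos by (simp add: abs_mult)
    hence "t < q - real k \<or> t < real k - q" by auto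
    thus "\<omega> \<in> ?S \<mu> \<union> ?S (- \<mu>)"
    proof
      assume "t < q - real k"
      hence "\<mu> * t \<le> \<mu> * (q - real k)" using \<mu>0 by (intro mult_left_mono) auto
      hence "\<mu> * real k + 7 * L \<le> \<mu> / (l2_norm z)\<^sup>2 * ?f \<omega>" using t pos fq by (simp add: algebra_simps)
      thus ?thesis using w by auto
    next
      assume "t < real k - q"
      hence "\<mu> * t \<le> \<mu> * (real k - q)" using \<mu>0 by (intro mult_left_mono) auto
      hence "- \<mu> * real k + 7 * L \<le> - \<mu> / (l2_norm z)\<^sup>2 * ?f \<omega>" using t pos fq by (simp add: algebra_simps)
      thus ?thesis using w by auto
    qed
  qed
  hence "measure ?M ?B \<le> measure ?M (?S \<mu> \<union> ?S (- \<mu>))" by (intro finite_measure_mono) auto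
  also have "\<dots> \<le> measure ?M (?S \<mu>) + measure ?M (?S (- \<mu>))" by (intro measure_Un_le) auto
  also have "\<dots> \<le> 2 * exp (- 6 * L)" using side[of \<mu>] side[of "- \<mu>"] by simp
  finally show ?thesis .
qed

lemma sum_exp_neg_abs_le:
  fixes \<theta> :: real and R :: nat
  assumes "0 < \<theta>" "\<theta> \<le> 1"
  shows "(\<Sum>m\<in>{- int R..int R}. exp (- (\<theta> * \<bar>real_of_int m\<bar>))) \<le> 4 / \<theta>"
proof -
  define q where "q = exp (- \<theta>)"
  have q: "0 < q" "q < 1" using assms by (auto simp: q_def)
  have "1 - \<theta> / 2 \<ge> q"
  proof -
    have "exp (- \<theta>) \<le> 1 / (1 + \<theta>)"
      using exp_ge_add_one_self[of \<theta>] assms by (simp add: exp_minus field_simps)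
    also have "\<dots> \<le> 1 - \<theta> / 2" using assms by (simp add: field_simps)
    finally show ?thesis by (simp add: q_def)
  qed
  hence q2: "1 / (1 - q) \<le> 2 / \<theta>" using q assms by (simp add: field_simps)
  have geo: "(\<Sum>m\<le>R. q ^ m) \<le> 1 / (1 - q)"
  proof -
    have "(\<Sum>m\<le>R. q ^ m) \<le> (\<Sum>m. q ^ m)"
      using q by (intro sum_le_suminf summable_geometric) auto
    also have "\<dots> = 1 / (1 - q)" using q by (intro suminf_geometric) auto
    finally show ?thesis .
  qed
  have pw: "exp (- (\<theta> * \<bar>real_of_int m\<bar>)) = q ^ nat \<bar>m\<bar>" for m
    by (simp add: q_def exp_of_nat_mult[symmetric] mult.commute)
  have "(\<Sum>m\<in>{- int R..int R}. exp (- (\<theta> * \<bar>real_of_int m\<bar>)))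
      \<le> (\<Sum>m\<in>int ` {..R} \<union> (\<lambda>i. - int i) ` {..R}. q ^ nat \<bar>m\<bar>)"
    unfolding pw
  proof (intro sum_mono2)
    show "{- int R..int R} \<subseteq> int ` {..R} \<union> (\<lambda>i. - int i) ` {..R}"
    proof
      fix m assume m: "m \<in> {- int R..int R}"
      show "m \<in> int ` {..R} \<union> (\<lambda>i. - int i) ` {..R}"
      proof (cases "0 \<le> m")
        case True
        hence "m = int (nat m)" "nat m \<le> R" using m by auto
        thus ?thesis by blast
      next
        case False
        hence "m = - int (nat (- m))" "nat (- m) \<le> R" using m by auto
        thus ?thesis by blast
      qed
    qed
  qed (use q in auto)
  also have "\<dots> \<le> (\<Sum>m\<in>int ` {..R}. q ^ nat \<bar>m\<bar>) + (\<Sum>m\<in>(\<lambda>i. - int i) ` {..R}. q ^ nat \<bar>m\<bar>)"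
    using sum.union_inter[of "int ` {..R}" "(\<lambda>i. - int i) ` {..R}" "\<lambda>m. q ^ nat \<bar>m\<bar>"]
      sum_nonneg[of "int ` {..R} \<inter> (\<lambda>i. - int i) ` {..R}" "\<lambda>m. q ^ nat \<bar>m\<bar>"] q by auto
  also have "\<dots> = (\<Sum>m\<le>R. q ^ m) + (\<Sum>m\<le>R. q ^ m)"
    by (subst sum.reindex, simp add: inj_on_def)+ simp
  also have "\<dots> \<le> 4 / \<theta>" using geo q2 by simp
  finally show ?thesis .
qed

text \<open>The net is the grid of mesh \<open>\<theta> / sqrt d\<close>, rounded towards zero. Its cardinality is bounded
  by the exponential weight \<open>exp (d - \<theta> \<parallel>m\<parallel>\<^sub>1) \<ge> 1\<close>, which factorizes.\<close>

lemma euclidean_net: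
  assumes \<theta>: "0 < \<theta>" "\<theta> \<le> 1"
  obtains N where "finite N" "N \<subseteq> carrier_vec d" "real (card N) \<le> (12 / \<theta>) ^ d"
    "\<And>x. x \<in> carrier_vec d \<Longrightarrow> l2_norm x \<le> 1 \<Longrightarrow> \<exists>z\<in>N. l2_norm (x - z) \<le> \<theta>"
proof (cases "d = 0")
  case True
  have "l2_norm (x - 0\<^sub>v 0) \<le> \<theta>" if "x \<in> carrier_vec 0" for x
    using that \<theta> by (auto simp: l2_norm_L2_set)
  thus thesis using True \<theta> by (intro that[of "{0\<^sub>v 0}"]) auto
next
  case False
  define \<delta> where "\<delta> = \<theta> / sqrt d"
  have \<delta>: "0 < \<delta>" using \<theta> False by (simp add: \<delta>_def)
  define R where "R = nat \<lfloor>real d / \<theta>\<rfloor>"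
  define F where "F = {f \<in> {..<d} \<rightarrow>\<^sub>E {- int R..int R}. \<theta> * (\<Sum>i<d. \<bar>real_of_int (f i)\<bar>) \<le> real d}"
  have fP: "finite ({..<d} \<rightarrow>\<^sub>E {- int R..int R})" by (intro finite_PiE) auto
  have fF: "finite F" by (rule finite_subset[OF _ fP]) (auto simp: F_def)
  define N where "N = (\<lambda>f. Matrix.vec d (\<lambda>i. \<delta> * real_of_int (f i))) ` F"
  have "real (card N) \<le> real (card F)" unfolding N_def using card_image_le[OF fF] by simp
  also have "\<dots> = (\<Sum>f\<in>F. 1)" by simp
  also have "\<dots> \<le> (\<Sum>f\<in>F. exp (real d - \<theta> * (\<Sum>i<d. \<bar>real_of_int (f i)\<bar>)))"
    by (intro sum_mono) (auto simp: F_def)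
  also have "\<dots> \<le> (\<Sum>f\<in>{..<d} \<rightarrow>\<^sub>E {- int R..int R}. exp (real d - \<theta> * (\<Sum>i<d. \<bar>real_of_int (f i)\<bar>)))"
    by (intro sum_mono2 fP) (auto simp: F_def)
  also have "\<dots> = (\<Sum>f\<in>{..<d} \<rightarrow>\<^sub>E {- int R..int R}. exp (real d) * (\<Prod>i<d. exp (- (\<theta> * \<bar>real_of_int (f i)\<bar>))))"
  proof (intro sum.cong refl)
    fix f :: "nat \<Rightarrow> int"
    have "real d - \<theta> * (\<Sum>i<d. \<bar>real_of_int (f i)\<bar>) = real d + (\<Sum>i<d. - (\<theta> * \<bar>real_of_int (f i)\<bar>))"
      by (simp add: sum_negf sum_distrib_left)
    thus "exp (real d - \<theta> * (\<Sum>i<d. \<bar>real_of_int (f i)\<bar>))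
        = exp (real d) * (\<Prod>i<d. exp (- (\<theta> * \<bar>real_of_int (f i)\<bar>)))"
      by (simp only: exp_add exp_sum finite_lessThan)
  qed
  also have "\<dots> = exp (real d) * (\<Prod>i<d. \<Sum>m\<in>{- int R..int R}. exp (- (\<theta> * \<bar>real_of_int m\<bar>)))"
    by (subst prod_sum_PiE) (auto simp: sum_distrib_left)
  also have "\<dots> \<le> exp (real d) * (\<Prod>i<d. 4 / \<theta>)"
    by (intro mult_left_mono prod_mono conjI sum_nonneg sum_exp_neg_abs_le \<theta>) auto
  also have "\<dots> = (exp 1 * (4 / \<theta>)) ^ d"
    using exp_of_nat_mult[of d "1::real"] by (simp add: power_mult_distrib power_divide)
  also have "\<dots> \<le> (12 / \<theta>) ^ d"
    using exp_le \<theta> by (intro power_mono) (auto simp: field_simps)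
  finally have card: "real (card N) \<le> (12 / \<theta>) ^ d" .
  have net: "\<exists>z\<in>N. l2_norm (x - z) \<le> \<theta>" if x: "x \<in> carrier_vec d" "l2_norm x \<le> 1" for x
  proof -
    define f where "f = (\<lambda>i\<in>{..<d}. (if 0 \<le> x $ i then \<lfloor>x $ i / \<delta>\<rfloor> else - \<lfloor>- (x $ i) / \<delta>\<rfloor>))"
    have fl: "0 \<le> real_of_int \<lfloor>y / \<delta>\<rfloor> \<and> \<delta> * real_of_int \<lfloor>y / \<delta>\<rfloor> \<le> y \<and> y < \<delta> * real_of_int \<lfloor>y / \<delta>\<rfloor> + \<delta>"
      if "0 \<le> y" for y
    proof -
      obtain r where r: "r = real_of_int \<lfloor>y / \<delta>\<rfloor>" by blast
      have "r \<le> y / \<delta>" "y / \<delta> < r + 1" unfolding r by linarith+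
      moreover have "0 \<le> r" unfolding r using that \<delta> by simp
      ultimately show ?thesis unfolding r[symmetric] using \<delta> by (simp add: field_simps)
    qed
    have f1: "\<delta> * \<bar>real_of_int (f i)\<bar> \<le> \<bar>x $ i\<bar>" and f2: "\<bar>x $ i - \<delta> * real_of_int (f i)\<bar> \<le> \<delta>" if "i < d" for i
      using fl[of "x $ i"] fl[of "- (x $ i)"] that by (auto simp: f_def)
    have "(\<Sum>i<d. \<bar>x $ i\<bar>) \<le> sqrt d"
    proof -
      have "(\<Sum>i<d. \<bar>x $ i\<bar> * \<bar>1\<bar>) \<le> L2_set (\<lambda>i. x $ i) {..<d} * L2_set (\<lambda>i. 1) {..<d}"
        by (rule L2_set_mult_ineq)
      also have "\<dots> \<le> 1 * sqrt d"
        using x by (intro mult_mono) (auto simp: l2_norm_L2_set L2_set_def)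
      finally show ?thesis by simp
    qed
    moreover have "\<delta> * (\<Sum>i<d. \<bar>real_of_int (f i)\<bar>) \<le> (\<Sum>i<d. \<bar>x $ i\<bar>)"
      unfolding sum_distrib_left by (intro sum_mono f1) auto
    ultimately have "\<delta> * (\<Sum>i<d. \<bar>real_of_int (f i)\<bar>) * sqrt d \<le> sqrt d * sqrt d"
      by (intro mult_right_mono) auto
    hence fs: "\<theta> * (\<Sum>i<d. \<bar>real_of_int (f i)\<bar>) \<le> real d"
      using False by (simp add: \<delta>_def)
    have "f i \<in> {- int R..int R}" if i: "i < d" for i
    proof -
      have "\<bar>real_of_int (f i)\<bar> \<le> (\<Sum>i<d. \<bar>real_of_int (f i)\<bar>)"
        using i by (intro member_le_sum) auto
      hence "\<theta> * \<bar>real_of_int (f i)\<bar> \<le> real d"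
        using fs mult_left_mono[of "\<bar>real_of_int (f i)\<bar>" _ \<theta>] \<theta> by (meson less_eq_real_def order.trans)
      hence "real_of_int \<bar>f i\<bar> \<le> real d / \<theta>" using \<theta> by (simp add: field_simps)
      hence "\<bar>f i\<bar> \<le> \<lfloor>real d / \<theta>\<rfloor>" by (simp only: le_floor_iff)
      moreover have "int R = \<lfloor>real d / \<theta>\<rfloor>" unfolding R_def using \<theta> by (intro nat_0_le) simp
      ultimately have "- int R \<le> f i" "f i \<le> int R" by linarith+
      thus ?thesis by simp
    qed
    hence fF: "f \<in> F" using fs by (auto simp: F_def f_def)
    let ?z = "Matrix.vec d (\<lambda>i. \<delta> * real_of_int (f i))"
    have "(l2_norm (x - ?z))\<^sup>2 = (\<Sum>i<d. (x $ i - \<delta> * real_of_int (f i))\<^sup>2)"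
      using x by (simp add: l2_norm_L2_set L2_set_def sum_nonneg)
    also have "\<dots> \<le> (\<Sum>i<d. \<delta>\<^sup>2)"
    proof (intro sum_mono)
      fix i assume "i \<in> {..<d}"
      thus "(x $ i - \<delta> * real_of_int (f i))\<^sup>2 \<le> \<delta>\<^sup>2"
        using f2[of i] power_mono[of "\<bar>x $ i - \<delta> * real_of_int (f i)\<bar>" \<delta> 2] by simp
    qed
    also have "\<dots> = \<theta>\<^sup>2" using False by (simp add: \<delta>_def power_divide)
    finally have "l2_norm (x - ?z) \<le> \<theta>" by (rule power2_le_imp_le) (use \<theta> in simp)
    moreover have "?z \<in> N" unfolding N_def using fF by (rule imageI)
    ultimately show ?thesis by blast
  qed
  have "finite N" unfolding N_def using fF by (rule finite_imageI)
  moreover have "N \<subseteq> carrier_vec d" by (auto simp: N_def)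
  ultimately show thesis using that card net by blast
qed

lemma norm_bound_net:
  assumes A: "A \<in> carrier_mat m d" and N: "N \<subseteq> carrier_vec d"
    and net: "\<And>x. x \<in> carrier_vec d \<Longrightarrow> l2_norm x \<le> 1 \<Longrightarrow> \<exists>z\<in>N. l2_norm (x - z) \<le> 1/2"
    and c: "0 \<le> c" "\<And>z. z \<in> N \<Longrightarrow> l2_norm (A *\<^sub>v z) \<le> c * l2_norm z"
  shows "norm_bound A (3 * c)"
proof -
  define s where "s = max 0 (spectral_norm A)"
  have sA: "norm_bound A s"
    by (rule norm_bound_mono[OF norm_bound_spectral_norm]) (simp add: s_def)
  have "l2_norm (A *\<^sub>v x) \<le> 3/2 * c + s / 2" if x: "x \<in> carrier_vec d" "l2_norm x \<le> 1" for x
  proof -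
    obtain z where z: "z \<in> N" "l2_norm (x - z) \<le> 1/2" using net[OF x] by auto
    have zc: "z \<in> carrier_vec d" using z N by auto
    have d: "x - z \<in> carrier_vec d" using x zc by auto
    have "x - (x - z) = z" using x(1) zc by (intro eq_vecI) auto
    hence "l2_norm z \<le> 1 + 1/2" using l2_norm_triangle_diff[OF x(1) d] x(2) z(2) by simp
    hence "l2_norm (A *\<^sub>v z) \<le> c * (3/2)" using c(2)[OF z(1)] mult_left_mono[OF _ c(1), of "l2_norm z" "3/2"] by linarith
    moreover have "l2_norm (A *\<^sub>v (x - z)) \<le> s * (1/2)"
      using norm_boundD[OF sA A d] mult_left_mono[OF z(2), of s] by (simp add: s_def)
    moreover have "A *\<^sub>v x = A *\<^sub>v z + A *\<^sub>v (x - z)"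
    proof -
      have "x = z + (x - z)" using x(1) zc by (intro eq_vecI) auto
      thus ?thesis using mult_add_distrib_mat_vec[OF A zc d] by simp
    qed
    ultimately show ?thesis
      using l2_norm_triangle[OF mult_mat_vec_carrier[OF A zc] mult_mat_vec_carrier[OF A d]] by simp
  qed
  hence "spectral_norm A \<le> 3/2 * c + s / 2"
    unfolding spectral_norm_def using A
    by (intro cSUP_least) (auto intro: exI[of _ "0\<^sub>v d"])
  hence "spectral_norm A \<le> 3 * c" using c by (auto simp: s_def max_def split: if_splits)
  thus ?thesis by (rule norm_bound_mono[OF norm_bound_spectral_norm])
qed

lemma lower_bound_net:
  assumes A: "A \<in> carrier_mat m d" and N: "N \<subseteq> carrier_vec d" and \<theta>: "\<theta> \<le> 1/2"
    and net: "\<And>x. x \<in> carrier_vec d \<Longrightarrow> l2_norm x \<le> 1 \<Longrightarrow> \<exists>z\<in>N. l2_norm (x - z) \<le> \<theta>"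
    and K: "norm_bound A K" "0 \<le> K"
    and c: "0 \<le> c" "\<And>z. z \<in> N \<Longrightarrow> c * l2_norm z \<le> l2_norm (A *\<^sub>v z)"
    and x: "x \<in> carrier_vec d"
  shows "(c / 2 - K * \<theta>) * l2_norm x \<le> l2_norm (A *\<^sub>v x)"
proof (cases "l2_norm x = 0")
  case False
  hence pos: "0 < l2_norm x" using l2_norm_nonneg[of x] by linarith
  let ?x = "(1 / l2_norm x) \<cdot>\<^sub>v x"
  have xc: "?x \<in> carrier_vec d" and x1: "l2_norm ?x = 1" using x pos by auto
  obtain z where z: "z \<in> N" "l2_norm (?x - z) \<le> \<theta>" using net[OF xc] x1 by auto
  have zc: "z \<in> carrier_vec d" using z N by auto
  have d: "?x - z \<in> carrier_vec d" using xc zc by auto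
  have xz: "?x = z + (?x - z)" using x zc by (intro eq_vecI) auto
  have "1 \<le> l2_norm z + l2_norm (?x - z)" using l2_norm_triangle[OF zc d] xz x1 by simp
  hence "1/2 \<le> l2_norm z" using z(2) \<theta> by linarith
  hence "c * (1/2) \<le> l2_norm (A *\<^sub>v z)" using c(2)[OF z(1)] mult_left_mono[OF _ c(1), of "1/2" "l2_norm z"] by linarith
  moreover have "l2_norm (A *\<^sub>v (?x - z)) \<le> K * \<theta>"
    using norm_boundD[OF K(1) A d] mult_left_mono[OF z(2) K(2)] by linarith
  moreover have "A *\<^sub>v ?x = A *\<^sub>v z + A *\<^sub>v (?x - z)"
    using mult_add_distrib_mat_vec[OF A zc d] xz by simp
  moreover have "l2_norm (A *\<^sub>v z) - l2_norm (A *\<^sub>v (?x - z)) \<le> l2_norm (A *\<^sub>v z + A *\<^sub>v (?x - z))"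
    by (rule l2_norm_diff_ge[OF mult_mat_vec_carrier[OF A zc] mult_mat_vec_carrier[OF A d]])
  ultimately have "c / 2 - K * \<theta> \<le> l2_norm (A *\<^sub>v ?x)" by simp
  also have "A *\<^sub>v ?x = (1 / l2_norm x) \<cdot>\<^sub>v (A *\<^sub>v x)" by (rule mult_mat_vec[OF A x])
  finally have "c / 2 - K * \<theta> \<le> (1 / l2_norm x) * l2_norm (A *\<^sub>v x)"
    using pos unfolding l2_norm_smult by simp
  thus ?thesis using pos by (simp add: field_simps)
qed simp

lemma (in prob_space) prob_finite_exists_le:
  assumes "finite T" and "\<And>z. z \<in> T \<Longrightarrow> {\<omega> \<in> space M. P z \<omega>} \<in> events"
    and "\<And>z. z \<in> T \<Longrightarrow> prob {\<omega> \<in> space M. P z \<omega>} \<le> p"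
  shows "{\<omega> \<in> space M. \<exists>z\<in>T. P z \<omega>} \<in> events"
    and "prob {\<omega> \<in> space M. \<exists>z\<in>T. P z \<omega>} \<le> real (card T) * p"
proof -
  have eq: "{\<omega> \<in> space M. \<exists>z\<in>T. P z \<omega>} = (\<Union>z\<in>T. {\<omega> \<in> space M. P z \<omega>})" by auto
  show "{\<omega> \<in> space M. \<exists>z\<in>T. P z \<omega>} \<in> events" unfolding eq using assms by auto
  have "prob (\<Union>z\<in>T. {\<omega> \<in> space M. P z \<omega>}) \<le> (\<Sum>z\<in>T. prob {\<omega> \<in> space M. P z \<omega>})"
    using assms by (intro finite_measure_subadditive_finite) auto
  also have "\<dots> \<le> (\<Sum>z\<in>T. p)" by (intro sum_mono assms)
  finally show "prob {\<omega> \<in> space M. \<exists>z\<in>T. P z \<omega>} \<le> real (card T) * p" unfolding eq by simp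
qed

lemma net_tail_constant: "24 ^ m * (exp (- (20 * real m / 4)) * sqrt 2 ^ m) \<le> exp (- real m)"
proof -
  have e: "5/2 \<le> exp (1::real)" using exp_lower_Taylor_quadratic[of "1::real"] by simp
  have "(36::real) \<le> (5/2) ^ 4" by (simp add: power4_eq_xxxx)
  also have "\<dots> \<le> exp 1 ^ 4" using e by (intro power_mono) auto
  finally have e4: "36 \<le> exp (4::real)" by (simp add: exp_of_nat_mult[symmetric])
  have s: "sqrt 2 \<le> 3/2" by (rule real_le_lsqrt) (auto simp: power2_eq_square)
  have "24 ^ m * (exp (- (20 * real m / 4)) * sqrt 2 ^ m) = (24 * exp (- 5) * sqrt 2) ^ m"
    using exp_of_nat_mult[of m "- 5 :: real"] by (simp add: power_mult_distrib algebra_simps)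
  also have "\<dots> \<le> exp (- 1) ^ m"
  proof (intro power_mono)
    have "24 * exp (- 5) * sqrt 2 \<le> 24 * exp (- 5) * (3/2)" using s by (intro mult_left_mono) auto
    also have "\<dots> = 36 * exp (- 5 :: real)" by simp
    also have "\<dots> \<le> exp 4 * exp (- 5)" using e4 by (intro mult_right_mono) auto
    also have "\<dots> = exp (- 1)" by (simp add: exp_add[symmetric])
    finally show "24 * exp (- 5) * sqrt 2 \<le> exp (- 1 :: real)" .
  qed auto
  also have "\<dots> = exp (- real m)" using exp_of_nat_mult[of m "- 1 :: real"] by simp
  finally show ?thesis .
qed

lemma gaussian_upper_tail_finite:
  assumes T: "finite T" "T \<subseteq> carrier_vec n" "real (card T) \<le> 24 ^ m" and k: "k \<le> m"
  defines "B \<equiv> {\<omega> \<in> space (gaussian_entries n k). \<exists>z\<in>T.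
      20 * real m * (l2_norm z)\<^sup>2 < (l2_norm (transpose_mat (Matrix.mat n k \<omega>) *\<^sub>v z))\<^sup>2}"
  shows "B \<in> sets (gaussian_entries n k)" "measure (gaussian_entries n k) B \<le> exp (- real m)"
proof -
  interpret prob_space "gaussian_entries n k" by (rule prob_space_gaussian_entries)
  let ?p = "exp (- (20 * real m / 4)) * sqrt 2 ^ k"
  have meas: "{\<omega> \<in> space (gaussian_entries n k).
      20 * real m * (l2_norm z)\<^sup>2 < (l2_norm (transpose_mat (Matrix.mat n k \<omega>) *\<^sub>v z))\<^sup>2} \<in> events" if "z \<in> T" for z
  proof -
    have [measurable]: "(\<lambda>\<omega>. (l2_norm (transpose_mat (Matrix.mat n k \<omega>) *\<^sub>v z))\<^sup>2) \<in> borel_measurable (gaussian_entries n k)"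
      using that T by (intro l2_norm_transpose_measurable) auto
    show ?thesis by measurable
  qed
  have p: "prob {\<omega> \<in> space (gaussian_entries n k).
      20 * real m * (l2_norm z)\<^sup>2 < (l2_norm (transpose_mat (Matrix.mat n k \<omega>) *\<^sub>v z))\<^sup>2} \<le> ?p" if "z \<in> T" for z
    by (rule gaussian_upper_tail) (use that T(2) in blast)
  show "B \<in> events" unfolding B_def by (rule prob_finite_exists_le(1)[OF T(1) meas p])
  have "prob B \<le> real (card T) * ?p" unfolding B_def by (rule prob_finite_exists_le(2)[OF T(1) meas p])
  also have "\<dots> \<le> 24 ^ m * (exp (- (20 * real m / 4)) * sqrt 2 ^ m)"
    using T(3) k by (intro mult_mono power_increasing) auto
  also have "\<dots> \<le> exp (- real m)" by (rule net_tail_constant)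
  finally show "prob B \<le> exp (- real m)" .
qed

definition small_ball_level :: "real \<Rightarrow> real" where
  "small_ball_level c = (1344 * exp 1) powr (- 1 / c)"

lemma small_ball_level: "0 < c \<Longrightarrow> 0 < small_ball_level c" "0 < c \<Longrightarrow> small_ball_level c \<le> 1"
proof -
  assume c: "0 < c"
  show "0 < small_ball_level c" by (simp add: small_ball_level_def)
  have "1 \<le> 1344 * exp (1::real)" using exp_ge_add_one_self[of "1::real"] by linarith
  hence "(1344 * exp 1) powr (- 1 / c) \<le> (1344 * exp 1) powr (0::real)"
    using c by (intro powr_mono) auto
  thus "small_ball_level c \<le> 1" by (simp add: small_ball_level_def)
qed

lemma small_ball_union:
  assumes c: "0 < c" and k: "real k \<le> (1 - c) * real m"
  shows "(12 / (small_ball_level c / 56)) ^ k * (2 * small_ball_level c) ^ m \<le> exp (- real m)"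
proof -
  let ?\<epsilon> = "small_ball_level c"
  note \<epsilon> = small_ball_level[OF c]
  have "real k \<le> real m" using k mult_right_mono[of "1 - c" 1 "real m"] c by simp
  hence km: "k \<le> m" by simp
  have "(12 / (?\<epsilon> / 56)) ^ k * (2 * ?\<epsilon>) ^ m = 672 ^ k * 2 ^ m * (?\<epsilon> ^ m / ?\<epsilon> ^ k)"
    by (simp add: power_mult_distrib power_divide)
  also have "?\<epsilon> ^ m / ?\<epsilon> ^ k = ?\<epsilon> powr (real m - real k)"
    using \<epsilon>(1) by (simp add: powr_diff powr_realpow)
  also have "672 ^ k * 2 ^ m * ?\<epsilon> powr (real m - real k) \<le> 672 ^ m * 2 ^ m * ?\<epsilon> powr (c * real m)"
  proof (intro mult_mono)
    show "?\<epsilon> powr (real m - real k) \<le> ?\<epsilon> powr (c * real m)"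
      using k \<epsilon> by (intro powr_mono') (auto simp: algebra_simps)
  qed (use km in \<open>auto intro: power_increasing\<close>)
  also have "?\<epsilon> powr (c * real m) = (1344 * exp 1) powr (- real m)"
    using c by (simp add: small_ball_level_def powr_powr)
  also have "\<dots> = 1 / (1344 ^ m * exp 1 ^ m)"
    by (simp add: powr_minus powr_realpow power_mult_distrib divide_inverse)
  also have "(672 :: real) ^ m * 2 ^ m = 1344 ^ m" by (simp add: power_mult_distrib[symmetric])
  also have "(1344 :: real) ^ m * (1 / (1344 ^ m * exp 1 ^ m)) = exp (- real m)"
    using exp_of_nat_mult[of m "1 :: real"] by (simp add: exp_minus divide_inverse)
  finally show ?thesis .
qed

lemma gaussian_upper_tail_family:
  fixes k :: nat
  assumes F: "finite F" "F \<subseteq> carrier_vec n"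
  defines "B \<equiv> {\<omega> \<in> space (gaussian_entries n k). \<exists>z\<in>F.
      20 * real k * (l2_norm z)\<^sup>2 < (l2_norm (transpose_mat (Matrix.mat n k \<omega>) *\<^sub>v z))\<^sup>2}"
  shows "B \<in> sets (gaussian_entries n k)" "measure (gaussian_entries n k) B \<le> real (card F) * exp (- real k)"
proof -
  interpret prob_space "gaussian_entries n k" by (rule prob_space_gaussian_entries)
  have 1: "{\<omega> \<in> space (gaussian_entries n k).
      20 * real k * (l2_norm z)\<^sup>2 < (l2_norm (transpose_mat (Matrix.mat n k \<omega>) *\<^sub>v z))\<^sup>2} \<in> events"
    "prob {\<omega> \<in> space (gaussian_entries n k).
      20 * real k * (l2_norm z)\<^sup>2 < (l2_norm (transpose_mat (Matrix.mat n k \<omega>) *\<^sub>v z))\<^sup>2} \<le> exp (- real k)"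
    if "z \<in> F" for z
  proof -
    have z: "finite {z}" "{z} \<subseteq> carrier_vec n" "real (card {z}) \<le> 24 ^ k" using that F by auto
    show "{\<omega> \<in> space (gaussian_entries n k).
      20 * real k * (l2_norm z)\<^sup>2 < (l2_norm (transpose_mat (Matrix.mat n k \<omega>) *\<^sub>v z))\<^sup>2} \<in> events"
      using gaussian_upper_tail_finite(1)[OF z order.refl] by (simp only: Bex_def insert_iff empty_iff simp_thms)
    show "prob {\<omega> \<in> space (gaussian_entries n k).
      20 * real k * (l2_norm z)\<^sup>2 < (l2_norm (transpose_mat (Matrix.mat n k \<omega>) *\<^sub>v z))\<^sup>2} \<le> exp (- real k)"
      using gaussian_upper_tail_finite(2)[OF z order.refl] by (simp only: Bex_def insert_iff empty_iff simp_thms)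
  qed
  show "B \<in> events" unfolding B_def by (rule prob_finite_exists_le(1)[OF F(1) 1])
  show "prob B \<le> real (card F) * exp (- real k)" unfolding B_def by (rule prob_finite_exists_le(2)[OF F(1) 1])
qed

lemma gaussian_small_ball_family:
  fixes k :: nat
  assumes F: "finite F" "F \<subseteq> carrier_vec n" and \<epsilon>: "0 < \<epsilon>"
  defines "B \<equiv> {\<omega> \<in> space (gaussian_entries n k). \<exists>z\<in>F.
      (l2_norm (transpose_mat (Matrix.mat n k \<omega>) *\<^sub>v z))\<^sup>2 < \<epsilon>\<^sup>2 * real k * (l2_norm z)\<^sup>2}"
  shows "B \<in> sets (gaussian_entries n k)" "measure (gaussian_entries n k) B \<le> real (card F) * (2 * \<epsilon>) ^ k"
proof -
  interpret prob_space "gaussian_entries n k" by (rule prob_space_gaussian_entries)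
  have 1: "{\<omega> \<in> space (gaussian_entries n k).
      (l2_norm (transpose_mat (Matrix.mat n k \<omega>) *\<^sub>v z))\<^sup>2 < \<epsilon>\<^sup>2 * real k * (l2_norm z)\<^sup>2} \<in> events" if "z \<in> F" for z
  proof -
    have [measurable]: "(\<lambda>\<omega>. (l2_norm (transpose_mat (Matrix.mat n k \<omega>) *\<^sub>v z))\<^sup>2) \<in> borel_measurable (gaussian_entries n k)"
      using that F by (intro l2_norm_transpose_measurable) auto
    show ?thesis by measurable
  qed
  have 2: "prob {\<omega> \<in> space (gaussian_entries n k).
      (l2_norm (transpose_mat (Matrix.mat n k \<omega>) *\<^sub>v z))\<^sup>2 < \<epsilon>\<^sup>2 * real k * (l2_norm z)\<^sup>2} \<le> (2 * \<epsilon>) ^ k" if "z \<in> F" for z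
    by (rule gaussian_small_ball) (use that F \<epsilon> in blast)+
  show "B \<in> events" unfolding B_def by (rule prob_finite_exists_le(1)[OF F(1) 1 2])
  show "prob B \<le> real (card F) * (2 * \<epsilon>) ^ k" unfolding B_def by (rule prob_finite_exists_le(2)[OF F(1) 1 2])
qed

lemma gaussian_concentration_family:
  fixes k :: nat
  assumes F: "finite F" "F \<subseteq> carrier_vec n" and L: "0 \<le> L" "4 * L \<le> real k"
  defines "B \<equiv> {\<omega> \<in> space (gaussian_entries n k). \<exists>z\<in>F. 14 * sqrt (real k * L) * (l2_norm z)\<^sup>2
        < \<bar>(l2_norm (transpose_mat (Matrix.mat n k \<omega>) *\<^sub>v z))\<^sup>2 - real k * (l2_norm z)\<^sup>2\<bar>}"
  shows "B \<in> sets (gaussian_entries n k)" "measure (gaussian_entries n k) B \<le> real (card F) * (2 * exp (- 6 * L))"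
proof -
  interpret prob_space "gaussian_entries n k" by (rule prob_space_gaussian_entries)
  have 1: "{\<omega> \<in> space (gaussian_entries n k). 14 * sqrt (real k * L) * (l2_norm z)\<^sup>2
        < \<bar>(l2_norm (transpose_mat (Matrix.mat n k \<omega>) *\<^sub>v z))\<^sup>2 - real k * (l2_norm z)\<^sup>2\<bar>} \<in> events" if "z \<in> F" for z
  proof -
    have [measurable]: "(\<lambda>\<omega>. (l2_norm (transpose_mat (Matrix.mat n k \<omega>) *\<^sub>v z))\<^sup>2) \<in> borel_measurable (gaussian_entries n k)"
      using that F by (intro l2_norm_transpose_measurable) auto
    show ?thesis by measurable
  qed
  have 2: "prob {\<omega> \<in> space (gaussian_entries n k). 14 * sqrt (real k * L) * (l2_norm z)\<^sup>2
        < \<bar>(l2_norm (transpose_mat (Matrix.mat n k \<omega>) *\<^sub>v z))\<^sup>2 - real k * (l2_norm z)\<^sup>2\<bar>} \<le> 2 * exp (- 6 * L)" if "z \<in> F" for z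
    by (rule gaussian_concentration) (use that F L in blast)+
  show "B \<in> events" unfolding B_def by (rule prob_finite_exists_le(1)[OF F(1) 1 2])
  show "prob B \<le> real (card F) * (2 * exp (- 6 * L))" unfolding B_def by (rule prob_finite_exists_le(2)[OF F(1) 1 2])
qed

lemma polarization_bound:
  assumes G: "(G :: real mat) \<in> carrier_mat n k" and x: "x \<in> carrier_vec n" and y: "y \<in> carrier_vec n"
    and xn: "l2_norm x = 1" and yn: "l2_norm y \<le> 1" and xy: "x \<bullet> y = 0" and t: "0 \<le> t"
    and conc: "\<And>z. z \<in> {x + y, x - y} \<Longrightarrow>
      \<bar>(l2_norm (G\<^sup>T *\<^sub>v z))\<^sup>2 - a * (l2_norm z)\<^sup>2\<bar> \<le> t * (l2_norm z)\<^sup>2"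
  shows "\<bar>(G\<^sup>T *\<^sub>v x) \<bullet> (G\<^sup>T *\<^sub>v y)\<bar> \<le> t"
proof -
  have Gt: "G\<^sup>T \<in> carrier_mat k n" using G by auto
  let ?u = "G\<^sup>T *\<^sub>v x" and ?w = "G\<^sup>T *\<^sub>v y"
  have uw: "?u \<in> carrier_vec k" "?w \<in> carrier_vec k" using Gt x y by auto
  define q where "q = 1 + (l2_norm y)\<^sup>2"
  have q: "(l2_norm (x + y))\<^sup>2 = q" "(l2_norm (x - y))\<^sup>2 = q"
    using l2_norm_add_square[OF x y] l2_norm_diff_square[OF x y] xn xy by (auto simp: q_def)
  have q2: "q \<le> 2" using power_mono[OF yn, of 2] by (simp add: q_def)
  have "(l2_norm (?u + ?w))\<^sup>2 - (l2_norm (?u - ?w))\<^sup>2 = 4 * (?u \<bullet> ?w)"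
    using l2_norm_add_square[OF uw] l2_norm_diff_square[OF uw] by simp
  moreover have "\<bar>(l2_norm (?u + ?w))\<^sup>2 - a * q\<bar> \<le> t * q" "\<bar>(l2_norm (?u - ?w))\<^sup>2 - a * q\<bar> \<le> t * q"
    using conc[of "x + y"] conc[of "x - y"] q mult_add_distrib_mat_vec[OF Gt x y] mult_minus_distrib_mat_vec[OF Gt x y]
    by auto
  moreover have "t * q \<le> t * 2" using q2 t by (rule mult_left_mono)
  ultimately show ?thesis by linarith
qed

lemma failure_budget:
  fixes n :: nat
  assumes n: "2 \<le> n" and k: "k \<le> n" and f: "f \<le> 2 * n" and m: "6 * ln (real n) \<le> real m"
    and F5: "F5 \<le> 2 * k * f"
  shows "exp (- real n) + exp (- real m) + exp (- real m) + real f * exp (- real m)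
      + real F5 * (2 * exp (- 6 * ln (real n))) \<le> 5 * real n powr (- 3) + 2 * exp (- real n / 2)"
proof -
  have n2: "2 \<le> real n" using n by simp
  have n6: "exp (- 6 * ln (real n)) = real n powr (- 3) * real n powr (- 3)"
    using n2 by (simp add: powr_def exp_add[symmetric])
  have em: "exp (- real m) \<le> exp (- 6 * ln (real n))" using m by simp
  have k': "real k \<le> real n" "real f \<le> 2 * real n" using k f by (simp_all flip: of_nat_le_iff)
  have "real F5 \<le> real (2 * k * f)" using F5 by (simp only: of_nat_le_iff)
  also have "\<dots> = 2 * real k * real f" by simp
  also have "\<dots> \<le> 2 * real n * (2 * real n)" using k' by (intro mult_mono) auto
  finally have F5': "real F5 \<le> 4 * real n ^ 2" by (simp add: power2_eq_square)
  let ?e = "exp (- 6 * ln (real n))"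
  have "exp (- real m) + exp (- real m) + real f * exp (- real m) + real F5 * (2 * ?e)
      \<le> ?e + ?e + (2 * real n) * ?e + (4 * real n ^ 2) * (2 * ?e)"
    using em k' F5' by (intro add_mono mult_mono) auto
  also have "\<dots> = (2 + 2 * real n + 8 * real n ^ 2) * ?e" by (simp add: algebra_simps)
  also have "\<dots> \<le> (5 * real n ^ 3) * ?e"
  proof (intro mult_right_mono)
    have a: "2 * real n \<le> real n ^ 2" using n2 by (simp add: power2_eq_square)
    have b: "2 * real n ^ 2 \<le> real n ^ 3" using n2 by (simp add: power2_eq_square power3_eq_cube)
    show "2 + 2 * real n + 8 * real n ^ 2 \<le> 5 * real n ^ 3" using a b n2 by linarith
  qed simp
  also have "real n ^ 3 * ?e = real n powr (- 3)"
  proof -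
    have "real n ^ 3 * real n powr (- 3) = 1" using n2 by (simp add: powr_minus)
    thus ?thesis unfolding n6 by (simp only: mult.assoc[symmetric] mult_1_left)
  qed
  hence "5 * real n ^ 3 * ?e = 5 * real n powr (- 3)" by simp
  finally have "exp (- real m) + exp (- real m) + real f * exp (- real m) + real F5 * (2 * ?e) \<le> 5 * real n powr (- 3)"
    using \<open>5 * real n ^ 3 * ?e = 5 * real n powr (- 3)\<close> by linarith
  moreover have "exp (- real n) \<le> exp (- real n / 2)" by simp
  moreover have "0 \<le> exp (- real n / 2)" by simp
  ultimately show ?thesis by linarith
qed

lemma gaussian_good_event:
  assumes c: "0 < c" "c < 1" and n: "2 \<le> n" and m: "m \<le> n" and k: "1 \<le> k" "real k \<le> (1 - c) * real m"
    and mL: "6 * ln (real n) \<le> real m" and U: "U \<in> carrier_mat n k" "orthonormal_cols U"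
    and F: "finite F" "F \<subseteq> carrier_vec n" "card F \<le> 2 * n"
    and Fy: "\<And>y. y \<in> F \<Longrightarrow> U\<^sup>T *\<^sub>v y = 0\<^sub>v k \<and> l2_norm y \<le> 1"
  shows "\<exists>A \<in> sets (gaussian_entries n m).
      1 - 5 * real n powr (- 3) - 2 * exp (- real n / 2) \<le> measure (gaussian_entries n m) A \<and>
      (\<forall>\<omega>\<in>A. let G = Matrix.mat n m \<omega> in
        (\<forall>z \<in> carrier_vec n. l2_norm (G\<^sup>T *\<^sub>v z) \<le> 14 * sqrt (real n) * l2_norm z) \<and>
        (\<forall>x \<in> carrier_vec k. small_ball_level c / 4 * sqrt (real m) * l2_norm x \<le> l2_norm (G\<^sup>T *\<^sub>v (U *\<^sub>v x))) \<and>
        (\<forall>y \<in> F. l2_norm (G\<^sup>T *\<^sub>v y) \<le> 5 * sqrt (real m) \<and>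
          l2_norm (U\<^sup>T *\<^sub>v (G *\<^sub>v (G\<^sup>T *\<^sub>v y))) \<le> sqrt (real k) * (14 * sqrt (real m * ln (real n)))))"
proof -
  let ?M = "gaussian_entries n m"
  interpret prob_space ?M by (rule prob_space_gaussian_entries)
  let ?\<epsilon> = "small_ball_level c"
  note \<epsilon> = small_ball_level[OF c(1)]
  have km: "k \<le> m" using k(2) mult_right_mono[of "1 - c" 1 "real m"] c by simp
  have L: "0 \<le> ln (real n)" "4 * ln (real n) \<le> real m" using n mL by auto
  have Uv: "U *\<^sub>v v \<in> carrier_vec n" for v using U(1) by (intro carrier_vecI) auto
  have nU: "l2_norm (U *\<^sub>v v) = l2_norm v" if "v \<in> carrier_vec k" for v
    by (rule orthonormal_cols_l2_norm[OF U(2,1) that])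
  obtain N1 where N1: "finite N1" "N1 \<subseteq> carrier_vec n" "real (card N1) \<le> (12 / (1/2)) ^ n"
    "\<And>x. x \<in> carrier_vec n \<Longrightarrow> l2_norm x \<le> 1 \<Longrightarrow> \<exists>z\<in>N1. l2_norm (x - z) \<le> 1/2"
    using euclidean_net[of "1/2" n] by auto
  obtain N2 where N2: "finite N2" "N2 \<subseteq> carrier_vec k" "real (card N2) \<le> (12 / (1/2)) ^ k"
    "\<And>x. x \<in> carrier_vec k \<Longrightarrow> l2_norm x \<le> 1 \<Longrightarrow> \<exists>z\<in>N2. l2_norm (x - z) \<le> 1/2"
    using euclidean_net[of "1/2" k] by auto
  obtain N3 where N3: "finite N3" "N3 \<subseteq> carrier_vec k" "real (card N3) \<le> (12 / (?\<epsilon> / 56)) ^ k"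
    "\<And>x. x \<in> carrier_vec k \<Longrightarrow> l2_norm x \<le> 1 \<Longrightarrow> \<exists>z\<in>N3. l2_norm (x - z) \<le> ?\<epsilon> / 56"
    using euclidean_net[of "?\<epsilon> / 56" k] \<epsilon> by auto
  let ?T2 = "(\<lambda>v. U *\<^sub>v v) ` N2" and ?T3 = "(\<lambda>v. U *\<^sub>v v) ` N3"
  define T5 where "T5 = (\<Union>(a, y) \<in> {..<k} \<times> F. {U *\<^sub>v unit_vec k a + y, U *\<^sub>v unit_vec k a - y})"
  have T2: "finite ?T2" "?T2 \<subseteq> carrier_vec n" "real (card ?T2) \<le> 24 ^ m"
  proof -
    have "real (card ?T2) \<le> real (card N2)" using card_image_le[OF N2(1)] by simp
    also have "\<dots> \<le> 24 ^ k" using N2(3) by simp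
    also have "\<dots> \<le> 24 ^ m" using km by (intro power_increasing) auto
    finally show "real (card ?T2) \<le> 24 ^ m" .
  qed (use N2 Uv in auto)
  have T3: "finite ?T3" "?T3 \<subseteq> carrier_vec n" "real (card ?T3) \<le> (12 / (?\<epsilon> / 56)) ^ k"
  proof -
    have "real (card ?T3) \<le> real (card N3)" using card_image_le[OF N3(1)] by simp
    thus "real (card ?T3) \<le> (12 / (?\<epsilon> / 56)) ^ k" using N3(3) by linarith
  qed (use N3 Uv in auto)
  have T5: "finite T5" "T5 \<subseteq> carrier_vec n" "card T5 \<le> 2 * k * card F"
  proof -
    show "finite T5" unfolding T5_def using F(1) by auto
    show "T5 \<subseteq> carrier_vec n" unfolding T5_def using F(2) Uv by auto
    have "card T5 \<le> (\<Sum>p\<in>{..<k} \<times> F. card (case p of (a, y) \<Rightarrow> {U *\<^sub>v unit_vec k a + y, U *\<^sub>v unit_vec k a - y}))"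
      unfolding T5_def using F(1) by (intro card_UN_le) auto
    also have "\<dots> \<le> (\<Sum>p\<in>{..<k} \<times> F. 2)"
      by (intro sum_mono) (auto simp: card_insert_if)
    finally show "card T5 \<le> 2 * k * card F" by (simp add: card_cartesian_product)
  qed
  note b2 = gaussian_upper_tail_finite[OF T2 order.refl]
  note b3 = gaussian_small_ball_family[OF T3(1,2) \<epsilon>(1), of m]
  note b4 = gaussian_upper_tail_family[OF F(1,2), of m]
  note b5 = gaussian_concentration_family[OF T5(1,2) L]
  let ?f = "\<lambda>\<omega> z. (l2_norm (transpose_mat (Matrix.mat n m \<omega>) *\<^sub>v z))\<^sup>2"
  let ?B1 = "{\<omega> \<in> space ?M. \<exists>z\<in>N1. 20 * real n * (l2_norm z)\<^sup>2 < ?f \<omega> z}"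
  let ?B2 = "{\<omega> \<in> space ?M. \<exists>z\<in>?T2. 20 * real m * (l2_norm z)\<^sup>2 < ?f \<omega> z}"
  let ?B3 = "{\<omega> \<in> space ?M. \<exists>z\<in>?T3. ?f \<omega> z < ?\<epsilon>\<^sup>2 * real m * (l2_norm z)\<^sup>2}"
  let ?B4 = "{\<omega> \<in> space ?M. \<exists>z\<in>F. 20 * real m * (l2_norm z)\<^sup>2 < ?f \<omega> z}"
  let ?B5 = "{\<omega> \<in> space ?M. \<exists>z\<in>T5. 14 * sqrt (real m * ln (real n)) * (l2_norm z)\<^sup>2 < \<bar>?f \<omega> z - real m * (l2_norm z)\<^sup>2\<bar>}"
  have N1c: "real (card N1) \<le> 24 ^ n" using N1(3) by simp
  note b1 = gaussian_upper_tail_finite[OF N1(1,2) N1c m]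
  have p3: "prob ?B3 \<le> exp (- real m)"
  proof -
    have "real (card ?T3) * (2 * ?\<epsilon>) ^ m \<le> (12 / (?\<epsilon> / 56)) ^ k * (2 * ?\<epsilon>) ^ m"
      using T3(3) \<epsilon> by (intro mult_right_mono) auto
    also have "\<dots> \<le> exp (- real m)" by (rule small_ball_union[OF c(1) k(2)])
    finally show ?thesis using b3(2) by linarith
  qed
  define B where "B = ?B1 \<union> (?B2 \<union> (?B3 \<union> (?B4 \<union> ?B5)))"
  have ev: "?B5 \<in> events" "?B4 \<in> events" "?B3 \<in> events" "?B2 \<in> events" "?B1 \<in> events"
    by (rule b5(1), rule b4(1), rule b3(1), rule b2(1), rule b1(1))
  have B: "B \<in> events" unfolding B_def using ev by (intro sets.Un)
  have "prob B \<le> prob ?B1 + (prob ?B2 + (prob ?B3 + (prob ?B4 + prob ?B5)))"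
    unfolding B_def using ev
    by (intro order.trans[OF measure_Un_le] add_left_mono) (auto intro!: sets.Un)
  also have "\<dots> \<le> exp (- real n) + (exp (- real m) + (exp (- real m) + (real (card F) * exp (- real m)
      + real (card T5) * (2 * exp (- 6 * ln (real n))))))"
    using b1(2) b2(2) p3 b4(2) b5(2) by (intro add_mono)
  also have "\<dots> = exp (- real n) + exp (- real m) + exp (- real m) + real (card F) * exp (- real m)
      + real (card T5) * (2 * exp (- 6 * ln (real n)))" by simp
  also have "\<dots> \<le> 5 * real n powr (- 3) + 2 * exp (- real n / 2)"
    using km m by (intro failure_budget[OF n _ F(3) mL T5(3)]) simp
  finally have pB: "prob B \<le> 5 * real n powr (- 3) + 2 * exp (- real n / 2)" .
  show ?thesis
  proof (intro bexI[of _ "space ?M - B"] conjI ballI)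
    show "space ?M - B \<in> events" using B by auto
    show "1 - 5 * real n powr (- 3) - 2 * exp (- real n / 2) \<le> prob (space ?M - B)"
      using prob_compl[OF B] pB by simp
    fix \<omega> assume w: "\<omega> \<in> space ?M - B"
    define G where "G = Matrix.mat n m \<omega>"
    have G: "G \<in> carrier_mat n m" by (simp add: G_def)
    have Gt: "G\<^sup>T \<in> carrier_mat m n" using G by auto
    have nB: "\<omega> \<notin> ?B1" "\<omega> \<notin> ?B2" "\<omega> \<notin> ?B3" "\<omega> \<notin> ?B4" "\<omega> \<notin> ?B5" and ws: "\<omega> \<in> space ?M"
      using w unfolding B_def by (simp_all only: Diff_iff Un_iff de_Morgan_disj not_False_eq_True)
    have good: "\<not> Q \<omega> z" if "\<omega> \<notin> {\<omega> \<in> space ?M. \<exists>z\<in>S. Q \<omega> z}" "z \<in> S" for Q z S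
      using that ws by blast
    have c1: "(l2_norm (G\<^sup>T *\<^sub>v z))\<^sup>2 \<le> 20 * real n * (l2_norm z)\<^sup>2" if "z \<in> N1" for z
      unfolding G_def by (rule leI, rule good[OF nB(1) that])
    have c2: "(l2_norm (G\<^sup>T *\<^sub>v z))\<^sup>2 \<le> 20 * real m * (l2_norm z)\<^sup>2" if "z \<in> ?T2" for z
      unfolding G_def by (rule leI, rule good[OF nB(2) that])
    have c3: "?\<epsilon>\<^sup>2 * real m * (l2_norm z)\<^sup>2 \<le> (l2_norm (G\<^sup>T *\<^sub>v z))\<^sup>2" if "z \<in> ?T3" for z
      unfolding G_def by (rule leI, rule good[OF nB(3) that])
    have c4: "(l2_norm (G\<^sup>T *\<^sub>v z))\<^sup>2 \<le> 20 * real m * (l2_norm z)\<^sup>2" if "z \<in> F" for z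
      unfolding G_def by (rule leI, rule good[OF nB(4) that])
    have c5: "\<bar>(l2_norm (G\<^sup>T *\<^sub>v z))\<^sup>2 - real m * (l2_norm z)\<^sup>2\<bar>
        \<le> 14 * sqrt (real m * ln (real n)) * (l2_norm z)\<^sup>2" if "z \<in> T5" for z
      unfolding G_def by (rule leI, rule good[OF nB(5) that])
    have s20: "sqrt 20 \<le> 14 / 3" by (rule real_le_lsqrt) (auto simp: power2_eq_square)
    have root: "x \<le> sqrt (20 * y) * z" if "x\<^sup>2 \<le> 20 * y * z\<^sup>2" "0 \<le> z" for x y z :: real
    proof -
      have "x \<le> sqrt (20 * y * z\<^sup>2)" using that(1) by (rule real_le_rsqrt)
      thus ?thesis using that(2) by (simp add: real_sqrt_mult)
    qed
    have b14: "3 * sqrt (20 * real l) \<le> 14 * sqrt (real l)" for l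
      using mult_right_mono[OF s20, of "sqrt (real l)"] by (simp add: real_sqrt_mult)
    have op: "norm_bound (G\<^sup>T) (14 * sqrt (real n))"
      by (rule norm_bound_mono[OF norm_bound_net[OF Gt N1(2,4) _ root[OF c1]] b14]) auto
    have GU: "G\<^sup>T * U \<in> carrier_mat m k" using Gt U by auto
    have GUv: "(G\<^sup>T * U) *\<^sub>v v = G\<^sup>T *\<^sub>v (U *\<^sub>v v)" if "v \<in> carrier_vec k" for v
      using Gt U(1) that by (rule assoc_mult_mat_vec)
    have op1: "norm_bound (G\<^sup>T * U) (14 * sqrt (real m))"
    proof (rule norm_bound_mono[OF norm_bound_net[OF GU N2(2,4)] b14])
      fix z assume z: "z \<in> N2"
      hence zc: "z \<in> carrier_vec k" using N2(2) by auto
      show "l2_norm ((G\<^sup>T * U) *\<^sub>v z) \<le> sqrt (20 * real m) * l2_norm z"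
        using root[OF c2[of "U *\<^sub>v z"]] z GUv[OF zc] nU[OF zc] by auto
    qed auto
    have sb: "?\<epsilon> / 4 * sqrt (real m) * l2_norm x \<le> l2_norm (G\<^sup>T *\<^sub>v (U *\<^sub>v x))"
      if x: "x \<in> carrier_vec k" for x
    proof -
      have "(?\<epsilon> * sqrt (real m) / 2 - 14 * sqrt (real m) * (?\<epsilon> / 56)) * l2_norm x
          \<le> l2_norm ((G\<^sup>T * U) *\<^sub>v x)"
      proof (rule lower_bound_net[OF GU N3(2) _ N3(4) op1 _ _ _ x])
        fix z assume z: "z \<in> N3"
        hence zc: "z \<in> carrier_vec k" using N3(2) by auto
        have "(?\<epsilon> * sqrt (real m) * l2_norm z)\<^sup>2 \<le> (l2_norm ((G\<^sup>T * U) *\<^sub>v z))\<^sup>2"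
          using c3[of "U *\<^sub>v z"] z GUv[OF zc] nU[OF zc] by (simp add: power_mult_distrib)
        thus "?\<epsilon> * sqrt (real m) * l2_norm z \<le> l2_norm ((G\<^sup>T * U) *\<^sub>v z)"
          by (rule power2_le_imp_le) simp
      qed (use \<epsilon> in auto)
      moreover have "?\<epsilon> * sqrt (real m) / 2 - 14 * sqrt (real m) * (?\<epsilon> / 56) = ?\<epsilon> / 4 * sqrt (real m)"
        by simp
      ultimately show ?thesis using GUv[OF x] by simp
    qed
    have row: "l2_norm (G\<^sup>T *\<^sub>v y) \<le> 5 * sqrt (real m)" if y: "y \<in> F" for y
    proof -
      have "l2_norm (G\<^sup>T *\<^sub>v y) \<le> sqrt (20 * real m) * l2_norm y"
        by (rule root[OF c4[OF y]]) simp
      also have "\<dots> \<le> sqrt (20 * real m) * 1" using Fy[OF y] by (intro mult_left_mono) auto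
      also have "\<dots> \<le> 5 * sqrt (real m)"
        using mult_right_mono[of "sqrt 20" 5 "sqrt (real m)"] s20 by (simp add: real_sqrt_mult)
      finally show ?thesis .
    qed
    have cross: "l2_norm (U\<^sup>T *\<^sub>v (G *\<^sub>v (G\<^sup>T *\<^sub>v y))) \<le> sqrt (real k) * (14 * sqrt (real m * ln (real n)))"
      if y: "y \<in> F" for y
    proof -
      let ?t = "14 * sqrt (real m * ln (real n))"
      have yc: "y \<in> carrier_vec n" using y F(2) by auto
      let ?h = "G\<^sup>T *\<^sub>v y"
      let ?q = "U\<^sup>T *\<^sub>v (G *\<^sub>v ?h)"
      have h: "?h \<in> carrier_vec m" using Gt yc by (rule mult_mat_vec_carrier)
      have Gh: "G *\<^sub>v ?h \<in> carrier_vec n" using G h by (rule mult_mat_vec_carrier)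
      have Ut: "U\<^sup>T \<in> carrier_mat k n" using U(1) by auto
      have qc: "?q \<in> carrier_vec k" using Ut Gh by (rule mult_mat_vec_carrier)
      have entry: "\<bar>?q $ a\<bar> \<le> ?t" if a: "a < k" for a
      proof -
        let ?e = "unit_vec k a :: real vec"
        let ?x = "U *\<^sub>v ?e"
        have "?q $ a = ?e \<bullet> ?q" using a qc by (simp add: scalar_prod_left_unit)
        also have "\<dots> = ?x \<bullet> (G *\<^sub>v ?h)"
          using scalar_prod_mult_mat_vec[OF Ut _ Gh, of ?e] by simp
        also have "\<dots> = (G\<^sup>T *\<^sub>v ?x) \<bullet> ?h"
          by (rule scalar_prod_mult_mat_vec[OF G Uv h])
        finally have eq: "?q $ a = (G\<^sup>T *\<^sub>v ?x) \<bullet> ?h" .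
        have x1: "l2_norm ?x = 1" using nU[of ?e] a by (simp add: l2_norm_def)
        have xy: "?x \<bullet> y = 0"
          using scalar_prod_mult_mat_vec[OF Ut _ yc, of ?e] Fy[OF y] by simp
        show ?thesis unfolding eq
        proof (rule polarization_bound[OF G Uv yc x1 _ xy])
          fix z assume "z \<in> {?x + y, ?x - y}"
          hence "z \<in> T5" using a y unfolding T5_def by auto
          thus "\<bar>(l2_norm (G\<^sup>T *\<^sub>v z))\<^sup>2 - real m * (l2_norm z)\<^sup>2\<bar> \<le> ?t * (l2_norm z)\<^sup>2" by (rule c5)
        qed (use Fy[OF y] L in auto)
      qed
      have "(l2_norm ?q)\<^sup>2 = (\<Sum>a<k. (?q $ a)\<^sup>2)" by (rule l2_norm_square_sum[OF qc])
      also have "\<dots> \<le> (\<Sum>a<k. ?t\<^sup>2)"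
      proof (intro sum_mono)
        fix a assume "a \<in> {..<k}"
        thus "(?q $ a)\<^sup>2 \<le> ?t\<^sup>2" using power_mono[OF entry, of a 2] by simp
      qed
      also have "\<dots> = (sqrt (real k) * ?t)\<^sup>2" by (simp add: power_mult_distrib)
      finally have "(l2_norm ?q)\<^sup>2 \<le> (sqrt (real k) * ?t)\<^sup>2" .
      moreover have "0 \<le> real m * ln (real n)" using L(1) by simp
      hence "0 \<le> sqrt (real k) * ?t" by simp
      ultimately show ?thesis by (rule power2_le_imp_le)
    qed
    show "let G = Matrix.mat n m \<omega> in
        (\<forall>z \<in> carrier_vec n. l2_norm (G\<^sup>T *\<^sub>v z) \<le> 14 * sqrt (real n) * l2_norm z) \<and>
        (\<forall>x \<in> carrier_vec k. ?\<epsilon> / 4 * sqrt (real m) * l2_norm x \<le> l2_norm (G\<^sup>T *\<^sub>v (U *\<^sub>v x))) \<and>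
        (\<forall>y \<in> F. l2_norm (G\<^sup>T *\<^sub>v y) \<le> 5 * sqrt (real m) \<and>
          l2_norm (U\<^sup>T *\<^sub>v (G *\<^sub>v (G\<^sup>T *\<^sub>v y))) \<le> sqrt (real k) * (14 * sqrt (real m * ln (real n))))"
      unfolding Let_def G_def[symmetric]
      by (intro conjI ballI; (rule norm_boundD[OF op Gt] | rule sb | rule row | rule cross); assumption)
  qed
qed

section \<open>Error bounds for randomized SVD\<close>

definition noise_ratio :: "rsvd_problem \<Rightarrow> real" where
  "noise_ratio p = 2 * noise_level p / sigma_min p"

lemma threshold_consequence:
  fixes X L \<alpha> \<beta> \<Delta> g :: real
  assumes L: "0 < L" and X: "0 < X" and \<alpha>: "1 \<le> \<alpha>" and \<alpha>\<beta>: "\<alpha> * \<beta> = q"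
    and g: "\<beta> + ln X / (\<alpha> * L) + \<Delta> \<le> g"
  shows "exp (- L) powr (\<alpha> * g) * X \<le> exp (- L) powr (q + \<alpha> * \<Delta>)"
proof -
  have aL: "0 < \<alpha> * L" using L \<alpha> by simp
  have "ln X / (\<alpha> * L) \<le> g - \<beta> - \<Delta>" using g by simp
  hence "ln X \<le> (g - \<beta> - \<Delta>) * (\<alpha> * L)" using aL by (simp add: pos_divide_le_eq)
  hence "- L * (\<alpha> * g) + ln X \<le> - L * (q + \<alpha> * \<Delta>)" using \<alpha>\<beta>[symmetric] by (simp add: algebra_simps)
  hence "exp (- L * (\<alpha> * g) + ln X) \<le> exp (- L * (q + \<alpha> * \<Delta>))" by simp
  moreover have "exp (- L * (\<alpha> * g) + ln X) = exp (- L * (\<alpha> * g)) * X" unfolding exp_add using X by simp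
  moreover have "exp (- L) powr y = exp (- L * y)" for y by (simp add: powr_def mult.commute)
  ultimately show ?thesis by (simp only:)
qed

lemma error_terms_bound:
  fixes x n k m l u w \<gamma> :: real
  assumes x: "0 \<le> x" and pos: "0 < n" "0 \<le> k" "0 < m" "0 \<le> l" and \<gamma>: "0 < \<gamma>" "\<gamma> \<le> 1"
    and h: "x * sqrt (k * l / m) \<le> w" "x ^ 3 * (n / m) \<le> w" "u * x\<^sup>2 * (n / m) \<le> w"
  defines "\<tau> \<equiv> x * (14 * sqrt n) / (\<gamma> * sqrt m)"
  defines "\<rho> \<equiv> x * (sqrt k * (14 * sqrt (m * l)) / (\<gamma> * sqrt m) + \<tau>\<^sup>2 * (5 * sqrt m)) / (\<gamma> * sqrt m)"
  shows "4 * \<tau>\<^sup>2 * (2 * u) \<le> 1568 / \<gamma> ^ 3 * w" "\<rho> \<le> 994 / \<gamma> ^ 3 * w"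
proof -
  have sm: "0 < sqrt m" "sqrt m * sqrt m = m" using pos by auto
  have w0: "0 \<le> w" using h(1) x pos by (meson divide_nonneg_pos mult_nonneg_nonneg order.trans real_sqrt_ge_zero)
  have g3: "1 / \<gamma>\<^sup>2 \<le> 1 / \<gamma> ^ 3" using \<gamma> by (intro divide_left_mono power_decreasing) auto
  have \<tau>2: "\<tau>\<^sup>2 = 196 / \<gamma>\<^sup>2 * (x\<^sup>2 * (n / m))"
    using pos by (simp add: \<tau>_def power_mult_distrib power_divide)
  have "4 * \<tau>\<^sup>2 * (2 * u) = 1568 / \<gamma>\<^sup>2 * (u * x\<^sup>2 * (n / m))" by (simp add: \<tau>2)
  also have "\<dots> \<le> 1568 / \<gamma>\<^sup>2 * w" using h(3) by (intro mult_left_mono) auto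
  also have "\<dots> \<le> 1568 / \<gamma> ^ 3 * w" using g3 w0 by (intro mult_right_mono) auto
  finally show "4 * \<tau>\<^sup>2 * (2 * u) \<le> 1568 / \<gamma> ^ 3 * w" .
  have a: "x * (sqrt k * (14 * sqrt (m * l)) / (\<gamma> * sqrt m)) / (\<gamma> * sqrt m) = 14 / \<gamma>\<^sup>2 * (x * sqrt (k * l / m))"
    using sm \<gamma> by (simp add: real_sqrt_mult real_sqrt_divide power2_eq_square ac_simps)
  have b: "x * (\<tau>\<^sup>2 * (5 * sqrt m)) / (\<gamma> * sqrt m) = 980 / \<gamma> ^ 3 * (x ^ 3 * (n / m))"
    unfolding \<tau>2 using sm \<gamma> by (simp add: power2_eq_square power3_eq_cube ac_simps)
  have "\<rho> = 14 / \<gamma>\<^sup>2 * (x * sqrt (k * l / m)) + 980 / \<gamma> ^ 3 * (x ^ 3 * (n / m))"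
    unfolding \<rho>_def a[symmetric] b[symmetric] by (simp add: distrib_left add_divide_distrib)
  also have "\<dots> \<le> 14 / \<gamma>\<^sup>2 * w + 980 / \<gamma> ^ 3 * w"
    using h \<gamma> by (intro add_mono mult_left_mono) auto
  also have "\<dots> \<le> 14 / \<gamma> ^ 3 * w + 980 / \<gamma> ^ 3 * w"
    using g3 w0 by (intro add_mono mult_right_mono) auto
  also have "\<dots> = 994 / \<gamma> ^ 3 * w" by (simp add: add_divide_distrib algebra_simps)
  finally show "\<rho> \<le> 994 / \<gamma> ^ 3 * w" .
qed

lemma lowrank_error_bound:
  fixes t R \<rho> K w \<sigma>1 \<sigma> e u \<eta> :: real
  assumes "R \<le> K * w" "t \<le> K * w" "\<rho> \<le> K * w" "0 \<le> K" "0 \<le> w" "w \<le> u" "0 < u" "0 \<le> e" "2 * e \<le> \<sigma>" "\<sigma> \<le> \<sigma>1"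
    and "0 \<le> \<eta>" "\<eta> \<le> \<sigma>1 + e" "0 \<le> R" "0 \<le> \<rho>"
  shows "(R + t) * (\<eta> * (2 * u)) + (2 * u + R) * (e * \<rho>) \<le> (8 * K + (2 + K) * K / 2) * (\<sigma>1 * u * w)"
proof -
  have s1: "0 \<le> \<sigma>1" using assms by linarith
  have Kw: "0 \<le> K * w" using assms by simp
  have "(R + t) * (\<eta> * (2 * u)) \<le> (2 * (K * w)) * ((2 * \<sigma>1) * (2 * u))"
    using assms s1 by (intro mult_mono) auto
  moreover have "(2 * u + R) * (e * \<rho>) \<le> ((2 + K) * u) * ((\<sigma>1 / 2) * (K * w))"
  proof (rule order.trans)
    have "R \<le> K * u" using assms mult_left_mono[of w u K] by linarith
    thus "(2 * u + R) * (e * \<rho>) \<le> ((2 + K) * u) * (e * (K * w))"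
      using assms by (intro mult_mono mult_left_mono) (auto simp: algebra_simps)
    show "((2 + K) * u) * (e * (K * w)) \<le> ((2 + K) * u) * ((\<sigma>1 / 2) * (K * w))"
      using assms Kw by (intro mult_left_mono mult_right_mono) auto
  qed
  moreover have "(2 * (K * w)) * ((2 * \<sigma>1) * (2 * u)) + ((2 + K) * u) * ((\<sigma>1 / 2) * (K * w))
      = (8 * K + (2 + K) * K / 2) * (\<sigma>1 * u * w)" by (simp add: field_simps)
  ultimately show ?thesis by linarith
qed

lemma valid_problem_facts:
  assumes valid: "valid_problem c p" and c: "0 < c" "c < 1"
  shows "4 \<le> dim_n p" "1 \<le> ln (real (dim_n p))" "1 \<le> rank_k p" "rank_k p \<le> dim_n p"
    "real (rank_k p) \<le> (1 - c) * real (sketch_k p)" "6 * ln (real (dim_n p)) \<le> real (sketch_k p)"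
    "sketch_k p \<le> dim_n p" "0 < sketch_k p" "sigma_min p \<le> sigma p 1"
proof -
  let ?n = "real (dim_n p)" and ?k = "real (rank_k p)" and ?m = "real (sketch_k p)"
  have M: "signal p \<in> carrier_mat (dim_n p) (dim_n p)" and sv: "leading_left_sv (rank_k p) (signal p) (U_signal p)"
    and svs: "singular_values (signal p) (sigma p)"
    and k: "1 \<le> rank_k p" and m: "sketch_k p \<le> dim_n p"
    and sk: "(?k + sqrt (24 * ?k * ln ?n) + 6 * ln ?n) / (1 - c)\<^sup>2 \<le> ?m"
    using valid by (auto simp: valid_problem_def)
  show "1 \<le> rank_k p" "sketch_k p \<le> dim_n p" by (rule k, rule m)
  show kn: "rank_k p \<le> dim_n p" using leading_left_sv_orthonormal(3)[OF sv M] .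
  from svs obtain U V where svd: "is_svd (signal p) U (sigma p) V" by (auto simp: singular_values_def)
  show "sigma_min p \<le> sigma p 1"
    unfolding sigma_min_def using k kn by (intro is_svd_antimono[OF svd M]) auto
  have n1: "1 \<le> dim_n p" using k kn by simp
  have l0: "0 \<le> ln ?n" using n1 by simp
  have c2: "0 < (1 - c)\<^sup>2" "(1 - c)\<^sup>2 \<le> 1 - c"
    using c mult_left_mono[of "1 - c" 1 "1 - c"] by (auto simp: power2_eq_square)
  have tot: "?k + sqrt (24 * ?k * ln ?n) + 6 * ln ?n \<le> (1 - c)\<^sup>2 * ?m"
    using sk c2(1) by (simp add: divide_le_eq mult.commute)
  have sq: "0 \<le> sqrt (24 * ?k * ln ?n)" using l0 by simp
  have le: "(1 - c)\<^sup>2 * ?m \<le> (1 - c) * ?m" using c2 by (intro mult_right_mono) auto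
  show kc: "?k \<le> (1 - c) * ?m" using tot sq l0 le by linarith
  have cm: "(1 - c) * ?m \<le> ?m" using c mult_right_mono[of "1 - c" 1 ?m] by simp
  show L: "6 * ln ?n \<le> ?m" using tot sq le cm by linarith
  show m0: "0 < sketch_k p"
  proof (rule ccontr)
    assume "\<not> 0 < sketch_k p"
    hence "?k \<le> 0" using kc by simp
    thus False using k by simp
  qed
  have "(1 - c) * ?m < ?m" using c m0 by (simp add: algebra_simps)
  hence "?k < ?m" using kc by linarith
  hence n2: "2 \<le> dim_n p" using k m by simp
  have "ln 2 \<le> ln ?n" using n2 by simp
  hence "2/3 \<le> ln ?n" using ln2_ge_two_thirds by linarith
  hence "4 \<le> ?m" using L by linarith
  thus n4: "4 \<le> dim_n p" using m by linarith
  have "ln (4 :: real) = 2 * ln 2" using ln_realpow[of 2 2] by simp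
  moreover have "ln 4 \<le> ln ?n" using n4 by simp
  ultimately show "1 \<le> ln ?n" using ln2_ge_two_thirds by linarith
qed

lemma threshold_bounds:
  assumes valid: "valid_problem c p" and c: "0 < c" "c < 1" and \<Delta>: "0 \<le> \<Delta>" and g: "g_star p + \<Delta> \<le> real g"
    and u: "0 < norm_2inf (U_signal p)"
  defines "x \<equiv> noise_ratio p ^ g" and "n \<equiv> real (dim_n p)" and "k \<equiv> real (rank_k p)" and "m \<equiv> real (sketch_k p)"
  defines "w \<equiv> noise_ratio p powr (1 + \<Delta>) / sqrt n"
  shows "x * sqrt (k * ln n / m) \<le> w" "x ^ 3 * (n / m) \<le> w" "norm_2inf (U_signal p) * x\<^sup>2 * (n / m) \<le> w"
proof -
  note f = valid_problem_facts[OF valid c]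
  let ?u = "norm_2inf (U_signal p)" and ?r = "noise_ratio p"
  define L where "L = ln (1 / 2 * sigma_min p / noise_level p)"
  have E: "0 < noise_level p" "2 * noise_level p < sigma_min p" using valid by (auto simp: valid_problem_def)
  have L0: "0 < L" unfolding L_def using E by (subst ln_gt_zero_iff) (auto simp: field_simps)
  have r: "?r = exp (- L)" unfolding L_def noise_ratio_def exp_minus using E by simp
  have r0: "0 < ?r" by (simp add: r)
  have n: "4 \<le> n" and l: "1 \<le> ln n" and k: "1 \<le> k" and m: "0 < m" using f by (auto simp: n_def k_def m_def)
  have n32: "n powr (3/2) = n * sqrt n"
    using n powr_add[of n 1 "1/2"] by (simp add: powr_half_sqrt)
  have gs: "1 + (ln (n * k / m) + ln (ln n)) / (2 * L) + \<Delta> \<le> real g"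
    "1 / 3 + (ln (n powr (3 / 2) / m) + 1 / 2 * ln (ln n)) / (3 * L) + \<Delta> \<le> real g"
    "1 / 2 + ln (n powr (3 / 2) * ?u / m) / (2 * L) + \<Delta> \<le> real g"
    using g unfolding g_star_def Let_def L_def[symmetric] n_def[symmetric] k_def[symmetric] m_def[symmetric] by linarith+
  have pw: "?r powr (a * real g) = x powr a" for a
  proof -
    have "?r powr (a * real g) = (?r powr real g) powr a" by (simp add: powr_powr mult.commute)
    thus ?thesis using r0 by (simp add: powr_realpow x_def)
  qed
  have x0: "0 < x" using r0 by (simp add: x_def)
  have sn: "0 < sqrt n" "sqrt n * sqrt n = n" using n by auto
  have "ln (n * k / m) + ln (ln n) = ln (n * k / m * ln n)"
    using n k m l by (intro ln_mult_pos[symmetric]) auto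
  hence "?r powr (2 * real g) * (n * k / m * ln n) \<le> ?r powr (2 + 2 * \<Delta>)"
    unfolding r using n k m l gs(1) by (intro threshold_consequence[OF L0, of _ 2 1]) auto
  hence h1: "x\<^sup>2 * (n * k / m * ln n) \<le> ?r powr (2 + 2 * \<Delta>)" unfolding pw using x0 by simp
  have w2: "w\<^sup>2 = ?r powr (2 + 2 * \<Delta>) / n"
  proof -
    have "(?r powr (1 + \<Delta>))\<^sup>2 = ?r powr (1 + \<Delta>) * ?r powr (1 + \<Delta>)" by (simp add: power2_eq_square)
    also have "\<dots> = ?r powr (2 + 2 * \<Delta>)" unfolding powr_add[symmetric] by (simp add: algebra_simps)
    finally show ?thesis using n by (simp add: w_def power_divide)
  qed
  have w0: "0 \<le> w" using n by (simp add: w_def)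
  show "x * sqrt (k * ln n / m) \<le> w"
  proof (rule power2_le_imp_le[OF _ w0])
    have "(x * sqrt (k * ln n / m))\<^sup>2 = x\<^sup>2 * (n * k / m * ln n) / n"
      using n k m l by (simp add: power_mult_distrib)
    also have "\<dots> \<le> w\<^sup>2" unfolding w2 using h1 n by (intro divide_right_mono) auto
    finally show "(x * sqrt (k * ln n / m))\<^sup>2 \<le> w\<^sup>2" .
  qed
  have rm: "?r powr (1 + a * \<Delta>) \<le> ?r powr (1 + \<Delta>)" if "1 \<le> a" for a
    using mult_right_mono[OF that \<Delta>] L0 r0 by (intro powr_mono') (auto simp: r)
  have "ln (n powr (3/2) / m) + 1/2 * ln (ln n) = ln (n powr (3/2) / m * sqrt (ln n))"
  proof -
    have "ln (n powr (3/2) / m * sqrt (ln n)) = ln (n powr (3/2) / m) + ln (sqrt (ln n))"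
      using n m l by (intro ln_mult_pos) auto
    thus ?thesis using l by (simp add: ln_sqrt)
  qed
  hence "?r powr (3 * real g) * (n powr (3/2) / m * sqrt (ln n)) \<le> ?r powr (1 + 3 * \<Delta>)"
    unfolding r using n m l gs(2) by (intro threshold_consequence[OF L0, of _ 3 "1/3"]) auto
  hence h2: "x ^ 3 * (n * sqrt n / m * sqrt (ln n)) \<le> ?r powr (1 + \<Delta>)"
    unfolding pw n32 using x0 rm[of 3] by simp
  have "x ^ 3 * (n * sqrt n / m * 1) \<le> x ^ 3 * (n * sqrt n / m * sqrt (ln n))"
    using x0 n m l by (intro mult_left_mono) auto
  hence "x ^ 3 * (n / m) * sqrt n \<le> ?r powr (1 + \<Delta>)" using h2 by (simp add: ac_simps)
  thus "x ^ 3 * (n / m) \<le> w" unfolding w_def using sn by (simp add: pos_le_divide_eq)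
  have "?r powr (2 * real g) * (n powr (3/2) * ?u / m) \<le> ?r powr (1 + 2 * \<Delta>)"
    unfolding r using n m u gs(3) by (intro threshold_consequence[OF L0, of _ 2 "1/2"]) auto
  hence "x\<^sup>2 * (n * sqrt n * ?u / m) \<le> ?r powr (1 + \<Delta>)"
    unfolding pw n32 using x0 rm[of 2] by simp
  hence "?u * x\<^sup>2 * (n / m) * sqrt n \<le> ?r powr (1 + \<Delta>)" by (simp add: ac_simps)
  thus "?u * x\<^sup>2 * (n / m) \<le> w" unfolding w_def using sn by (simp add: pos_le_divide_eq)
qed

text \<open>For \<open>\<Delta> = 0\<close> these are the bounds (i) and (ii); for \<open>\<Delta> > 0\<close> the additional factor
  \<open>noise_ratio p powr \<Delta>\<close> yields (iii).\<close>

lemma sketch_bounds: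
  assumes c: "0 < c" "c < 1" and valid: "valid_problem c p" and \<Delta>: "0 \<le> \<Delta>" and g: "g_star p + \<Delta> \<le> real g"
  defines "K \<equiv> 2562 / (small_ball_level c / 4) ^ 3"
  shows "subspace_bound p g (2 * K * noise_ratio p powr \<Delta> * subspace_rate p)"
    and "lowrank_bound p g ((16 * K + (2 + K) * K) * noise_ratio p powr \<Delta> * lowrank_rate p)"
proof -
  define n where "n = dim_n p"
  define k where "k = rank_k p"
  define m where "m = sketch_k p"
  define H where "H = observed p"
  define Uh where "Uh = U_hat p"
  define U where "U = U_signal p"
  define e where "e = noise_level p"
  define \<sigma> where "\<sigma> = sigma_min p"
  define u where "u = norm_2inf U"
  define \<gamma> where "\<gamma> = small_ball_level c / 4"
  note f = valid_problem_facts[OF valid c, folded n_def k_def m_def \<sigma>_def]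
  have M: "signal p \<in> carrier_mat n n" and E: "noise p \<in> carrier_mat n n" and H_def': "H = signal p + noise p"
    and sym: "H\<^sup>T = H" and rank: "vec_space.rank n (signal p) = k"
    and svs: "singular_values (signal p) (sigma p)"
    and lU: "leading_left_sv k (signal p) U" and lUh: "leading_left_sv k H Uh"
    and e: "0 < e" "2 * e < \<sigma>" and dU: "d_2inf Uh U \<le> u"
    using valid by (auto simp: valid_problem_def n_def k_def H_def Uh_def U_def e_def \<sigma>_def u_def observed_def)
  have Hc: "H \<in> carrier_mat n n" using M E by (simp add: H_def')
  have Uc: "U \<in> carrier_mat n k" "orthonormal_cols U" by (rule leading_left_sv_orthonormal[OF lU M])+
  have Uhc: "Uh \<in> carrier_mat n k" "orthonormal_cols Uh" by (rule leading_left_sv_orthonormal[OF lUh Hc])+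
  have n0: "0 < n" and n2: "2 \<le> n" using f(1) by auto
  have uu: "1 \<le> u * sqrt (real n)" "u \<le> 1" unfolding u_def by (rule norm_2inf_orthonormal_bounds[OF Uc f(3) n0])+
  have sn: "0 < sqrt (real n)" using n0 by simp
  have u0: "0 < u" using uu(1) sn by (smt (verit) zero_less_mult_pos2)
  have \<sigma>k: "sigma p k = \<sigma>" by (simp add: \<sigma>_def sigma_min_def k_def)
  have eb: "norm_bound (noise p) e" unfolding e_def noise_level_def by (rule norm_bound_spectral_norm)
  have sp: "spectral_split n k H Uh (\<sigma> / 2) e" and nH: "norm_bound H (sigma p 1 + e)"
    using perturbed_spectral_split[OF M E _ rank f(3) svs _ eb, folded H_def', OF sym lUh] e \<sigma>k by auto
  have rowU: "l2_norm (Uh\<^sup>T *\<^sub>v unit_vec n i) \<le> 2 * u" if "i < n" for i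
    using row_norm_le_d_2inf[OF Uhc(1) Uc(1) that] dU unfolding u_def by linarith
  define v where "v i = unit_vec n i - Uh *\<^sub>v (Uh\<^sup>T *\<^sub>v unit_vec n i)" for i
  have ec: "unit_vec n i \<in> carrier_vec n" for i :: nat by simp
  note dv = orthonormal_decompose[OF Uhc ec, folded v_def]
  have v1: "l2_norm (v i) \<le> 1" if "i < n" for i
    using dv(4)[of i] that by (simp add: l2_norm_def)
  have Hg: "H ^\<^sub>m g \<in> carrier_mat n n" using Hc by auto
  have Hv: "H *\<^sub>v v i \<in> carrier_vec n" "Uh\<^sup>T *\<^sub>v (H *\<^sub>v v i) = 0\<^sub>v k"
    "l2_norm (H *\<^sub>v v i) \<le> e * l2_norm (v i)" for i
    using sp dv(1,2)[of i] Hc by (auto simp: spectral_split_def)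
  define z1 where "z1 i = H ^\<^sub>m g *\<^sub>v v i" for i
  define z2 where "z2 i = H ^\<^sub>m g *\<^sub>v (H *\<^sub>v v i)" for i
  have z1: "z1 i \<in> carrier_vec n" "Uh\<^sup>T *\<^sub>v z1 i = 0\<^sub>v k" "i < n \<Longrightarrow> l2_norm (z1 i) \<le> e ^ g" for i
  proof -
    show "z1 i \<in> carrier_vec n" unfolding z1_def using Hg dv(1) by (rule mult_mat_vec_carrier)
    note c = spectral_split_power_complement[OF sp dv(1,2)[of i], of g, folded z1_def]
    show "Uh\<^sup>T *\<^sub>v z1 i = 0\<^sub>v k" using c by simp
    assume "i < n"
    hence "e ^ g * l2_norm (v i) \<le> e ^ g * 1" using v1 e by (intro mult_left_mono) auto
    thus "l2_norm (z1 i) \<le> e ^ g" using c by simp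
  qed
  have z2: "z2 i \<in> carrier_vec n" "Uh\<^sup>T *\<^sub>v z2 i = 0\<^sub>v k" "i < n \<Longrightarrow> l2_norm (z2 i) \<le> e * e ^ g" for i
  proof -
    show "z2 i \<in> carrier_vec n" unfolding z2_def using Hg Hv(1) by (rule mult_mat_vec_carrier)
    note c = spectral_split_power_complement[OF sp Hv(1,2)[of i], of g, folded z2_def]
    show "Uh\<^sup>T *\<^sub>v z2 i = 0\<^sub>v k" using c by simp
    assume i: "i < n"
    have "e * l2_norm (v i) \<le> e * 1" using v1[OF i] e by (intro mult_left_mono) auto
    hence "l2_norm (H *\<^sub>v v i) \<le> e" using Hv(3)[of i] by simp
    hence "e ^ g * l2_norm (H *\<^sub>v v i) \<le> e ^ g * e" using e by (intro mult_left_mono) auto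
    thus "l2_norm (z2 i) \<le> e * e ^ g" using c by (simp add: mult.commute)
  qed
  define F where "F = (\<lambda>i. (1 / e ^ g) \<cdot>\<^sub>v z1 i) ` {..<n} \<union> (\<lambda>i. (1 / (e * e ^ g)) \<cdot>\<^sub>v z2 i) ` {..<n}"
  have F: "finite F" "F \<subseteq> carrier_vec n" "card F \<le> 2 * n"
  proof -
    show "finite F" by (simp add: F_def)
    show "F \<subseteq> carrier_vec n" using z1(1) z2(1) by (auto simp: F_def)
    have "card F \<le> card ((\<lambda>i. (1 / e ^ g) \<cdot>\<^sub>v z1 i) ` {..<n}) + card ((\<lambda>i. (1 / (e * e ^ g)) \<cdot>\<^sub>v z2 i) ` {..<n})"
      unfolding F_def by (rule card_Un_le)
    also have "\<dots> \<le> n + n" by (intro add_mono order.trans[OF card_image_le]) auto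
    finally show "card F \<le> 2 * n" by simp
  qed
  have Uht: "Uh\<^sup>T \<in> carrier_mat k n" using Uhc by auto
  have Fy: "Uh\<^sup>T *\<^sub>v y = 0\<^sub>v k \<and> l2_norm y \<le> 1" if y: "y \<in> F" for y
  proof -
    have sc: "Uh\<^sup>T *\<^sub>v ((1 / a) \<cdot>\<^sub>v z) = 0\<^sub>v k \<and> l2_norm ((1 / a) \<cdot>\<^sub>v z) \<le> 1"
      if "z \<in> carrier_vec n" "Uh\<^sup>T *\<^sub>v z = 0\<^sub>v k" "l2_norm z \<le> a" "0 < a" for z a
      unfolding mult_mat_vec[OF Uht that(1)] that(2) using that(3,4) by auto
    consider i where "i < n" "y = (1 / e ^ g) \<cdot>\<^sub>v z1 i" | i where "i < n" "y = (1 / (e * e ^ g)) \<cdot>\<^sub>v z2 i"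
      using y by (auto simp: F_def)
    thus ?thesis
    proof cases
      case 1
      thus ?thesis using sc[OF z1(1,2) z1(3)[OF 1(1)]] e by simp
    next
      case 2
      thus ?thesis using sc[OF z2(1,2) z2(3)[OF 2(1)]] e by simp
    qed
  qed
  define x where "x = noise_ratio p ^ g"
  define w where "w = noise_ratio p powr (1 + \<Delta>) / sqrt (real n)"
  have nr: "noise_ratio p = e / (\<sigma> / 2)" by (simp add: noise_ratio_def e_def \<sigma>_def)
  have r01: "0 < noise_ratio p" "noise_ratio p \<le> 1" using e by (auto simp: nr)
  have u0': "0 < norm_2inf (U_signal p)" using u0 by (simp add: u_def U_def)
  note th = threshold_bounds[OF valid c \<Delta> g u0', folded x_def n_def k_def m_def U_def u_def, folded w_def]
  have x0: "0 \<le> x" and w0: "0 \<le> w" using r01 by (auto simp: x_def w_def)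
  have \<gamma>: "0 < \<gamma>" "\<gamma> \<le> 1" using small_ball_level[OF c(1)] by (auto simp: \<gamma>_def)
  have K: "K = 2562 / \<gamma> ^ 3" by (simp add: K_def \<gamma>_def)
  have K0: "0 \<le> K" using \<gamma> by (simp add: K)
  have m0: "0 < sqrt (real m)" using f(8) by simp
  have xe: "e ^ g * y / ((\<sigma> / 2) ^ g * z) = x * y / z" for y z
    by (simp add: x_def nr power_divide)
  define \<tau> where "\<tau> = e ^ g * (14 * sqrt (real n)) / ((\<sigma> / 2) ^ g * (\<gamma> * sqrt (real m)))"
  define \<alpha> where "\<alpha> = e ^ g * (5 * sqrt (real m))"
  define \<beta> where "\<beta> = e ^ g * (sqrt (real k) * (14 * sqrt (real m * ln (real n))))"
  define \<rho> where "\<rho> = (\<beta> / (\<gamma> * sqrt (real m)) + \<tau>\<^sup>2 * \<alpha>) / ((\<sigma> / 2) ^ g * (\<gamma> * sqrt (real m)))"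
  define R where "R = 4 * \<tau>\<^sup>2 * (2 * u) + \<rho>"
  have \<tau>': "\<tau> = x * (14 * sqrt (real n)) / (\<gamma> * sqrt (real m))" unfolding \<tau>_def xe ..
  have "\<beta> / (\<gamma> * sqrt (real m)) + \<tau>\<^sup>2 * \<alpha> = e ^ g * (sqrt (real k) * (14 * sqrt (real m * ln (real n))) / (\<gamma> * sqrt (real m)) + \<tau>\<^sup>2 * (5 * sqrt (real m)))"
    by (simp add: \<alpha>_def \<beta>_def algebra_simps)
  hence \<rho>': "\<rho> = x * (sqrt (real k) * (14 * sqrt (real m * ln (real n))) / (\<gamma> * sqrt (real m)) + \<tau>\<^sup>2 * (5 * sqrt (real m))) / (\<gamma> * sqrt (real m))"
    unfolding \<rho>_def by (simp only: xe)
  have l0: "0 \<le> ln (real n)" using f(2) by simp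
  note et = error_terms_bound[OF x0 _ _ _ l0 \<gamma> th, folded \<tau>', folded \<rho>']
  have t: "4 * \<tau>\<^sup>2 * (2 * u) \<le> 1568 / \<gamma> ^ 3 * w" and \<rho>w: "\<rho> \<le> 994 / \<gamma> ^ 3 * w"
    using et n0 f(8) by auto
  have Kw: "1568 / \<gamma> ^ 3 * w + 994 / \<gamma> ^ 3 * w = K * w" by (simp add: K add_divide_distrib[symmetric] distrib_right[symmetric])
  have nn: "0 \<le> 1568 / \<gamma> ^ 3 * w" "0 \<le> 994 / \<gamma> ^ 3 * w" using \<gamma> w0 by auto
  have RK: "R \<le> K * w" and tK: "4 * \<tau>\<^sup>2 * (2 * u) \<le> K * w" and \<rho>K: "\<rho> \<le> K * w"
    using t \<rho>w Kw nn unfolding R_def by linarith+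
  have \<rho>0: "0 \<le> \<rho>" unfolding \<rho>' using x0 \<gamma> m0 l0 by simp
  have R0: "0 \<le> R" unfolding R_def using \<rho>0 u0 by simp
  have w_eq: "w = noise_ratio p powr \<Delta> * (2 * e / (\<sigma> * sqrt (real n)))"
  proof -
    have "noise_ratio p / sqrt (real n) = 2 * e / (\<sigma> * sqrt (real n))" by (simp add: nr)
    moreover have "w = noise_ratio p powr \<Delta> * (noise_ratio p / sqrt (real n))"
      using r01 by (simp add: w_def powr_add)
    ultimately show ?thesis by (simp only:)
  qed
  have n12: "real n powr (- 1 / 2) = 1 / sqrt (real n)"
    using n0 by (simp add: powr_minus_divide powr_half_sqrt)
  have sub: "K * w = 2 * K * noise_ratio p powr \<Delta> * subspace_rate p"
    unfolding w_eq subspace_rate_def n_def[symmetric] e_def[symmetric] \<sigma>_def[symmetric] n12 by (simp add: ac_simps)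
  have wu: "w \<le> u"
  proof -
    have "noise_ratio p powr (1 + \<Delta>) \<le> 1" using r01 \<Delta> by (simp add: powr_le1)
    hence "w \<le> 1 / sqrt (real n)" unfolding w_def using sn by (intro divide_right_mono) auto
    also have "\<dots> \<le> u" using uu(1) sn by (simp add: divide_le_eq)
    finally show ?thesis .
  qed
  have "(R + 4 * \<tau>\<^sup>2 * (2 * u)) * ((sigma p 1 + e) * (2 * u)) + (2 * u + R) * (e * \<rho>) \<le> (8 * K + (2 + K) * K / 2) * (sigma p 1 * u * w)"
    using e f(9) by (intro lowrank_error_bound[OF RK tK \<rho>K K0 w0 wu u0 _ _ f(9) _ _ R0 \<rho>0]) auto
  also have "\<dots> = (16 * K + (2 + K) * K) * noise_ratio p powr \<Delta> * lowrank_rate p"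
  proof -
    have "sigma p 1 * u * w = 2 * (noise_ratio p powr \<Delta> * lowrank_rate p)"
      unfolding w_eq lowrank_rate_def cond_number_def n_def[symmetric] e_def[symmetric] \<sigma>_def[symmetric] n12
        U_def[symmetric] u_def[symmetric] by (simp add: ac_simps)
    thus ?thesis by (simp add: algebra_simps)
  qed
  finally have low: "(R + 4 * \<tau>\<^sup>2 * (2 * u)) * ((sigma p 1 + e) * (2 * u)) + (2 * u + R) * (e * \<rho>)
    \<le> (16 * K + (2 + K) * K) * noise_ratio p powr \<Delta> * lowrank_rate p" .
  obtain S where S: "S \<in> sets (gaussian_entries n m)"
    "1 - 5 * real n powr (- 3) - 2 * exp (- real n / 2) \<le> measure (gaussian_entries n m) S"
    and good: "\<And>\<omega>. \<omega> \<in> S \<Longrightarrow> let G = Matrix.mat n m \<omega> in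
        (\<forall>z \<in> carrier_vec n. l2_norm (G\<^sup>T *\<^sub>v z) \<le> 14 * sqrt (real n) * l2_norm z) \<and>
        (\<forall>x \<in> carrier_vec k. small_ball_level c / 4 * sqrt (real m) * l2_norm x \<le> l2_norm (G\<^sup>T *\<^sub>v (Uh *\<^sub>v x))) \<and>
        (\<forall>y \<in> F. l2_norm (G\<^sup>T *\<^sub>v y) \<le> 5 * sqrt (real m) \<and>
          l2_norm (Uh\<^sup>T *\<^sub>v (G *\<^sub>v (G\<^sup>T *\<^sub>v y))) \<le> sqrt (real k) * (14 * sqrt (real m * ln (real n))))"
    using gaussian_good_event[OF c n2 f(7,3,5,6) Uhc F Fy] by blast
  have main: "d_2inf Q U \<le> d_2inf Uh U + 2 * K * noise_ratio p powr \<Delta> * subspace_rate p \<and>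
      norm_max (Q * Q\<^sup>T * H - signal p) \<le> norm_max (Uh * Uh\<^sup>T * H - signal p)
        + (16 * K + (2 + K) * K) * noise_ratio p powr \<Delta> * lowrank_rate p"
    if \<omega>: "\<omega> \<in> S" and Q: "rsvd_output H k g (Matrix.mat n m \<omega>) Q" for \<omega> Q
  proof -
    define G where "G = Matrix.mat n m \<omega>"
    have G: "G \<in> carrier_mat n m" by (simp add: G_def)
    have Gt: "G\<^sup>T \<in> carrier_mat m n" using G by auto
    have op: "l2_norm (G\<^sup>T *\<^sub>v z) \<le> 14 * sqrt (real n) * l2_norm z" if "z \<in> carrier_vec n" for z
      using good[OF \<omega>] that unfolding Let_def G_def[symmetric] by blast
    have sb: "\<gamma> * sqrt (real m) * l2_norm x \<le> l2_norm (G\<^sup>T *\<^sub>v (Uh *\<^sub>v x))" if "x \<in> carrier_vec k" for x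
      using good[OF \<omega>] that unfolding Let_def G_def[symmetric] \<gamma>_def by blast
    have Fb: "l2_norm (G\<^sup>T *\<^sub>v y) \<le> 5 * sqrt (real m)"
      "l2_norm (Uh\<^sup>T *\<^sub>v (G *\<^sub>v (G\<^sup>T *\<^sub>v y))) \<le> sqrt (real k) * (14 * sqrt (real m * ln (real n)))"
      if "y \<in> F" for y
      using good[OF \<omega>] that unfolding Let_def G_def[symmetric] by blast+
    have scale: "l2_norm (G\<^sup>T *\<^sub>v z) \<le> a * (5 * sqrt (real m)) \<and>
        l2_norm (Uh\<^sup>T *\<^sub>v (G *\<^sub>v (G\<^sup>T *\<^sub>v z))) \<le> a * (sqrt (real k) * (14 * sqrt (real m * ln (real n))))"
      if z: "z \<in> carrier_vec n" and zF: "(1 / a) \<cdot>\<^sub>v z \<in> F" and a: "0 < a" for z a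
    proof -
      have Gz: "G\<^sup>T *\<^sub>v z \<in> carrier_vec m" using Gt z by (rule mult_mat_vec_carrier)
      have GGz: "G *\<^sub>v (G\<^sup>T *\<^sub>v z) \<in> carrier_vec n" using G Gz by (rule mult_mat_vec_carrier)
      show ?thesis using Fb[OF zF] a
        unfolding mult_mat_vec[OF Gt z] mult_mat_vec[OF G Gz] mult_mat_vec[OF Uht GGz] l2_norm_smult
        by (simp add: divide_le_eq mult.commute)
    qed
    have r1: "l2_norm (G\<^sup>T *\<^sub>v (H ^\<^sub>m g *\<^sub>v v i)) \<le> \<alpha>"
      "l2_norm (Uh\<^sup>T *\<^sub>v (G *\<^sub>v (G\<^sup>T *\<^sub>v (H ^\<^sub>m g *\<^sub>v v i)))) \<le> \<beta>" if "i < n" for i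
      using scale[OF z1(1)[of i], of "e ^ g"] that e unfolding z1_def[symmetric] \<alpha>_def \<beta>_def by (auto simp: F_def)
    have r2: "l2_norm (G\<^sup>T *\<^sub>v (H ^\<^sub>m g *\<^sub>v (H *\<^sub>v v i))) \<le> e * \<alpha>"
      "l2_norm (Uh\<^sup>T *\<^sub>v (G *\<^sub>v (G\<^sup>T *\<^sub>v (H ^\<^sub>m g *\<^sub>v (H *\<^sub>v v i))))) \<le> e * \<beta>" if "i < n" for i
      using scale[OF z2(1)[of i], of "e * e ^ g"] that e unfolding z2_def[symmetric] \<alpha>_def \<beta>_def by (auto simp: F_def mult.assoc)
    have sv: "leading_left_sv k (H ^\<^sub>m g * G) Q" using Q by (simp add: rsvd_output_def G_def)
    have b0: "0 < \<gamma> * sqrt (real m)" using \<gamma> m0 by simp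
    have a0: "0 \<le> 14 * sqrt (real n)" by simp
    have \<eta>0: "0 \<le> sigma p 1 + e" using e f(9) by linarith
    note se = sketch_error_bounds[OF sp f(3) n0 G sv a0 op b0 sb v_def r1 r2 rowU nH \<eta>0,
        folded \<tau>_def, folded \<rho>_def, folded R_def]
    have "d_2inf Q U \<le> d_2inf Uh U + R" by (rule se(1)[OF _ _ _ _ _ _ _ Uc(1)])
    moreover have "norm_max (Q * Q\<^sup>T * H - signal p)
      \<le> norm_max (Uh * Uh\<^sup>T * H - signal p) + ((R + 4 * \<tau>\<^sup>2 * (2 * u)) * ((sigma p 1 + e) * (2 * u)) + (2 * u + R) * (e * \<rho>))"
      by (rule se(2)[OF _ _ _ _ _ _ _ M])
    ultimately show ?thesis using RK sub low by linarith
  qed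
  show "subspace_bound p g (2 * K * noise_ratio p powr \<Delta> * subspace_rate p)"
    unfolding subspace_bound_def gaussian_prob_ge_def n_def[symmetric] m_def[symmetric] k_def[symmetric]
      H_def[symmetric] Uh_def[symmetric] U_def[symmetric]
    using S main by blast
  have "1 - 9 * real n powr (- 3) - 2 * exp (- real n / 2) \<le> measure (gaussian_entries n m) S"
    using S(2) powr_ge_zero[of "real n" "- 3"] by linarith
  thus "lowrank_bound p g ((16 * K + (2 + K) * K) * noise_ratio p powr \<Delta> * lowrank_rate p)"
    unfolding lowrank_bound_def gaussian_prob_ge_def n_def[symmetric] m_def[symmetric] k_def[symmetric]
      H_def[symmetric] Uh_def[symmetric] U_def[symmetric]
    using S(1) main by blast
qed

lemma subspace_bound_mono: "subspace_bound p g a \<Longrightarrow> a \<le> b \<Longrightarrow> subspace_bound p g b"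
  unfolding subspace_bound_def gaussian_prob_ge_def by (meson add_left_mono order.trans)

lemma valid_problem_rates_nonneg:
  assumes valid: "valid_problem c p" and c: "0 < c" "c < 1"
  shows "0 \<le> subspace_rate p" "0 \<le> lowrank_rate p" "0 < noise_ratio p" "noise_ratio p < 1"
proof -
  note f = valid_problem_facts[OF valid c]
  have E: "0 < noise_level p" "2 * noise_level p < sigma_min p" using valid by (auto simp: valid_problem_def)
  have M: "signal p \<in> carrier_mat (dim_n p) (dim_n p)" and lU: "leading_left_sv (rank_k p) (signal p) (U_signal p)"
    using valid by (auto simp: valid_problem_def)
  have u: "0 \<le> norm_2inf (U_signal p)"
    using f(1) by (intro norm_2inf_nonneg[OF leading_left_sv_orthonormal(1)[OF lU M]]) simp
  have cn: "0 \<le> cond_number p" unfolding cond_number_def using E f(9) by (intro divide_nonneg_nonneg) auto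
  show "0 \<le> subspace_rate p" unfolding subspace_rate_def using E by simp
  show "0 \<le> lowrank_rate p" unfolding lowrank_rate_def using cn E u by simp
  show "0 < noise_ratio p" "noise_ratio p < 1" unfolding noise_ratio_def using E by auto
qed

text \<open>Holds for every power \<open>g\<close> and every sketch; it only serves to cover the finitely many
  problems of a sequence which are below the asymptotic regime.\<close>

lemma crude_bounds:
  assumes valid: "valid_problem c p" and c: "0 < c" "c < 1"
  shows "\<exists>B. \<forall>g. subspace_bound p g B \<and> lowrank_bound p g B"
proof -
  define n where "n = dim_n p"
  define k where "k = rank_k p"
  define m where "m = sketch_k p"
  note f = valid_problem_facts[OF valid c, folded n_def k_def m_def]
  have M: "signal p \<in> carrier_mat n n" and E: "noise p \<in> carrier_mat n n"
    and lU: "leading_left_sv k (signal p) (U_signal p)" and lUh: "leading_left_sv k (observed p) (U_hat p)"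
    using valid by (auto simp: valid_problem_def n_def k_def)
  have H: "observed p \<in> carrier_mat n n" using M E by (simp add: observed_def)
  have U: "U_signal p \<in> carrier_mat n k" "orthonormal_cols (U_signal p)"
    by (rule leading_left_sv_orthonormal[OF lU M])+
  have Uh: "U_hat p \<in> carrier_mat n k" "orthonormal_cols (U_hat p)"
    by (rule leading_left_sv_orthonormal[OF lUh H])+
  have n: "0 < n" using f(1) by simp
  obtain \<eta> where \<eta>: "0 \<le> \<eta>" "norm_bound (observed p) \<eta>" using norm_bound_exists by auto
  have small: "l2_norm (Q\<^sup>T *\<^sub>v y) \<le> l2_norm y"
    if "Q \<in> carrier_mat n k" "orthonormal_cols Q" "y \<in> carrier_vec n" for Q y
    using norm_boundD[OF orthonormal_cols_norm_bound(2)[OF that(2)], of k n y] that by auto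
  have e1: "l2_norm (unit_vec n i :: real vec) = 1" if "i < n" for i
    using that by (simp add: l2_norm_def)
  have d: "d_2inf Q (U_signal p) \<le> d_2inf (U_hat p) (U_signal p) + 2"
    if Q: "Q \<in> carrier_mat n k" "orthonormal_cols Q" for Q
  proof -
    have "d_2inf Q (U_signal p) \<le> norm_2inf (Q - U_signal p * 1\<^sub>m k)"
      by (rule d_2inf_le[OF Q(1) U(1) n _ orthonormal_cols_one]) simp
    also have "\<dots> \<le> 2"
    proof (rule norm_2inf_le[OF _ n])
      show "Q - U_signal p * 1\<^sub>m k \<in> carrier_mat n k" using U by (intro minus_carrier_mat) auto
      fix i assume i: "i < n"
      let ?q = "Q\<^sup>T *\<^sub>v unit_vec n i" and ?u = "transpose_mat (U_signal p) *\<^sub>v unit_vec n i"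
      have qu: "?q \<in> carrier_vec k" "?u \<in> carrier_vec k"
        using Q U by (auto intro: transpose_mult_mat_vec_carrier)
      have "transpose_mat (Q - U_signal p * 1\<^sub>m k) *\<^sub>v unit_vec n i = ?q - ?u"
        using transpose_diff_mult_vec[OF Q(1) U(1) one_carrier_mat, of "unit_vec n i"] qu by simp
      thus "l2_norm (transpose_mat (Q - U_signal p * 1\<^sub>m k) *\<^sub>v unit_vec n i) \<le> 2"
        using l2_norm_triangle_diff[OF qu] small[OF Q, of "unit_vec n i"] small[OF U, of "unit_vec n i"] e1[OF i] by simp
    qed
    also have "0 \<le> d_2inf (U_hat p) (U_signal p)"
      using U n by (intro d_2inf_ge[OF Uh(1) U(1)] norm_2inf_nonneg[of _ n k] minus_carrier_mat) auto
    hence "2 \<le> d_2inf (U_hat p) (U_signal p) + 2" by simp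
    finally show ?thesis by simp
  qed
  have entry: "\<bar>(Q * Q\<^sup>T * observed p) $$ (i, j)\<bar> \<le> \<eta>"
    if Q: "Q \<in> carrier_mat n k" "orthonormal_cols Q" and ij: "i < n" "j < n" for Q i j
  proof -
    let ?q = "Q\<^sup>T *\<^sub>v unit_vec n i"
    have Hj: "observed p *\<^sub>v unit_vec n j \<in> carrier_vec n" using H by (rule mult_mat_vec_carrier) simp
    have "\<bar>(Q * Q\<^sup>T * observed p) $$ (i, j)\<bar>
        \<le> l2_norm ?q * l2_norm (Q\<^sup>T *\<^sub>v (observed p *\<^sub>v unit_vec n j))"
      unfolding projected_entry[OF Q(1) H ij]
      by (intro scalar_prod_le_l2_norm[of _ k] transpose_mult_mat_vec_carrier[OF Q(1)])
    also have "\<dots> \<le> 1 * \<eta>"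
    proof (rule mult_mono)
      show "l2_norm ?q \<le> 1" using small[OF Q, of "unit_vec n i"] e1[OF ij(1)] by simp
      show "l2_norm (Q\<^sup>T *\<^sub>v (observed p *\<^sub>v unit_vec n j)) \<le> \<eta>"
        using small[OF Q Hj] norm_boundD[OF \<eta>(2) H, of "unit_vec n j"] e1[OF ij(2)] by simp
    qed auto
    finally show ?thesis by simp
  qed
  have l: "norm_max (Q * Q\<^sup>T * observed p - signal p)
      \<le> norm_max (U_hat p * transpose_mat (U_hat p) * observed p - signal p) + 2 * \<eta>"
    if Q: "Q \<in> carrier_mat n k" "orthonormal_cols Q" for Q
  proof (rule norm_max_diff_le[OF _ _ M n])
    show "Q * Q\<^sup>T * observed p \<in> carrier_mat n n" using Q H by auto
    show "U_hat p * transpose_mat (U_hat p) * observed p \<in> carrier_mat n n" using Uh H by auto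
    fix i j assume ij: "i < n" "j < n"
    show "\<bar>(Q * Q\<^sup>T * observed p) $$ (i, j) - (U_hat p * transpose_mat (U_hat p) * observed p) $$ (i, j)\<bar> \<le> 2 * \<eta>"
      using entry[OF Q ij] entry[OF Uh ij] by linarith
  qed
  have Q: "Q \<in> carrier_mat n k" "orthonormal_cols Q" if "rsvd_output (observed p) k g (Matrix.mat n m \<omega>) Q" for g \<omega> Q
  proof -
    have Hc: "observed p ^\<^sub>m g * Matrix.mat n m \<omega> \<in> carrier_mat n m" using H by auto
    show "Q \<in> carrier_mat n k" "orthonormal_cols Q"
      using leading_left_sv_orthonormal[OF _ Hc] that by (auto simp: rsvd_output_def)
  qed
  interpret prob_space "gaussian_entries n m" by (rule prob_space_gaussian_entries)
  have pr: "1 - a * real n powr (- 3) - 2 * exp (- real n / 2) \<le> prob (space (gaussian_entries n m))" if "0 \<le> a" for a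
  proof -
    have "0 \<le> a * real n powr (- 3)" "0 \<le> exp (- real n / 2)" using that by auto
    thus ?thesis unfolding prob_space by linarith
  qed
  have "subspace_bound p g (max 2 (2 * \<eta>))" for g
    unfolding subspace_bound_def gaussian_prob_ge_def n_def[symmetric] m_def[symmetric] k_def[symmetric]
  proof (intro bexI[of _ "space (gaussian_entries n m)"] conjI ballI allI impI pr)
    fix \<omega> Ug assume "rsvd_output (observed p) k g (Matrix.mat n m \<omega>) Ug"
    thus "d_2inf Ug (U_signal p) \<le> d_2inf (U_hat p) (U_signal p) + max 2 (2 * \<eta>)"
      using d[OF Q] by fastforce
  qed auto
  moreover have "lowrank_bound p g (max 2 (2 * \<eta>))" for g
    unfolding lowrank_bound_def gaussian_prob_ge_def n_def[symmetric] m_def[symmetric] k_def[symmetric]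
  proof (intro bexI[of _ "space (gaussian_entries n m)"] conjI ballI allI impI pr)
    fix \<omega> Ug assume "rsvd_output (observed p) k g (Matrix.mat n m \<omega>) Ug"
    thus "norm_max (Ug * Ug\<^sup>T * observed p - signal p)
        \<le> norm_max (U_hat p * transpose_mat (U_hat p) * observed p - signal p) + max 2 (2 * \<eta>)"
      using l[OF Q] by fastforce
  qed auto
  ultimately show ?thesis by blast
qed

lemma max3_diff_le:
  fixes a b c a' b' c' d :: real
  assumes "\<bar>a - a'\<bar> \<le> d" "\<bar>b - b'\<bar> \<le> d" "\<bar>c - c'\<bar> \<le> d"
  shows "\<bar>max a (max b c) - max a' (max b' c')\<bar> \<le> d"
  using assms unfolding max_def by (auto split: if_splits)

lemma g_star_simple_diff:
  assumes valid: "valid_problem c p" and c: "0 < c" "c < 1"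
  defines "L \<equiv> ln (1 / 2 * sigma_min p / noise_level p)" and "N \<equiv> ln (real (dim_n p))"
  shows "0 < L" "\<bar>g_star p - g_star_simple p\<bar> \<le> N / L\<^sup>2 + ln N / L"
proof -
  note f = valid_problem_facts[OF valid c]
  define n where "n = real (dim_n p)"
  define k where "k = real (rank_k p)"
  define m where "m = real (sketch_k p)"
  define u where "u = norm_2inf (U_signal p)"
  define L' where "L' = ln (sigma_min p / noise_level p)"
  have E: "0 < noise_level p" "2 * noise_level p < sigma_min p" using valid by (auto simp: valid_problem_def)
  have s: "0 < sigma_min p" using E by linarith
  show L: "0 < L" unfolding L_def using E by (subst ln_gt_zero_iff) (auto simp: field_simps)
  have n: "4 \<le> n" "1 \<le> N" and k: "1 \<le> k" "k \<le> n" and m: "0 < m" "m \<le> n" "1 \<le> m"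
    using f by (auto simp: n_def k_def m_def N_def)
  have Nn: "N = ln n" by (simp add: N_def n_def)
  have LL: "L' = L + ln 2"
    unfolding L_def L'_def using E s by (simp add: ln_div ln_mult)
  have L'0: "L \<le> L'" "0 < L'" using LL L ln2_ge_two_thirds by linarith+
  have M: "signal p \<in> carrier_mat (dim_n p) (dim_n p)" and lU: "leading_left_sv (rank_k p) (signal p) (U_signal p)"
    using valid by (auto simp: valid_problem_def)
  have "1 \<le> u * sqrt n" "u \<le> 1" unfolding u_def n_def
    using f(1) by (auto intro!: norm_2inf_orthonormal_bounds[OF leading_left_sv_orthonormal(1,2)[OF lU M] f(3)])
  note u = this
  have sn: "0 < sqrt n" "sqrt n * sqrt n = n" "sqrt n \<le> n" using n by (auto simp: real_le_lsqrt power2_eq_square)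
  have u0: "0 < u" using u(1) sn by (smt (verit) zero_less_mult_pos2)
  have n32: "n powr (3/2) = n * sqrt n"
    using n powr_add[of n 1 "1/2"] by (simp add: powr_half_sqrt)
  have ln_range: "\<bar>ln x\<bar> \<le> 2 * N" if "1 \<le> x" "x \<le> n\<^sup>2" for x
  proof -
    have "ln x \<le> ln (n\<^sup>2)" using that by (intro ln_mono) auto
    thus ?thesis using that n by (simp add: Nn ln_realpow)
  qed
  have nn: "n * sqrt n \<le> n\<^sup>2" using sn n by (simp add: power2_eq_square)
  have b1: "\<bar>ln (n * k / m)\<bar> \<le> 2 * N"
  proof (rule ln_range)
    show "1 \<le> n * k / m" using n k m mult_mono[of m n 1 k] by (simp add: le_divide_eq)
    have "n * k / m \<le> n * k / 1" using n k m by (intro divide_left_mono) auto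
    also have "\<dots> \<le> n\<^sup>2" using k n by (simp add: power2_eq_square)
    finally show "n * k / m \<le> n\<^sup>2" .
  qed
  have sn1: "1 \<le> sqrt n" using n by simp
  have b2: "\<bar>ln (n powr (3/2) / m)\<bar> \<le> 2 * N"
  proof (rule ln_range)
    show "1 \<le> n powr (3/2) / m" unfolding n32 using n m sn1 mult_mono[of m n 1 "sqrt n"] by (simp add: le_divide_eq)
    have "n * sqrt n / m \<le> n * sqrt n / 1" using n m sn by (intro divide_left_mono) auto
    thus "n powr (3/2) / m \<le> n\<^sup>2" unfolding n32 using nn by simp
  qed
  have b3: "\<bar>ln (n powr (3/2) * u / m)\<bar> \<le> 2 * N"
  proof (rule ln_range)
    have "m * 1 \<le> n * (u * sqrt n)" using n m u by (intro mult_mono) auto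
    thus "1 \<le> n powr (3/2) * u / m" unfolding n32 using m by (simp add: le_divide_eq ac_simps)
    have "n * sqrt n * u / m \<le> n * sqrt n * 1 / 1" using n m u u0 sn by (intro frac_le mult_left_mono) auto
    thus "n powr (3/2) * u / m \<le> n\<^sup>2" unfolding n32 using nn by simp
  qed
  have lN: "0 \<le> ln N" using n by simp
  have diff: "\<bar>(\<beta> + (x + y) / (\<alpha> * L)) - (\<beta> + x / (\<alpha> * L'))\<bar> \<le> N / L\<^sup>2 + ln N / L"
    if x: "\<bar>x\<bar> \<le> 2 * N" and y: "0 \<le> y" "y \<le> ln N" and \<alpha>: "2 \<le> \<alpha>" for x y \<alpha> \<beta> :: real
  proof -
    have aL: "0 < \<alpha> * L" "0 < \<alpha> * L'" using \<alpha> L L'0 by auto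
    have eq: "(\<beta> + (x + y) / (\<alpha> * L)) - (\<beta> + x / (\<alpha> * L')) = x * ln 2 / (\<alpha> * (L * L')) + y / (\<alpha> * L)"
      using \<alpha> L L'0 LL by (simp add: divide_simps) (simp add: algebra_simps)
    have "\<bar>x * ln 2 / (\<alpha> * (L * L'))\<bar> = \<bar>x\<bar> * ln 2 / (\<alpha> * (L * L'))" using \<alpha> L L'0 by (simp add: abs_mult)
    also have "\<dots> \<le> (2 * N) * 1 / (2 * (L * L))"
    proof (rule frac_le)
      show "\<bar>x\<bar> * ln 2 \<le> (2 * N) * 1" using x ln_2_less_1 n by (intro mult_mono) auto
      show "2 * (L * L) \<le> \<alpha> * (L * L')" using \<alpha> L L'0 by (intro mult_mono) auto
    qed (use n L in auto)
    finally have t1: "\<bar>x * ln 2 / (\<alpha> * (L * L'))\<bar> \<le> N / L\<^sup>2" by (simp add: power2_eq_square)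
    have "y / (\<alpha> * L) \<le> ln N / (1 * L)" using y \<alpha> L lN by (intro frac_le mult_right_mono) auto
    hence t2: "\<bar>y / (\<alpha> * L)\<bar> \<le> ln N / L" using y aL by simp
    show ?thesis unfolding eq using t1 t2 by linarith
  qed
  have gs: "g_star p = max (1 + (ln (n * k / m) + ln N) / (2 * L)) (max (1 / 3 + (ln (n powr (3 / 2) / m) + 1 / 2 * ln N) / (3 * L))
      (1 / 2 + (ln (n powr (3 / 2) * u / m) + 0) / (2 * L)))"
    unfolding g_star_def Let_def L_def n_def k_def m_def u_def N_def by simp
  have gs': "g_star_simple p = max (1 + ln (n * k / m) / (2 * L')) (max (1 / 3 + ln (n powr (3 / 2) / m) / (3 * L'))
      (1 / 2 + ln (n powr (3 / 2) * u / m) / (2 * L')))"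
    unfolding g_star_simple_def Let_def L'_def n_def k_def m_def u_def by simp
  show "\<bar>g_star p - g_star_simple p\<bar> \<le> N / L\<^sup>2 + ln N / L"
    unfolding gs gs' using lN by (intro max3_diff_le diff b1 b2 b3) auto
qed

lemma smallo_mult_null:
  fixes f g :: "nat \<Rightarrow> real"
  assumes "f \<longlonglongrightarrow> 0" and "eventually (\<lambda>i. h i = f i * g i) sequentially"
  shows "h \<in> o(g)"
proof (rule landau_o.smallI)
  fix c :: real assume c: "0 < c"
  have "eventually (\<lambda>i. dist (f i) 0 < c) sequentially" using assms(1) c by (rule tendstoD)
  with assms(2) show "eventually (\<lambda>i. norm (h i) \<le> c * norm (g i)) sequentially"
  proof eventually_elim
    case (elim i)
    thus ?case by (simp add: abs_mult mult_right_mono)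
  qed
qed

lemma powr_tendsto_zero:
  fixes r :: "nat \<Rightarrow> real"
  assumes "r \<longlonglongrightarrow> 0" "\<And>i. 0 < r i" "0 < \<Delta>"
  shows "(\<lambda>i. C * r i powr \<Delta>) \<longlonglongrightarrow> 0"
proof -
  have "(\<lambda>i. r i powr \<Delta>) \<longlonglongrightarrow> 0 powr \<Delta>"
    using assms by (intro tendsto_powr2 tendsto_const always_eventually) (auto intro: less_imp_le)
  thus ?thesis using assms(3) by (intro tendsto_mult_right_zero) simp
qed

lemma power_gap_asymptotics:
  assumes seq: "problem_sequence c P" and c: "0 < c" "c < 1" and \<epsilon>: "0 < \<epsilon>"
    and gap: "(\<lambda>i. sigma_min (P i) / noise_level (P i)) \<in> \<Omega>(\<lambda>i. real (dim_n (P i)) powr \<epsilon>)"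
  shows "(\<lambda>i. g_star (P i) - g_star_simple (P i)) \<longlonglongrightarrow> 0" "(\<lambda>i. noise_ratio (P i)) \<longlonglongrightarrow> 0"
proof -
  have valid: "valid_problem c (P i)" for i using seq by (auto simp: problem_sequence_def)
  have n_top: "filterlim (\<lambda>i. dim_n (P i)) at_top sequentially" using seq by (auto simp: problem_sequence_def)
  define N where "N i = ln (real (dim_n (P i)))" for i
  define L where "L i = ln (1 / 2 * sigma_min (P i) / noise_level (P i))" for i
  have rn: "filterlim (\<lambda>i. real (dim_n (P i))) at_top sequentially"
    by (rule filterlim_compose[OF filterlim_real_sequentially n_top])
  have N_top: "filterlim N at_top sequentially"
    unfolding N_def by (rule filterlim_compose[OF ln_at_top rn])
  obtain a where a: "0 < a"
    "eventually (\<lambda>i. a * norm (real (dim_n (P i)) powr \<epsilon>) \<le> norm (sigma_min (P i) / noise_level (P i))) sequentially"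
    using landau_omega.bigE[OF gap] by auto
  have E: "0 < noise_level (P i)" "2 * noise_level (P i) < sigma_min (P i)" for i
    using valid[of i] by (auto simp: valid_problem_def)
  have n4: "4 \<le> dim_n (P i)" and N1: "1 \<le> N i" for i
    using valid_problem_facts(1,2)[OF valid c, of i] by (auto simp: N_def)
  have "eventually (\<lambda>i. 2 / \<epsilon> * \<bar>ln (a / 2)\<bar> \<le> N i) sequentially"
    using N_top unfolding filterlim_at_top by blast
  with a(2) have LN: "eventually (\<lambda>i. \<epsilon> / 2 * N i \<le> L i) sequentially"
  proof eventually_elim
    case (elim i)
    have s: "0 < sigma_min (P i)" using E[of i] by linarith
    have "a * real (dim_n (P i)) powr \<epsilon> \<le> sigma_min (P i) / noise_level (P i)" using elim(1) E[of i] s by simp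
    hence "a / 2 * real (dim_n (P i)) powr \<epsilon> \<le> 1 / 2 * sigma_min (P i) / noise_level (P i)" by simp
    moreover have "0 < a / 2 * real (dim_n (P i)) powr \<epsilon>" using a(1) n4[of i] by simp
    ultimately have "ln (a / 2 * real (dim_n (P i)) powr \<epsilon>) \<le> L i" unfolding L_def using ln_mono by blast
    moreover have "ln (a / 2 * real (dim_n (P i)) powr \<epsilon>) = ln (a / 2) + \<epsilon> * N i"
      using a(1) n4[of i] ln_mult_pos[of "a / 2" "real (dim_n (P i)) powr \<epsilon>"] by (simp add: N_def)
    moreover have "\<bar>ln (a / 2)\<bar> \<le> \<epsilon> / 2 * N i" using elim(2) \<epsilon> by (simp add: field_simps)
    ultimately show ?case by linarith
  qed
  have inv0: "(\<lambda>i. inverse (N i)) \<longlonglongrightarrow> 0"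
    by (rule filterlim_compose[OF tendsto_inverse_0_at_top[OF filterlim_ident] N_top])
  have ln0: "(\<lambda>i. ln (N i) / N i) \<longlonglongrightarrow> 0"
    by (rule filterlim_compose[OF ln_x_over_x_tendsto_0 N_top])
  have lim: "(\<lambda>i. 4 / \<epsilon>\<^sup>2 * inverse (N i) + 2 / \<epsilon> * (ln (N i) / N i)) \<longlonglongrightarrow> 0"
    using tendsto_add[OF tendsto_mult_right_zero[OF inv0, of "4 / \<epsilon>\<^sup>2"] tendsto_mult_right_zero[OF ln0, of "2 / \<epsilon>"]] by simp
  show "(\<lambda>i. g_star (P i) - g_star_simple (P i)) \<longlonglongrightarrow> 0"
  proof (rule Lim_null_comparison[OF _ lim])
    show "eventually (\<lambda>i. norm (g_star (P i) - g_star_simple (P i)) \<le> 4 / \<epsilon>\<^sup>2 * inverse (N i) + 2 / \<epsilon> * (ln (N i) / N i)) sequentially"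
      using LN
    proof eventually_elim
      case (elim i)
      have eN: "0 < \<epsilon> / 2 * N i" using \<epsilon> N1[of i] by simp
      have L0: "0 < L i" using elim eN by linarith
      have "N i / (L i)\<^sup>2 \<le> N i / (\<epsilon> / 2 * N i)\<^sup>2"
        using elim eN L0 N1[of i] \<epsilon> by (intro divide_left_mono power_mono mult_pos_pos zero_less_power) auto
      also have "\<dots> = 4 / \<epsilon>\<^sup>2 * inverse (N i)"
        using \<epsilon> N1[of i] by (simp add: power2_eq_square field_simps)
      finally have "N i / (L i)\<^sup>2 \<le> 4 / \<epsilon>\<^sup>2 * inverse (N i)" .
      moreover have "ln (N i) / L i \<le> ln (N i) / (\<epsilon> / 2 * N i)"
        using elim eN L0 N1[of i] \<epsilon> by (intro divide_left_mono mult_pos_pos) auto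
      moreover have "ln (N i) / (\<epsilon> / 2 * N i) = 2 / \<epsilon> * (ln (N i) / N i)" by simp
      ultimately show ?case
        using g_star_simple_diff(2)[OF valid c, of i, folded N_def L_def] unfolding real_norm_def by linarith
    qed
  qed
  have "filterlim (\<lambda>i. \<epsilon> / 2 * N i) at_top sequentially"
    using \<epsilon> by (intro filterlim_tendsto_pos_mult_at_top[OF tendsto_const _ N_top]) simp
  hence "filterlim L at_top sequentially" using LN by (rule filterlim_at_top_mono)
  hence "(\<lambda>i. exp (- L i)) \<longlonglongrightarrow> 0"
    by (intro filterlim_compose[OF exp_at_bot] filterlim_compose[OF filterlim_uminus_at_bot_at_top])
  moreover have "exp (- L i) = noise_ratio (P i)" for i
    unfolding L_def noise_ratio_def exp_minus using E[of i] by simp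
  ultimately show "(\<lambda>i. noise_ratio (P i)) \<longlonglongrightarrow> 0" by simp
qed

theorem corollary3:
  fixes c_gap :: real
  assumes "0 < c_gap" and "c_gap < 1"
  shows
    "\<exists>C>0.
      (\<forall>p g. valid_problem c_gap p \<and> 1 \<le> g \<and> g_star p \<le> real g \<longrightarrow>
         subspace_bound p g (C * subspace_rate p)) \<and>
      (\<forall>p g. valid_problem c_gap p \<and> 1 \<le> g \<and> g_star p \<le> real g \<longrightarrow>
         lowrank_bound p g (C * lowrank_rate p)) \<and>
      (\<forall>P. problem_sequence c_gap P \<and>
           (\<lambda>i. sigma_min (P i)) \<in> \<omega>(\<lambda>i. noise_level (P i)) \<longrightarrow>
         (\<forall>\<Delta>>0.
           (\<exists>e \<in> o(\<lambda>i. subspace_rate (P i)). \<forall>i g.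
              1 \<le> g \<and> g_star (P i) + \<Delta> \<le> real g \<longrightarrow> subspace_bound (P i) g (e i)) \<and>
           (\<exists>e \<in> o(\<lambda>i. lowrank_rate (P i)). \<forall>i g.
              1 \<le> g \<and> g_star (P i) + \<Delta> \<le> real g \<longrightarrow> lowrank_bound (P i) g (e i)))) \<and>
      (\<forall>P \<epsilon>. problem_sequence c_gap P \<and> \<epsilon> > 0 \<and>
           (\<lambda>i. sigma_min (P i) / noise_level (P i)) \<in> \<Omega>(\<lambda>i. real (dim_n (P i)) powr \<epsilon>) \<longrightarrow>
         (\<exists>\<eta>. \<eta> \<longlonglongrightarrow> 0 \<and> (\<forall>i. g_star (P i) = g_star_simple (P i) + \<eta> i) \<and>
           (\<forall>i g. 1 \<le> g \<and> g_star_simple (P i) + \<eta> i \<le> real g \<longrightarrow>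
              subspace_bound (P i) g (C * subspace_rate (P i)) \<and>
              lowrank_bound (P i) g (C * lowrank_rate (P i)))) \<and>
         (\<forall>\<Delta>>0.
           (\<exists>e \<in> o(\<lambda>i. subspace_rate (P i)). \<forall>i g.
              1 \<le> g \<and> g_star_simple (P i) + \<Delta> \<le> real g \<longrightarrow> subspace_bound (P i) g (e i)) \<and>
           (\<exists>e \<in> o(\<lambda>i. lowrank_rate (P i)). \<forall>i g.
              1 \<le> g \<and> g_star_simple (P i) + \<Delta> \<le> real g \<longrightarrow> lowrank_bound (P i) g (e i))))"
proof -
  note c = assms
  define K where "K = 2562 / (small_ball_level c_gap / 4) ^ 3"
  define C where "C = 16 * K + (2 + K) * K"
  have K: "0 < K" using small_ball_level(1)[OF c(1)] by (simp add: K_def)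
  have "C = 18 * K + K * K" by (simp add: C_def algebra_simps)
  moreover have "0 < K * K" using K by simp
  ultimately have C: "0 < C" "2 * K \<le> C" using K by linarith+
  have core: "subspace_bound p g (C * noise_ratio p powr \<Delta> * subspace_rate p)"
    "lowrank_bound p g (C * noise_ratio p powr \<Delta> * lowrank_rate p)"
    if "valid_problem c_gap p" "0 \<le> \<Delta>" "g_star p + \<Delta> \<le> real g" for p \<Delta> g
  proof -
    note b = sketch_bounds[OF c that, folded K_def, folded C_def]
    have "2 * K * noise_ratio p powr \<Delta> * subspace_rate p \<le> C * noise_ratio p powr \<Delta> * subspace_rate p"
      using C valid_problem_rates_nonneg(1)[OF that(1) c] by (intro mult_right_mono) auto
    thus "subspace_bound p g (C * noise_ratio p powr \<Delta> * subspace_rate p)"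
      by (rule subspace_bound_mono[OF b(1)])
    show "lowrank_bound p g (C * noise_ratio p powr \<Delta> * lowrank_rate p)" by (rule b(2))
  qed
  have core0: "subspace_bound p g (C * subspace_rate p)" "lowrank_bound p g (C * lowrank_rate p)"
    if "valid_problem c_gap p" "g_star p \<le> real g" for p g
    using core[of p 0 g] that valid_problem_rates_nonneg(3)[OF that(1) c] by auto
  have part3: "\<exists>e \<in> o(\<lambda>i. subspace_rate (P i)). \<forall>i g. g_star (P i) + \<Delta> \<le> real g \<longrightarrow> subspace_bound (P i) g (e i)"
    "\<exists>e \<in> o(\<lambda>i. lowrank_rate (P i)). \<forall>i g. g_star (P i) + \<Delta> \<le> real g \<longrightarrow> lowrank_bound (P i) g (e i)"
    if seq: "problem_sequence c_gap P" and om: "(\<lambda>i. sigma_min (P i)) \<in> \<omega>(\<lambda>i. noise_level (P i))" and \<Delta>: "0 < \<Delta>" for P \<Delta>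
  proof -
    have valid: "valid_problem c_gap (P i)" for i using seq by (auto simp: problem_sequence_def)
    have "(\<lambda>i. noise_level (P i)) \<in> o(\<lambda>i. sigma_min (P i))"
      using om by (simp add: smallomega_iff_smallo)
    hence "(\<lambda>i. noise_level (P i) / sigma_min (P i)) \<longlonglongrightarrow> 0" by (rule smalloD_tendsto)
    hence "(\<lambda>i. 2 * (noise_level (P i) / sigma_min (P i))) \<longlonglongrightarrow> 0" by (rule tendsto_mult_right_zero)
    hence r: "(\<lambda>i. noise_ratio (P i)) \<longlonglongrightarrow> 0" by (simp add: noise_ratio_def)
    have z: "(\<lambda>i. C * noise_ratio (P i) powr \<Delta>) \<longlonglongrightarrow> 0"
      using valid_problem_rates_nonneg(3)[OF valid c] by (intro powr_tendsto_zero[OF r _ \<Delta>])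
    show "\<exists>e \<in> o(\<lambda>i. subspace_rate (P i)). \<forall>i g. g_star (P i) + \<Delta> \<le> real g \<longrightarrow> subspace_bound (P i) g (e i)"
      using core(1)[OF valid less_imp_le[OF \<Delta>]]
      by (intro bexI[of _ "\<lambda>i. C * noise_ratio (P i) powr \<Delta> * subspace_rate (P i)"] smallo_mult_null[OF z]) auto
    show "\<exists>e \<in> o(\<lambda>i. lowrank_rate (P i)). \<forall>i g. g_star (P i) + \<Delta> \<le> real g \<longrightarrow> lowrank_bound (P i) g (e i)"
      using core(2)[OF valid less_imp_le[OF \<Delta>]]
      by (intro bexI[of _ "\<lambda>i. C * noise_ratio (P i) powr \<Delta> * lowrank_rate (P i)"] smallo_mult_null[OF z]) auto
  qed
  have part4: "\<exists>e \<in> o(\<lambda>i. subspace_rate (P i)). \<forall>i g. g_star_simple (P i) + \<Delta> \<le> real g \<longrightarrow> subspace_bound (P i) g (e i)"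
    "\<exists>e \<in> o(\<lambda>i. lowrank_rate (P i)). \<forall>i g. g_star_simple (P i) + \<Delta> \<le> real g \<longrightarrow> lowrank_bound (P i) g (e i)"
    if seq: "problem_sequence c_gap P" and \<epsilon>: "0 < \<epsilon>"
      and gap: "(\<lambda>i. sigma_min (P i) / noise_level (P i)) \<in> \<Omega>(\<lambda>i. real (dim_n (P i)) powr \<epsilon>)"
      and \<Delta>: "0 < \<Delta>" for P \<epsilon> \<Delta>
  proof -
    have valid: "valid_problem c_gap (P i)" for i using seq by (auto simp: problem_sequence_def)
    note as = power_gap_asymptotics[OF seq c \<epsilon> gap]
    have \<Delta>2: "0 < \<Delta> / 2" using \<Delta> by simp
    have z: "(\<lambda>i. C * noise_ratio (P i) powr (\<Delta> / 2)) \<longlonglongrightarrow> 0"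
      using valid_problem_rates_nonneg(3)[OF valid c] by (intro powr_tendsto_zero[OF as(2) _ \<Delta>2])
    obtain B where B: "\<And>i g. subspace_bound (P i) g (B i) \<and> lowrank_bound (P i) g (B i)"
      using crude_bounds[OF valid c] by metis
    define near where "near i \<longleftrightarrow> g_star (P i) \<le> g_star_simple (P i) + \<Delta> / 2" for i
    have "eventually (\<lambda>i. dist (g_star (P i) - g_star_simple (P i)) 0 < \<Delta> / 2) sequentially"
      by (rule tendstoD[OF as(1) \<Delta>2])
    hence near: "eventually near sequentially"
    proof eventually_elim
      case (elim i)
      thus ?case unfolding near_def dist_real_def by linarith
    qed
    let ?e = "\<lambda>rate i. if near i then C * noise_ratio (P i) powr (\<Delta> / 2) * rate (P i) else B i"
    have small: "(\<lambda>i. ?e rate i) \<in> o(\<lambda>i. rate (P i))" for rate :: "rsvd_problem \<Rightarrow> real"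
      by (rule smallo_mult_null[OF z]) (use near in eventually_elim, simp)
    have sb: "subspace_bound (P i) g (?e subspace_rate i)" and lb: "lowrank_bound (P i) g (?e lowrank_rate i)"
      if "g_star_simple (P i) + \<Delta> \<le> real g" for i g
    proof -
      have *: "g_star (P i) + \<Delta> / 2 \<le> real g" if "near i"
        using that \<open>g_star_simple (P i) + \<Delta> \<le> real g\<close> by (simp add: near_def)
      show "subspace_bound (P i) g (?e subspace_rate i)" "lowrank_bound (P i) g (?e lowrank_rate i)"
        using core[OF valid less_imp_le[OF \<Delta>2] *] B[of i g] by (cases "near i"; simp)+
    qed
    show "\<exists>e \<in> o(\<lambda>i. subspace_rate (P i)). \<forall>i g. g_star_simple (P i) + \<Delta> \<le> real g \<longrightarrow> subspace_bound (P i) g (e i)"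
      by (rule bexI[OF _ small[of subspace_rate]]) (intro allI impI sb)
    show "\<exists>e \<in> o(\<lambda>i. lowrank_rate (P i)). \<forall>i g. g_star_simple (P i) + \<Delta> \<le> real g \<longrightarrow> lowrank_bound (P i) g (e i)"
      by (rule bexI[OF _ small[of lowrank_rate]]) (intro allI impI lb)
  qed
  have part4a: "\<exists>\<eta>. \<eta> \<longlonglongrightarrow> 0 \<and> (\<forall>i. g_star (P i) = g_star_simple (P i) + \<eta> i) \<and>
      (\<forall>i g. 1 \<le> g \<and> g_star_simple (P i) + \<eta> i \<le> real g \<longrightarrow>
        subspace_bound (P i) g (C * subspace_rate (P i)) \<and> lowrank_bound (P i) g (C * lowrank_rate (P i)))"
    if seq: "problem_sequence c_gap P" and \<epsilon>: "0 < \<epsilon>"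
      and gap: "(\<lambda>i. sigma_min (P i) / noise_level (P i)) \<in> \<Omega>(\<lambda>i. real (dim_n (P i)) powr \<epsilon>)" for P \<epsilon>
    using power_gap_asymptotics(1)[OF seq c \<epsilon> gap] core0 seq
    by (intro exI[of _ "\<lambda>i. g_star (P i) - g_star_simple (P i)"]) (auto simp: problem_sequence_def)
  show ?thesis
  proof (intro exI[of _ C] conjI allI impI C(1); (elim conjE)?)
    fix p g assume "valid_problem c_gap p" "g_star p \<le> real g"
    thus "subspace_bound p g (C * subspace_rate p)" "lowrank_bound p g (C * lowrank_rate p)"
      by (rule core0)+
  next
    fix P and \<Delta> :: real
    assume *: "problem_sequence c_gap P" "(\<lambda>i. sigma_min (P i)) \<in> \<omega>(\<lambda>i. noise_level (P i))" "0 < \<Delta>"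
    show "\<exists>e \<in> o(\<lambda>i. subspace_rate (P i)). \<forall>i g. 1 \<le> g \<and> g_star (P i) + \<Delta> \<le> real g \<longrightarrow> subspace_bound (P i) g (e i)"
      using part3(1)[OF *] by blast
    show "\<exists>e \<in> o(\<lambda>i. lowrank_rate (P i)). \<forall>i g. 1 \<le> g \<and> g_star (P i) + \<Delta> \<le> real g \<longrightarrow> lowrank_bound (P i) g (e i)"
      using part3(2)[OF *] by blast
  next
    fix P and \<epsilon> :: real
    assume *: "problem_sequence c_gap P" "0 < \<epsilon>"
      "(\<lambda>i. sigma_min (P i) / noise_level (P i)) \<in> \<Omega>(\<lambda>i. real (dim_n (P i)) powr \<epsilon>)"
    show "\<exists>\<eta>. \<eta> \<longlonglongrightarrow> 0 \<and> (\<forall>i. g_star (P i) = g_star_simple (P i) + \<eta> i) \<and>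
      (\<forall>i g. 1 \<le> g \<and> g_star_simple (P i) + \<eta> i \<le> real g \<longrightarrow>
        subspace_bound (P i) g (C * subspace_rate (P i)) \<and> lowrank_bound (P i) g (C * lowrank_rate (P i)))"
      by (rule part4a[OF *])
    fix \<Delta> :: real assume \<Delta>: "0 < \<Delta>"
    show "\<exists>e \<in> o(\<lambda>i. subspace_rate (P i)). \<forall>i g. 1 \<le> g \<and> g_star_simple (P i) + \<Delta> \<le> real g \<longrightarrow> subspace_bound (P i) g (e i)"
      using part4(1)[OF * \<Delta>] by blast
    show "\<exists>e \<in> o(\<lambda>i. lowrank_rate (P i)). \<forall>i g. 1 \<le> g \<and> g_star_simple (P i) + \<Delta> \<le> real g \<longrightarrow> lowrank_bound (P i) g (e i)"
      using part4(2)[OF * \<Delta>] by blast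
  qed
qed

end
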